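(* Let $\Pi$ be the preprojective algebra of type $D_n$ ($n\ge4$) and $W$ its Weyl group. Let $w=[i_1,\ldots,i_n]\in W$ be a join-irreducible element of type $\ell=\pm1$. Then $J(w)$ is the factor module of $P_\ell$ which has the form $$J(w)=\begin{array}{|ccccc|}\hline i'_2&&&&\\ \hline 2&i'_3&&&\\ \hline 3&\cdots&i'_4&&\\ \hline \vdots&\vdots&\vdots&\ddots&\\ \hline n-2&n-3&\cdots&\cdots&i'_{n-1}\\ \hline n-1&n-2&\cdots&i'_n&\\ \hline\end{array}$$ where $i'_m:=\max\{i_m,(-1)^m\ell\}$ for $m\in\{2,\ldots,n\}$. That is, for each $m\in\{2,\ldots,n\}$, row $m-1$ of $J(w)$ consists of the entries of row $m-1$ of $P_\ell$ from the first entry up to and including the entry $i'_m$ (the row is empty if $i'_m=m$).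
   Context: $\Pi$ is the preprojective algebra of type $D_n$ over a field $k$: the path algebra of the quiver with vertices $-1,1,2,\ldots,n-1$ and arrows $x_1:1\to2$, $x'_1:-1\to2$, $y_2:2\to1$, $y'_2:2\to-1$, $x_i:i\to i+1$ ($2\le i\le n-2$), $y_i:i\to i-1$ ($3\le i\le n-1$), with relations (paths read from left to right) $x_1y_2=0$, $x'_1y'_2=0$, $x_2y_3=y_2x_1+y'_2x'_1$, $x_iy_{i+1}=y_ix_{i-1}$ for $3\le i\le n-2$, $y_{n-1}x_{n-2}=0$. Modules are finite-dimensional left modules, viewed as representations of this quiver with relations; $e_i$ is the idempotent at vertex $i$ and $P_\ell=\Pi e_\ell$. $W$ is the group of permutations $w$ of $\{\pm1,\ldots,\pm n\}$ with $w(-i)=-w(i)$ and an even number of $i\in\{1,\ldots,n\}$ with $w(i)<0$; product $(ww')(i)=w(w'(i))$; write $w=[i_1,\ldots,i_n]$ with $i_m=w(m)$. Simple reflections: $s_{-1}=[-2,-1,3,\ldots,n]$ and $s_m=[1,\ldots,m-1,m+1,m,m+2,\ldots,n]$ for $1\le m\le n-1$. $W$ carries the right weak order ($u\ge v$ iff $\ell(u)=\ell(v)+\ell(v^{-1}u)$ for the length function $\ell(\cdot)$). A join-irreducible element (one covering exactly one element) $w=[i_1,\ldots,i_n]$ is of type $-1$ if $i_1<\cdots<i_n$ and $-i_1>i_2$; it is of type $\ell\in\{1,\ldots,n-1\}$ if $i_1<\cdots<i_\ell>i_{\ell+1}<\cdots<i_n$ and $-i_1<i_2$. Every join-irreducible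 element has exactly one type $\ell$, and then covers only $ws_\ell$. Let $I_i=\Pi(1-e_i)\Pi$ and, for a reduced word $w=s_{j_1}\cdots s_{j_m}$, $I(w)=I_{j_1}\cdots I_{j_m}$ (independent of the reduced word). For $w$ join-irreducible of type $\ell$, $J(w):=(\Pi/I(w))e_\ell$. For $\ell=\pm1$, $P_\ell$ is represented by a triangular array with rows $r=1,\ldots,n-1$ and columns $c=1,\ldots,r$ in row $r$, whose $(r,c)$ entry is $r+1-c$ if $c<r$ and $(-1)^{r-1}\ell$ if $c=r$ (so row $1$ is $\ell$, row $2$ is $2,-\ell$, row $3$ is $3,2,\ell$, etc.). This means $P_\ell$ has a basis $b_{r,c}$ indexed by the array, $b_{r,c}$ lying on the vertex given by the entry, generated by $b_{1,1}$, with quiver arrows acting by $b_{r,c}\mapsto b_{r+1,c}$ (if $r<n-1$) and $b_{r,c}\mapsto b_{r,c+1}$ (if $c<r$), each by the quiver arrow between the corresponding vertices, all other actions being zero. Factor modules of $P_\ell$ correspond to subarrays closed under predecessors: the factor module is the quotient by the span of the $b_{r,c}$ not in the subarray. It holds that $i'_m\le m$ for all $m\in\{2,\ldots,n\}$. *)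

theory Defs
  imports
    "HOL-Algebra.Embedded_Algebras"
    "HOL-Algebra.Ideal_Product"
    "HOL-Algebra.QuotRing"
    "HOL-Combinatorics.Permutations"
    "Graph_Theory.Arc_Walk"
begin

section \<open>Path algebras\<close>

text \<open>
  A path is given by its starting vertex and its list of arrows, so that \<open>(i, [])\<close> is the trivial
  path at \<open>i\<close>.  An element of the path algebra over \<open>'k\<close> is a finitely supported function on paths.
  Paths are read from left to right: in the product, a path \<open>(u, p)\<close> is split in all possible ways
  into a first part and a second part, the latter starting where the former ends.
\<close>

definition quiver_paths :: "('v, 'a) pre_digraph \<Rightarrow> ('v \<times> 'a list) set" where
  "quiver_paths G = {(u, p). \<exists>v. pre_digraph.awalk G u p v}"

definition path_algebra :: "('v, 'a) pre_digraph \<Rightarrow> ('v \<times> 'a list \<Rightarrow> 'k::field) ring" where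
  "path_algebra G =
    \<lparr> carrier = {f. finite {q. f q \<noteq> 0} \<and> {q. f q \<noteq> 0} \<subseteq> quiver_paths G},
      monoid.mult = (\<lambda>f g (u, p). \<Sum>i\<le>length p.
        f (u, take i p) * g (last (pre_digraph.awalk_verts G u (take i p)), drop i p)),
      one = (\<lambda>(u, p). if u \<in> verts G \<and> p = [] then 1 else 0),
      zero = (\<lambda>_. 0),
      add = (\<lambda>f g q. f q + g q) \<rparr>"

definition path_elem :: "'v \<times> 'a list \<Rightarrow> 'v \<times> 'a list \<Rightarrow> 'k::field" where
  "path_elem p = (\<lambda>q. if q = p then 1 else 0)"

section \<open>The preprojective algebra of type D\<close>

text \<open>\<open>X i\<close>, \<open>X'\<close>, \<open>Y i\<close>, \<open>Y'\<close> stand for the arrows $x_i$, $x'_1$, $y_i$, $y'_2$.\<close>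

datatype arrow = X int | X' | Y int | Y'

fun arrow_tail :: "arrow \<Rightarrow> int" where
  "arrow_tail (X i) = i"
| "arrow_tail X' = -1"
| "arrow_tail (Y i) = i"
| "arrow_tail Y' = 2"

fun arrow_head :: "arrow \<Rightarrow> int" where
  "arrow_head (X i) = i + 1"
| "arrow_head X' = 2"
| "arrow_head (Y i) = i - 1"
| "arrow_head Y' = -1"

definition D_quiver :: "nat \<Rightarrow> (int, arrow) pre_digraph" where
  "D_quiver n =
    \<lparr> verts = {-1} \<union> {1..int n - 1},
      arcs = {X', Y'} \<union> X ` {1..int n - 2} \<union> Y ` {2..int n - 1},
      tail = arrow_tail,
      head = arrow_head \<rparr>"

type_synonym 'k path_elt = "int \<times> arrow list \<Rightarrow> 'k"

definition arrow_path :: "arrow \<Rightarrow> 'k::field path_elt" where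
  "arrow_path a = path_elem (arrow_tail a, [a])"

definition D_relations :: "nat \<Rightarrow> 'k::field path_elt set" where
  "D_relations n =
    (let A = path_algebra (D_quiver n);
         x = (\<lambda>i. arrow_path (X i)); x' = arrow_path X';
         y = (\<lambda>i. arrow_path (Y i)); y' = arrow_path Y'
     in {x 1 \<otimes>\<^bsub>A\<^esub> y 2, x' \<otimes>\<^bsub>A\<^esub> y',
         x 2 \<otimes>\<^bsub>A\<^esub> y 3 \<ominus>\<^bsub>A\<^esub> (y 2 \<otimes>\<^bsub>A\<^esub> x 1 \<oplus>\<^bsub>A\<^esub> y' \<otimes>\<^bsub>A\<^esub> x'),
         y (int n - 1) \<otimes>\<^bsub>A\<^esub> x (int n - 2)}
        \<union> {x i \<otimes>\<^bsub>A\<^esub> y (i + 1) \<ominus>\<^bsub>A\<^esub> y i \<otimes>\<^bsub>A\<^esub> x (i - 1) | i. 3 \<le> i \<and> i \<le> int n - 2})"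

definition D_ideal :: "nat \<Rightarrow> 'k::field path_elt set" where
  "D_ideal n = genideal (path_algebra (D_quiver n)) (D_relations n)"

type_synonym 'k preproj_elt = "'k path_elt set"

definition preproj :: "nat \<Rightarrow> 'k::field preproj_elt ring" where
  "preproj n = path_algebra (D_quiver n) Quot D_ideal n"

definition idem :: "nat \<Rightarrow> int \<Rightarrow> 'k::field preproj_elt" where
  "idem n i = D_ideal n +>\<^bsub>path_algebra (D_quiver n)\<^esub> path_elem (i, [])"

definition arrow_cls :: "nat \<Rightarrow> arrow \<Rightarrow> 'k::field preproj_elt" where
  "arrow_cls n a = D_ideal n +>\<^bsub>path_algebra (D_quiver n)\<^esub> arrow_path a"

text \<open>
  The image of the field in the preprojective algebra.  Linear algebra over the field is the linear
  algebra over this subfield from \<^theory>\<open>HOL-Algebra.Embedded_Algebras\<close>.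
\<close>

definition scalars :: "nat \<Rightarrow> 'k::field preproj_elt set" where
  "scalars n = (let A = path_algebra (D_quiver n) in
     range (\<lambda>c. D_ideal n +>\<^bsub>A\<^esub> (\<lambda>q. c * \<one>\<^bsub>A\<^esub> q)))"

section \<open>The Weyl group\<close>

definition D_weyl :: "nat \<Rightarrow> (int \<Rightarrow> int) set" where
  "D_weyl n = {w. w permutes ({- int n..int n} - {0}) \<and> (\<forall>i. w (- i) = - w i)
                 \<and> even (card {i \<in> {1..int n}. w i < 0})}"

definition simple_refl :: "int \<Rightarrow> int \<Rightarrow> int" where
  "simple_refl i =
    (if i = -1 then transpose 1 (-2) \<circ> transpose 2 (-1)
     else transpose i (i + 1) \<circ> transpose (- i) (- (i + 1)))"

definition word_prod :: "int list \<Rightarrow> int \<Rightarrow> int" where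
  "word_prod js = foldr (\<circ>) (map simple_refl js) id"

definition D_length :: "nat \<Rightarrow> (int \<Rightarrow> int) \<Rightarrow> nat" where
  "D_length n w = (LEAST m. \<exists>js. set js \<subseteq> verts (D_quiver n) \<and> length js = m \<and> word_prod js = w)"

definition reduced_word :: "nat \<Rightarrow> (int \<Rightarrow> int) \<Rightarrow> int list \<Rightarrow> bool" where
  "reduced_word n w js \<longleftrightarrow>
     set js \<subseteq> verts (D_quiver n) \<and> word_prod js = w \<and> length js = D_length n w"

definition weak_le :: "nat \<Rightarrow> (int \<Rightarrow> int) \<Rightarrow> (int \<Rightarrow> int) \<Rightarrow> bool" where
  "weak_le n v u \<longleftrightarrow> v \<in> D_weyl n \<and> u \<in> D_weyl n
     \<and> D_length n u = D_length n v + D_length n (inv_into UNIV v \<circ> u)"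

definition weak_covers :: "nat \<Rightarrow> (int \<Rightarrow> int) \<Rightarrow> (int \<Rightarrow> int) \<Rightarrow> bool" where
  "weak_covers n u v \<longleftrightarrow> weak_le n v u \<and> v \<noteq> u
     \<and> (\<forall>z. weak_le n v z \<and> weak_le n z u \<longrightarrow> z = v \<or> z = u)"

definition join_irreducible :: "nat \<Rightarrow> (int \<Rightarrow> int) \<Rightarrow> bool" where
  "join_irreducible n w \<longleftrightarrow> w \<in> D_weyl n \<and> (\<exists>!v. weak_covers n w v)"

definition has_type :: "nat \<Rightarrow> int \<Rightarrow> (int \<Rightarrow> int) \<Rightarrow> bool" where
  "has_type n l w \<longleftrightarrow>
     l = -1 \<and> strict_mono_on {1..int n} w \<and> - w 1 > w 2
   \<or> l \<in> {1..int n - 1} \<and> strict_mono_on {1..l} w \<and> w l > w (l + 1)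
       \<and> strict_mono_on {l + 1..int n} w \<and> - w 1 < w 2"

section \<open>The ideals and modules attached to elements of the Weyl group\<close>

text \<open>
  \<^const>\<open>ideal_prod\<close> forms the set of sums of products for arbitrary sets of factors, so this
  is $\Pi(1-e_i)\Pi$.
\<close>

definition vertex_ideal :: "nat \<Rightarrow> int \<Rightarrow> 'k::field preproj_elt set" where
  "vertex_ideal n i = (let P = preproj n in
     ideal_prod P (carrier P #>\<^bsub>P\<^esub> (\<one>\<^bsub>P\<^esub> \<ominus>\<^bsub>P\<^esub> idem n i)) (carrier P))"

definition word_ideal :: "nat \<Rightarrow> int list \<Rightarrow> 'k::field preproj_elt set" where
  "word_ideal n js = foldr (ideal_prod (preproj n)) (map (vertex_ideal n) js) (carrier (preproj n))"

text \<open>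
  Left modules over a (noncommutative) ring are represented by the library's module records, whose
  ring multiplication and unit are irrelevant here.
\<close>

definition proj_module :: "nat \<Rightarrow> int \<Rightarrow> ('k::field preproj_elt, 'k preproj_elt) module" where
  "proj_module n l = (let P = preproj n in
     \<lparr> carrier = carrier P #>\<^bsub>P\<^esub> idem n l, monoid.mult = undefined, one = undefined,
       zero = \<zero>\<^bsub>P\<^esub>, add = add P, smult = monoid.mult P \<rparr>)"

text \<open>The module $(\Pi/I)e_\ell$, where $I$ is the ideal of the given word.\<close>

definition J_module :: "nat \<Rightarrow> int \<Rightarrow> int list
    \<Rightarrow> ('k::field preproj_elt, 'k preproj_elt set) module" where
  "J_module n l js = (let P = preproj n; I = word_ideal n js; Q = P Quot I in
     \<lparr> carrier = carrier Q #>\<^bsub>Q\<^esub> (I +>\<^bsub>P\<^esub> idem n l), monoid.mult = undefined, one = undefined,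
       zero = \<zero>\<^bsub>Q\<^esub>, add = add Q, smult = (\<lambda>a x. (I +>\<^bsub>P\<^esub> a) \<otimes>\<^bsub>Q\<^esub> x) \<rparr>)"

definition module_epi :: "('a, 'm) ring_scheme \<Rightarrow> ('a, 'b, 'n) module_scheme
    \<Rightarrow> ('a, 'c, 'o) module_scheme \<Rightarrow> ('b \<Rightarrow> 'c) set" where
  "module_epi R M N = {f. f ` carrier M = carrier N
     \<and> (\<forall>x\<in>carrier M. \<forall>y\<in>carrier M. f (x \<oplus>\<^bsub>M\<^esub> y) = f x \<oplus>\<^bsub>N\<^esub> f y)
     \<and> (\<forall>a\<in>carrier R. \<forall>x\<in>carrier M. f (a \<odot>\<^bsub>M\<^esub> x) = a \<odot>\<^bsub>N\<^esub> f x)}"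

section \<open>Triangular arrays\<close>

definition array_entry :: "int \<Rightarrow> nat \<Rightarrow> nat \<Rightarrow> int" where
  "array_entry l r c = (if c = r then (-1) ^ (r - 1) * l else int r + 1 - int c)"

definition array_positions :: "nat \<Rightarrow> (nat \<times> nat) list" where
  "array_positions n = [(r, c). r \<leftarrow> [1..<n], c \<leftarrow> [1..<Suc r]]"

text \<open>
  The family \<open>b\<close> represents the projective module at the vertex \<open>l\<close> by its triangular array; the
  generator is normalised to be the idempotent itself.  Since paths are read from left to right,
  left multiplication by an arrow sends elements at its head to elements at its tail.
\<close>

definition array_basis :: "nat \<Rightarrow> int \<Rightarrow> (nat \<Rightarrow> nat \<Rightarrow> 'k::field preproj_elt) \<Rightarrow> bool" where
  "array_basis n l b \<longleftrightarrow> (let P = preproj n; bs = map (case_prod b) (array_positions n) in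
     b 1 1 = idem n l
   \<and> ring.independent P (scalars n) bs
   \<and> ring.Span P (scalars n) bs = carrier (proj_module n l)
   \<and> (\<forall>(r, c) \<in> set (array_positions n).
        idem n (array_entry l r c) \<otimes>\<^bsub>P\<^esub> b r c = b r c
      \<and> (\<forall>a \<in> arcs (D_quiver n). arrow_cls n a \<otimes>\<^bsub>P\<^esub> b r c =
           (if r < n - 1 \<and> arrow_head a = array_entry l r c
                 \<and> arrow_tail a = array_entry l (r + 1) c then b (r + 1) c
            else if c < r \<and> arrow_head a = array_entry l r c
                 \<and> arrow_tail a = array_entry l r (c + 1) then b r (c + 1)
            else \<zero>\<^bsub>P\<^esub>))))"

definition i_prime :: "int \<Rightarrow> (int \<Rightarrow> int) \<Rightarrow> nat \<Rightarrow> int" where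
  "i_prime l w m = max (w (int m)) ((-1) ^ m * l)"

text \<open>
  Row \<open>r\<close> consists of the entries up to and including $i'_{r+1}$.  No entry of row \<open>r\<close> equals
  \<open>r + 1\<close>, so the row is empty if $i'_{r+1} = r+1$.
\<close>

definition in_subarray :: "int \<Rightarrow> (int \<Rightarrow> int) \<Rightarrow> nat \<Rightarrow> nat \<Rightarrow> bool" where
  "in_subarray l w r c \<longleftrightarrow>
     (\<exists>c'. c \<le> c' \<and> c' \<le> r \<and> array_entry l r c' = i_prime l w (r + 1))"

end

(*
  Flipping the sign of w(1) when l = 1 turns the minimal coset representatives w of type l into
  increasing sequences, so that w is encoded by its value set V, which contains exactly one of k
  and -k for each k in {1..n}.  Left multiplication by s_j either fixes V, adds one box to the
  subarray attached to V, or removes one.  The number of boxes is the length of w, hence every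
  letter of a reduced word of w, read from the right, adds a box.  On the algebra side, multiplying
  the span of the complementary positions by the ideal of the vertex j removes exactly the minimal
  positions with entry j, and this is the box that s_j adds.  The array itself is a basis of the
  projective module: it spans by the relations, and it is independent because the path algebra acts
  on the free vector space on the positions compatibly with the relations.
*)

theory Submission
  imports Defs
begin

section \<open>Signed sets and minimal coset representatives\<close>

text \<open>The dictionary between \<open>V\<close> and the array runs along diagonals: of the
  positions with \<open>r + 1 - c = a\<close> the subarray keeps the first
  \<open>count_below V a\<close>, as many as there are values below \<open>- a\<close>. A value
  \<open>v < 0\<close> lies below \<open>- a\<close> for \<open>- v - 1\<close> choices of
  \<open>a \<ge> 1\<close>, so the box count is \<open>weight V\<close>. The delicate place is the
  main diagonal, where the entries alternate between 1 and -1, so that it matters which of the two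
  end reflections adds the next box. The parity of the number of negative values decides this: it is
  odd for \<open>l = 1\<close> (this is what flipping the sign of w(1) does), even for
  \<open>l = -1\<close>, and every reflection preserves it. On the algebra side the kernel of the
  map from the projective module to J(w) is the intersection of the word ideal with the projective
  module. As the ideal is two-sided, this intersection is also its image under right multiplication
  by the idempotent at \<open>l\<close>, so the vertex ideals can be applied one at a time from the
  left.\<close>

lemma simple_refl_pos:
  assumes "1 \<le> j"
  shows "simple_refl j k = (if k = j then j + 1 else if k = j + 1 then j
    else if k = - j then - j - 1 else if k = - j - 1 then - j else k)"
  using assms by (auto simp: simple_refl_def transpose_def)

lemma simple_refl_neg:
  "simple_refl (-1) k = (if k = 1 then - 2 else if k = 2 then - 1
    else if k = - 1 then 2 else if k = - 2 then 1 else k)"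
  by (auto simp: simple_refl_def transpose_def)

lemma verts_D_quiver: "j \<in> verts (D_quiver n) \<longleftrightarrow> j = -1 \<or> 1 \<le> j \<and> j \<le> int n - 1"
  by (auto simp: D_quiver_def)

lemma simple_refl_involution: "j \<in> verts (D_quiver n) \<Longrightarrow> simple_refl j (simple_refl j k) = k"
  by (auto simp: verts_D_quiver simple_refl_pos simple_refl_neg)

lemma simple_refl_uminus: "j \<in> verts (D_quiver n) \<Longrightarrow> simple_refl j (- k) = - simple_refl j k"
  by (auto simp: verts_D_quiver simple_refl_pos simple_refl_neg)

lemma simple_refl_abs_le:
  "j \<in> verts (D_quiver n) \<Longrightarrow> n \<ge> 2 \<Longrightarrow> 1 \<le> \<bar>k\<bar> \<and> \<bar>k\<bar> \<le> int n \<Longrightarrow>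
     1 \<le> \<bar>simple_refl j k\<bar> \<and> \<bar>simple_refl j k\<bar> \<le> int n"
  by (auto simp: verts_D_quiver simple_refl_pos simple_refl_neg)

lemma mem_simple_refl_image:
  assumes "j \<in> verts (D_quiver n)"
  shows "k \<in> simple_refl j ` V \<longleftrightarrow> simple_refl j k \<in> V"
  using simple_refl_involution[OF assms] by (auto simp: image_iff) metis

definition signed_set :: "nat \<Rightarrow> int set \<Rightarrow> bool" where
  "signed_set n V \<longleftrightarrow> (\<forall>k\<in>V. 1 \<le> \<bar>k\<bar> \<and> \<bar>k\<bar> \<le> int n \<and> - k \<notin> V)
     \<and> (\<forall>k. 1 \<le> \<bar>k\<bar> \<and> \<bar>k\<bar> \<le> int n \<longrightarrow> k \<in> V \<or> - k \<in> V)"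

text \<open>For \<open>a \<ge> 1\<close> this is the number of boxes on one diagonal of the
  subarray. For \<open>a = 0\<close> it is the number of negative values, of which only the parity
  matters.\<close>

definition count_below :: "int set \<Rightarrow> int \<Rightarrow> nat" where
  "count_below V a = card {v \<in> V. v < - a}"

text \<open>
  The number of boxes of the subarray attached to \<open>V\<close>, and also the length of the minimal
  coset representative with value set \<open>V\<close>.
\<close>

definition weight :: "int set \<Rightarrow> nat" where
  "weight V = (\<Sum>v \<in> {v \<in> V. v < 0}. nat (- v - 1))"

text \<open>The case in which \<open>simple_refl j\<close> lowers two values of \<open>V\<close>:
  \<open>- j\<close> and \<open>j + 1\<close> become \<open>- j - 1\<close> and \<open>j\<close>, or
  1 and 2 become -2 and -1.\<close>

definition ascent :: "int \<Rightarrow> int set \<Rightarrow> bool" where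
  "ascent j V \<longleftrightarrow> (if j = -1 then {1, 2} else {- j, j + 1}) \<subseteq> V"

lemma signed_set_finite: "signed_set n V \<Longrightarrow> finite V"
  by (rule finite_subset[of _ "{- int n..int n}"]) (auto simp: signed_set_def abs_le_iff)

lemma signed_set_uminus: "signed_set n V \<Longrightarrow> k \<in> V \<Longrightarrow> - k \<notin> V"
  unfolding signed_set_def by blast

lemma signed_set_range: "signed_set n V \<Longrightarrow> k \<in> V \<Longrightarrow> 1 \<le> \<bar>k\<bar> \<and> \<bar>k\<bar> \<le> int n"
  unfolding signed_set_def by blast

lemma signed_set_uminus_iff:
  "signed_set n V \<Longrightarrow> 1 \<le> \<bar>k\<bar> \<and> \<bar>k\<bar> \<le> int n \<Longrightarrow> - k \<in> V \<longleftrightarrow> k \<notin> V"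
  unfolding signed_set_def by blast

lemma signed_set_image:
  assumes "signed_set n V" "j \<in> verts (D_quiver n)" "n \<ge> 2"
  shows "signed_set n (simple_refl j ` V)"
proof -
  have "1 \<le> \<bar>k\<bar> \<and> \<bar>k\<bar> \<le> int n" if "simple_refl j k \<in> V" for k
    using assms(1) that simple_refl_abs_le[OF assms(2,3), of "simple_refl j k"]
    unfolding signed_set_def simple_refl_involution[OF assms(2)] by blast
  then show ?thesis
    using assms(1) simple_refl_abs_le[OF assms(2,3)] signed_set_uminus[OF assms(1)]
    unfolding signed_set_def[of n "simple_refl j ` V"] Ball_def
      mem_simple_refl_image[OF assms(2)] simple_refl_uminus[OF assms(2)]
    by (metis signed_set_uminus_iff)
qed

text \<open>The pair \<open>(p, q)\<close> treats both kinds of reflections at once: in either case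
  \<open>p\<close> goes to \<open>- q\<close> and \<open>q\<close> to \<open>- p\<close>.\<close>

lemma ascent_image:
  assumes "signed_set n V" "j \<in> verts (D_quiver n)" "ascent j V"
    and pq: "(p, q) = (if j = -1 then (1, 2) else (- j, j + 1))"
  shows "p \<in> V" "q \<in> V" "- p \<notin> V" "- q \<notin> V" "p < q" "- p < q"
    "simple_refl j ` V = V - {p, q} \<union> {- q, - p}"
proof -
  show V: "p \<in> V" "q \<in> V" and "p < q" "- p < q"
    using assms(2-4) by (auto simp: ascent_def verts_D_quiver split: if_splits)
  with signed_set_uminus[OF assms(1)] show *: "- p \<notin> V" "- q \<notin> V" by auto
  show "simple_refl j ` V = V - {p, q} \<union> {- q, - p}"
  proof (cases "j = -1")
    case True
    then show ?thesis using V * pq unfolding set_eq_iff mem_simple_refl_image[OF assms(2)]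
      by (auto simp: simple_refl_neg)
  next
    case False
    then show ?thesis using V * pq assms(2) unfolding set_eq_iff mem_simple_refl_image[OF assms(2)]
      by (auto simp: simple_refl_pos verts_D_quiver)
  qed
qed

text \<open>Two absolute values are moved, with four choices of sign. Two choices are fixed as sets,
  one is an ascent and one is the image of an ascent.\<close>

lemma simple_refl_trichotomy:
  assumes "signed_set n V" "j \<in> verts (D_quiver n)" "n \<ge> 2"
  shows "simple_refl j ` V = V \<or> ascent j V \<or> ascent j (simple_refl j ` V)"
proof (cases "j = -1")
  case True
  have "-1 \<in> V \<longleftrightarrow> 1 \<notin> V" "-2 \<in> V \<longleftrightarrow> 2 \<notin> V"
    using signed_set_uminus_iff[OF assms(1), of 1] signed_set_uminus_iff[OF assms(1), of 2] assms(3)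
    by auto
  then show ?thesis
    unfolding ascent_def set_eq_iff subset_iff mem_simple_refl_image[OF assms(2)]
    by (auto simp: simple_refl_neg True)
next
  case False
  have "- j \<in> V \<longleftrightarrow> j \<notin> V" "- j - 1 \<in> V \<longleftrightarrow> j + 1 \<notin> V"
    using assms False signed_set_uminus_iff[OF assms(1), of j]
      signed_set_uminus_iff[OF assms(1), of "j + 1"] by (auto simp: verts_D_quiver)
  then show ?thesis using False assms(2)
    unfolding ascent_def set_eq_iff subset_iff mem_simple_refl_image[OF assms(2)]
    by (auto simp: simple_refl_pos verts_D_quiver)
qed

section \<open>Effect of an ascent on the counts and on the weight\<close>

lemma sum_swap:
  fixes f :: "int \<Rightarrow> nat"
  assumes "finite V" "p \<in> V" "q \<in> V" "p \<noteq> q" "- p \<notin> V" "- q \<notin> V"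
  shows "sum f (V - {p, q} \<union> {- q, - p}) + f p + f q = sum f V + f (- p) + f (- q)"
proof -
  have "sum f (V - {p, q} \<union> {- q, - p}) = sum f (V - {p, q}) + (f (- q) + f (- p))"
    using assms by (subst sum.union_disjoint) auto
  moreover have "sum f V = sum f (V - {p, q}) + (f p + f q)"
    using assms sum.subset_diff[of "{p, q}" V f] by auto
  ultimately show ?thesis by simp
qed

lemma count_below_sum: "finite V \<Longrightarrow> count_below V a = (\<Sum>v\<in>V. if v < - a then 1 else 0)"
  unfolding count_below_def by (simp add: sum.If_cases Int_def)

lemma weight_sum: "finite V \<Longrightarrow> weight V = (\<Sum>v\<in>V. if v < 0 then nat (- v - 1) else 0)"
  unfolding weight_def by (simp add: sum.If_cases Int_def)

text \<open>Each lowered value crosses one threshold. For \<open>a \<ge> 1\<close> only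
  \<open>a = \<bar>j\<bar>\<close> is affected; at \<open>a = 0\<close> the reflection with
  \<open>j = -1\<close> turns two positive values negative, while the others leave the signs as they
  are in number.\<close>

lemma count_below_ascent:
  assumes "signed_set n V" "j \<in> verts (D_quiver n)" "ascent j V" "n \<ge> 2" "0 \<le> a"
  shows "count_below (simple_refl j ` V) a =
    count_below V a + (if a = \<bar>j\<bar> then 1 else if a = 0 \<and> j = -1 then 2 else 0)"
proof -
  obtain p q where pq: "(p, q) = (if j = -1 then (1, 2) else (- j, j + 1))"
    by (metis surj_pair)
  note * = ascent_image[OF assms(1-3) pq]
  define f :: "int \<Rightarrow> nat" where "f v = (if v < - a then 1 else 0)" for v
  have "f (- p) + f (- q) = f p + f q + (if a = \<bar>j\<bar> then 1 else if a = 0 \<and> j = -1 then 2 else 0)"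
    using pq assms(2,5) by (auto simp: f_def verts_D_quiver split: if_splits)
  then show ?thesis
    using sum_swap[OF signed_set_finite[OF assms(1)] *(1,2) _ *(3,4), of f] *(5)
      signed_set_finite[OF assms(1)]
    by (simp add: *(7) count_below_sum f_def[abs_def])
qed

lemma weight_ascent:
  assumes "signed_set n V" "j \<in> verts (D_quiver n)" "ascent j V" "n \<ge> 2"
  shows "weight (simple_refl j ` V) = weight V + 1"
proof -
  obtain p q where pq: "(p, q) = (if j = -1 then (1, 2) else (- j, j + 1))"
    by (metis surj_pair)
  note * = ascent_image[OF assms(1-3) pq]
  define f :: "int \<Rightarrow> nat" where "f v = (if v < 0 then nat (- v - 1) else 0)" for v
  have "f (- p) + f (- q) = f p + f q + 1"
    using pq assms(2) by (auto simp: f_def verts_D_quiver split: if_splits)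
  then show ?thesis
    using sum_swap[OF signed_set_finite[OF assms(1)] *(1,2) _ *(3,4), of f] *(5)
      signed_set_finite[OF assms(1)]
    by (simp add: *(7) weight_sum f_def[abs_def])
qed

lemma count_below_Suc:
  assumes "signed_set n V" "1 \<le> a"
  shows "count_below V (a - 1) = count_below V a + (if - a \<in> V then 1 else 0)"
proof -
  have "{v \<in> V. v < - (a - 1)} = {v \<in> V. v < - a} \<union> ({- a} \<inter> V)" by auto
  then show ?thesis using signed_set_finite[OF assms(1)] by (auto simp: count_below_def)
qed

text \<open>Between \<open>- a\<close> and \<open>a\<close> a signed set has exactly
  \<open>a\<close> values, one from each pair of opposite numbers. The remaining values
  \<open>\<le> a\<close> are those below \<open>- a\<close>.\<close>

lemma card_le_signed:
  assumes V: "signed_set n V" and "a \<le> n"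
  shows "card {v \<in> V. v \<le> int a} = count_below V (int a) + a"
  using assms(2)
proof (induction a)
  case 0
  have "{v \<in> V. v \<le> 0} = {v \<in> V. v < 0}" using V by (auto simp: signed_set_def order_le_less)
  then show ?case by (simp add: count_below_def)
next
  case (Suc a)
  have "{v \<in> V. v \<le> int (Suc a)} = {v \<in> V. v \<le> int a} \<union> ({int (Suc a)} \<inter> V)" by auto
  then have "card {v \<in> V. v \<le> int (Suc a)} =
      card {v \<in> V. v \<le> int a} + (if int (Suc a) \<in> V then 1 else 0)"
    using signed_set_finite[OF V] by auto
  moreover have "- int (Suc a) \<in> V \<longleftrightarrow> int (Suc a) \<notin> V"
    using signed_set_uminus_iff[OF V, of "int (Suc a)"] Suc.prems by auto
  ultimately show ?case
    using Suc count_below_Suc[OF V, of "int (Suc a)"] by (auto split: if_splits)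
qed

subsection \<open>The subarray of a signed set\<close>

definition positions :: "nat \<Rightarrow> (nat \<times> nat) set" where
  "positions n = {(r, c). 1 \<le> c \<and> c \<le> r \<and> r < n}"

text \<open>Column \<open>c\<close> holds the \<open>c\<close>-th box of its diagonal, so the kept
  boxes are the first \<open>count_below V a\<close> on the diagonal
  \<open>a = r + 1 - c\<close>.\<close>

definition removed :: "nat \<Rightarrow> int set \<Rightarrow> (nat \<times> nat) set" where
  "removed n V = {(r, c) \<in> positions n. count_below V (int r + 1 - int c) < c}"

definition successors :: "nat \<times> nat \<Rightarrow> (nat \<times> nat) set" where
  "successors = (\<lambda>(r, c). {(r + 1, c), (r, c + 1)})"

lemma array_entry_diag:
  assumes "l = 1 \<or> l = -1" and "1 \<le> r"
  shows "array_entry l r r = (if even r \<longleftrightarrow> l = -1 then 1 else -1)"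
  using assms by (cases r) (auto simp: array_entry_def)

text \<open>An ascent lengthens the kept part of the diagonal \<open>\<bar>j\<bar>\<close> by one
  box and of no other. Membership of the two moved values in \<open>V\<close> fixes the lengths of
  the adjacent diagonals, and with these lengths the new box is the only removed box of entry
  \<open>j\<close> without a removed predecessor.\<close>

lemma removed_simple_refl:
  assumes V: "signed_set n V" and j: "j \<in> verts (D_quiver n)" and asc: "ascent j V"
    and n: "n \<ge> 2" and l: "l = 1 \<or> l = -1" and par: "even (count_below V 0) \<longleftrightarrow> l = -1"
  shows "removed n (simple_refl j ` V) =
    {(r, c) \<in> removed n V. array_entry l r c \<noteq> j \<or> (\<exists>y \<in> removed n V. (r, c) \<in> successors y)}"
proof -
  let ?C = "count_below V"
  have step: "count_below (simple_refl j ` V) a = ?C a + (if a = \<bar>j\<bar> then 1 else 0)" if "a \<ge> 1" for a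
    using count_below_ascent[OF V j asc n, of a] that by auto
  \<comment> \<open>These two lengths say that both neighbours preceding the next box of diagonal
    \<open>j\<close> are kept already, whereas every later box on that diagonal has a removed
    predecessor.\<close>
  have pos: "?C (j - 1) = ?C j + 1" "?C (j + 1) = ?C j" if "j \<ge> 1"
  proof -
    have "- j \<in> V" "j + 1 \<in> V" using asc that by (auto simp: ascent_def)
    then show "?C (j - 1) = ?C j + 1" "?C (j + 1) = ?C j"
      using count_below_Suc[OF V, of j] count_below_Suc[OF V, of "j + 1"]
        signed_set_uminus[OF V, of "j + 1"] that by auto
  qed
  have neg: "?C 0 = ?C 1" "?C 1 = ?C 2" if "j = -1"
  proof -
    have "- 1 \<notin> V" "- 2 \<notin> V"
      using asc that signed_set_uminus[OF V, of 1] signed_set_uminus[OF V, of 2]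
      by (auto simp: ascent_def)
    then show "?C 0 = ?C 1" "?C 1 = ?C 2"
      using count_below_Suc[OF V, of 1] count_below_Suc[OF V, of 2] by auto
  qed
  \<comment> \<open>The predecessors above and to the left lie on the diagonals \<open>a - 1\<close>
    and \<open>a + 1\<close>; the guards \<open>c < r\<close> and \<open>1 < c\<close> express that
    they exist.\<close>
  have pred: "(\<exists>y \<in> removed n V. (r, c) \<in> successors y) \<longleftrightarrow>
      c < r \<and> ?C (int r - int c) < c \<or> 1 < c \<and> ?C (int r + 2 - int c) < c - 1"
    if "(r, c) \<in> positions n" for r c
  proof -
    obtain r0 c0 where rc0: "r = Suc r0" "c = Suc c0"
      using \<open>(r, c) \<in> positions n\<close> by (cases r; cases c) (auto simp: positions_def)
    have "(\<exists>y \<in> removed n V. (r, c) \<in> successors y) \<longleftrightarrow>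
        (r0, c) \<in> removed n V \<or> (r, c0) \<in> removed n V"
      unfolding successors_def by (auto simp: rc0 Bex_def)
    also have "\<dots> \<longleftrightarrow> c < r \<and> ?C (int r - int c) < c \<or> 1 < c \<and> ?C (int r + 2 - int c) < c - 1"
      using that by (auto simp: rc0 removed_def positions_def algebra_simps)
    finally show ?thesis .
  qed
  have "(r, c) \<in> removed n (simple_refl j ` V) \<longleftrightarrow> (r, c) \<in> removed n V
      \<and> (array_entry l r c \<noteq> j \<or> (\<exists>y \<in> removed n V. (r, c) \<in> successors y))" for r c
  proof (cases "(r, c) \<in> positions n")
    case rc: True
    define a where "a = int r + 1 - int c"
    have a: "a \<ge> 1" "int r - int c = a - 1" "int r + 2 - int c = a + 1"
      using rc by (auto simp: a_def positions_def)
    have rem: "(r, c) \<in> removed n U \<longleftrightarrow> count_below U a < c" for U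
      using rc by (auto simp: removed_def a_def)
    show ?thesis
    proof (cases "c = r")
      case True
      then have a1: "a = 1" by (simp add: a_def)
      have r: "r \<ge> 1" using rc by (auto simp: positions_def)
      \<comment> \<open>The parity hypothesis enters here. \<open>?C 0\<close> is
        \<open>?C 1 + 1\<close> if \<open>j = 1\<close> and \<open>?C 1\<close> if
        \<open>j = -1\<close>, so the parity of \<open>?C 0\<close> fixes the sign of the diagonal
        entry in row \<open>?C 1 + 1\<close>.\<close>
      have e: "array_entry l r r = j" if "r = ?C 1 + 1" "\<bar>j\<bar> = 1"
      proof (cases "j = 1")
        case True
        then show ?thesis unfolding array_entry_diag[OF l r] using that pos par by auto
      next
        case False
        then have "j = -1" using that by auto
        then show ?thesis unfolding array_entry_diag[OF l r] using that neg par l by auto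
      qed
      \<comment> \<open>A box on the main diagonal has only a left predecessor. \<open>P\<close>
        stands for "the reflection moves this diagonal" and \<open>E\<close> for "the entry is
        \<open>j\<close>"; \<open>E\<close> matters only at the new box \<open>y = x + 1\<close>,
        because further down the left predecessor is removed anyway.\<close>
      have aux: "x + (if P then 1 else 0) < y \<longleftrightarrow> x < y \<and> (\<not> E \<or> 1 < y \<and> z < y - 1)"
        if "P \<longrightarrow> z = x" "P \<or> \<not> E" "P \<longrightarrow> y = x + 1 \<longrightarrow> E" for x y z :: nat and P E
        using that by (cases P; cases E; simp; linarith)
      have "\<bar>j\<bar> = 1 \<Longrightarrow> ?C 2 = ?C 1" using pos(2) neg(2) by (cases "j = 1") auto
      moreover have "array_entry l r r \<noteq> j" if "\<bar>j\<bar> \<noteq> 1"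
        using that by (auto simp: array_entry_diag[OF l r] split: if_splits)
      ultimately have "?C 1 + (if 1 = \<bar>j\<bar> then 1 else 0) < r \<longleftrightarrow>
          ?C 1 < r \<and> (array_entry l r r \<noteq> j \<or> 1 < r \<and> ?C 2 < r - 1)"
        using e by (intro aux impI) metis+
      then show ?thesis
        unfolding pred[OF rc] rem a step[OF a(1)] unfolding \<open>c = r\<close> a1 by simp
    next
      case False
      then have "array_entry l r c = a" "a > 1" "c < r" "c \<ge> 1"
        using rc by (auto simp: array_entry_def a_def positions_def)
      then show ?thesis
        unfolding pred[OF rc] rem a step[OF a(1)]
        using pos j by (auto simp: verts_D_quiver)
    qed
  qed (auto simp: removed_def)
  then show ?thesis by auto
qed

subsection \<open>Reduced words\<close>

definition hat :: "int \<Rightarrow> (int \<Rightarrow> int) \<Rightarrow> int \<Rightarrow> int" where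
  "hat l w i = (if i = 1 then - l * w i else w i)"

definition value_set :: "nat \<Rightarrow> int \<Rightarrow> (int \<Rightarrow> int) \<Rightarrow> int set" where
  "value_set n l w = hat l w ` {1..int n}"

lemma word_prod_Nil: "word_prod [] = id"
  and word_prod_Cons: "word_prod (j # js) = simple_refl j \<circ> word_prod js"
  by (simp_all add: word_prod_def)

text \<open>The sign is changed at a position and not at a value, hence it commutes with left
  multiplication by an odd map.\<close>

lemma hat_simple_refl:
  assumes "j \<in> verts (D_quiver n)" "l = 1 \<or> l = -1"
  shows "hat l (simple_refl j \<circ> w) = simple_refl j \<circ> hat l w"
  using assms(2) simple_refl_uminus[OF assms(1)] by (auto simp: hat_def fun_eq_iff)

lemma value_set_simple_refl:
  assumes "j \<in> verts (D_quiver n)" "l = 1 \<or> l = -1"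
  shows "value_set n l (simple_refl j \<circ> w) = simple_refl j ` value_set n l w"
  by (simp add: value_set_def hat_simple_refl[OF assms] image_comp)

lemma value_set_id: assumes "n \<ge> 1" shows "value_set n l id = insert (- l) {2..int n}"
proof -
  have "{1..int n} = insert 1 {2..int n}" using assms by auto
  then show ?thesis by (auto simp: value_set_def hat_def image_iff)
qed

text \<open>For \<open>l = 1\<close> the identity already has the negative value -1. It lies below
  no \<open>- a\<close> with \<open>a \<ge> 1\<close>, so it contributes no box and only makes the
  parity odd.\<close>

lemma value_set_id_props:
  assumes "n \<ge> 1" "l = 1 \<or> l = -1"
  shows "signed_set n (value_set n l id)" "weight (value_set n l id) = 0"
    "a \<ge> 1 \<Longrightarrow> count_below (value_set n l id) a = 0"
    "count_below (value_set n l id) 0 = (if l = 1 then 1 else 0)"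
proof -
  have *: "{v \<in> insert (- l) {2..int n}. v < - a} = (if a < l then {- l} else {})" if "0 \<le> a" for a
    using assms that by auto
  show "signed_set n (value_set n l id)"
    using assms by (auto simp: value_set_id signed_set_def)
  note sets = *[OF order_refl, unfolded minus_zero]
  show "weight (value_set n l id) = 0"
    unfolding value_set_id[OF assms(1)] weight_def sets using assms(2) by auto
  show "count_below (value_set n l id) 0 = (if l = 1 then 1 else 0)"
    unfolding value_set_id[OF assms(1)] count_below_def minus_zero sets using assms(2) by auto
  show "count_below (value_set n l id) a = 0" if "a \<ge> 1"
  proof -
    have "0 \<le> a" "\<not> a < l" using that assms(2) by auto
    then show ?thesis unfolding value_set_id[OF assms(1)] count_below_def *[OF \<open>0 \<le> a\<close>] by simp
  qed
qed

text \<open>An ascent changes the number of negative values by 0 or 2, and in the remaining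
  nontrivial case the reflection undoes an ascent.\<close>

lemma parity_simple_refl:
  assumes "signed_set n V" "j \<in> verts (D_quiver n)" "n \<ge> 2"
  shows "even (count_below (simple_refl j ` V) 0) = even (count_below V 0)"
proof -
  let ?U = "simple_refl j ` V"
  have "simple_refl j ` ?U = V"
    by (simp add: image_comp comp_def simple_refl_involution[OF assms(2)])
  moreover have "even (count_below (simple_refl j ` W) 0) = even (count_below W 0)"
    if "signed_set n W" "ascent j W" for W
    using count_below_ascent[OF that(1) assms(2) that(2) assms(3), of 0] assms(2)
    by (auto simp: verts_D_quiver)
  ultimately show ?thesis
    using simple_refl_trichotomy[OF assms] signed_set_image[OF assms] assms(1) by metis
qed

lemma value_set_word_prod:
  assumes "set js \<subseteq> verts (D_quiver n)" "n \<ge> 2" "l = 1 \<or> l = -1"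
  shows "signed_set n (value_set n l (word_prod js))"
    "even (count_below (value_set n l (word_prod js)) 0) \<longleftrightarrow> l = -1"
  using assms(1)
proof (induction js)
  case Nil
  show "signed_set n (value_set n l (word_prod []))"
    "even (count_below (value_set n l (word_prod [])) 0) \<longleftrightarrow> l = -1"
    using value_set_id_props(1,4)[of n l] assms unfolding word_prod_Nil by auto
next
  case (Cons j js)
  {
    case 1
    then show ?case
      using Cons signed_set_image[of n _ j] assms(2)
      unfolding word_prod_Cons by (subst value_set_simple_refl[OF _ assms(3)]) auto
  next
    case 2
    then show ?case
      using Cons parity_simple_refl[of n _ j] assms(2)
      unfolding word_prod_Cons by (subst value_set_simple_refl[OF _ assms(3)]) auto
  }
qed

text \<open>By the trichotomy the weight changes by 1, 0 or -1, because the reflection is an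
  involution and a step down is an ascent read backwards.\<close>

lemma weight_word_prod:
  assumes "set (j # js) \<subseteq> verts (D_quiver n)" "n \<ge> 2" "l = 1 \<or> l = -1"
  shows "weight (value_set n l (word_prod (j # js))) \<le> weight (value_set n l (word_prod js)) + 1"
    and "weight (value_set n l (word_prod (j # js))) = weight (value_set n l (word_prod js)) + 1
      \<longleftrightarrow> ascent j (value_set n l (word_prod js))"
proof -
  let ?V = "value_set n l (word_prod js)"
  let ?U = "simple_refl j ` ?V"
  have V: "signed_set n ?V" using value_set_word_prod(1) assms by auto
  have j: "j \<in> verts (D_quiver n)" using assms by auto
  have "?V = simple_refl j ` ?U"
    by (simp add: image_comp comp_def simple_refl_involution[OF j])
  then have down: "weight ?V = weight ?U + 1" if "ascent j ?U"
    using weight_ascent[OF signed_set_image[OF V j assms(2)] j that assms(2)] by simp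
  have up: "weight ?U = weight ?V + 1" if "ascent j ?V"
    using weight_ascent[OF V j that assms(2)] .
  have same: "weight ?U = weight ?V" if "\<not> ascent j ?V" "\<not> ascent j ?U"
    using simple_refl_trichotomy[OF V j assms(2)] that by metis
  have U: "value_set n l (word_prod (j # js)) = ?U"
    unfolding word_prod_Cons by (rule value_set_simple_refl[OF j assms(3)])
  show "weight (value_set n l (word_prod (j # js))) \<le> weight ?V + 1"
    "weight (value_set n l (word_prod (j # js))) = weight ?V + 1 \<longleftrightarrow> ascent j ?V"
    unfolding U using up down same by (cases "ascent j ?V"; cases "ascent j ?U"; linarith)+
qed

lemma weight_le_length:
  assumes "set js \<subseteq> verts (D_quiver n)" "n \<ge> 2" "l = 1 \<or> l = -1"
  shows "weight (value_set n l (word_prod js)) \<le> length js"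
  using assms(1)
proof (induction js)
  case Nil
  have "1 \<le> n" using assms(2) by simp
  then show ?case using value_set_id_props(2)[OF _ assms(3)] by (metis word_prod_Nil le0)
next
  case (Cons j js)
  then show ?case using weight_word_prod(1)[OF Cons.prems assms(2,3)] by auto
qed

section \<open>Signed permutations and words whose length is the weight\<close>

definition signed_perm :: "nat \<Rightarrow> (int \<Rightarrow> int) \<Rightarrow> bool" where
  "signed_perm n w \<longleftrightarrow> w permutes ({- int n..int n} - {0}) \<and> (\<forall>i. w (- i) = - w i)"

lemma simple_refl_signed_perm:
  assumes "j \<in> verts (D_quiver n)" "n \<ge> 2" "signed_perm n w"
  shows "signed_perm n (simple_refl j \<circ> w)"
proof -
  have "simple_refl j permutes ({- int n..int n} - {0})"
  proof (rule bij_imp_permutes)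
    have X: "k \<in> {- int n..int n} - {0} \<longleftrightarrow> 1 \<le> \<bar>k\<bar> \<and> \<bar>k\<bar> \<le> int n" for k
      by auto
    have "simple_refl j ` ({- int n..int n} - {0}) \<subseteq> {- int n..int n} - {0}"
      unfolding image_subset_iff Ball_def X by (intro allI impI simple_refl_abs_le[OF assms(1,2)])
    then show "bij_betw (simple_refl j) ({- int n..int n} - {0}) ({- int n..int n} - {0})"
      using simple_refl_involution[OF assms(1)]
      by (intro bij_betw_byWitness[where f' = "simple_refl j"]) auto
    show "simple_refl j k = k" if "k \<notin> {- int n..int n} - {0}" for k
      using that assms(1,2) by (auto simp: verts_D_quiver simple_refl_pos simple_refl_neg)
  qed
  then show ?thesis
    using assms(3) by (auto simp: signed_perm_def simple_refl_uminus[OF assms(1)] intro: permutes_compose)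
qed

lemma hat_eq:
  assumes "signed_perm n w" "l = 1 \<or> l = -1"
  shows "hat l w i = w (hat l id i)"
proof -
  have "w (- 1) = - w 1" using assms(1) unfolding signed_perm_def by blast
  then show ?thesis using assms(2) by (auto simp: hat_def)
qed

lemma hat_inj:
  assumes "signed_perm n w" "l = 1 \<or> l = -1"
  shows "inj_on (hat l w) {1..int n}"
proof (rule inj_onI)
  fix x y assume xy: "x \<in> {1..int n}" "y \<in> {1..int n}" "hat l w x = hat l w y"
  have "inj w" using assms(1) unfolding signed_perm_def by (blast dest: permutes_inj)
  then have "hat l id x = hat l id y" using xy(3) hat_eq[OF assms] by (simp add: inj_eq)
  then show "x = y" using xy(1,2) assms(2) by (auto simp: hat_def split: if_splits)
qed

lemma signed_set_value_set:
  assumes "signed_perm n w" "l = 1 \<or> l = -1" "n \<ge> 1"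
  shows "signed_set n (value_set n l w)"
proof -
  let ?X = "{- int n..int n} - {0}"
  have w: "w permutes ?X" and odd: "w (- i) = - w i" for i
    using assms(1) unfolding signed_perm_def by blast+
  have X: "k \<in> ?X \<longleftrightarrow> 1 \<le> \<bar>k\<bar> \<and> \<bar>k\<bar> \<le> int n" for k by auto
  let ?I = "value_set n l id"
  have I: "signed_set n ?I" using value_set_id_props(1) assms by auto
  have eq: "value_set n l w = w ` ?I"
    unfolding value_set_def image_image using hat_eq[OF assms(1,2)] by (intro image_cong) auto
  have mem: "w i \<in> w ` ?I \<longleftrightarrow> i \<in> ?I" for i
    using permutes_inj[OF w] by (rule inj_image_mem_iff)
  have "1 \<le> \<bar>k\<bar> \<and> \<bar>k\<bar> \<le> int n \<and> - k \<notin> w ` ?I" if "k \<in> w ` ?I" for k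
  proof -
    from that obtain i where i: "i \<in> ?I" "k = w i" by auto
    then have "i \<in> ?X" using I unfolding X signed_set_def by blast
    then have "k \<in> ?X" using permutes_in_image[OF w] i by simp
    moreover have "- i \<notin> ?I" using signed_set_uminus[OF I i(1)] .
    ultimately show ?thesis unfolding X i(2) odd[symmetric] mem by blast
  qed
  moreover have "k \<in> w ` ?I \<or> - k \<in> w ` ?I" if k: "1 \<le> \<bar>k\<bar> \<and> \<bar>k\<bar> \<le> int n" for k
  proof -
    have "k \<in> w ` ?X" using k unfolding permutes_image[OF w] X .
    then obtain i where i: "i \<in> ?X" "k = w i" by blast
    then have "i \<in> ?I \<or> - i \<in> ?I" using I unfolding X signed_set_def by blast
    then show ?thesis unfolding i(2) odd[symmetric] mem .
  qed
  ultimately show ?thesis unfolding eq signed_set_def by blast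
qed

text \<open>Both functions list their common image in increasing order along
  \<open>A\<close>.\<close>

lemma strict_mono_on_image_eq:
  fixes f g :: "'a::linorder \<Rightarrow> 'b::linorder"
  assumes "finite A" "strict_mono_on A f" "strict_mono_on A g" "f ` A = g ` A" "x \<in> A"
  shows "f x = g x"
proof -
  let ?xs = "sorted_list_of_set A"
  have "map h ?xs = sorted_list_of_set (h ` A)" if "strict_mono_on A h" for h :: "'a \<Rightarrow> 'b"
  proof (rule strict_sorted_equal)
    show "sorted_wrt (<) (map h ?xs)"
      unfolding sorted_wrt_map
      by (rule sorted_wrt_mono_rel[OF _ strict_sorted_list_of_set])
        (use that assms(1) in \<open>auto simp: strict_mono_on_def\<close>)
  qed (use assms(1) in auto)
  then have "map f ?xs = map g ?xs" using assms by metis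
  then show ?thesis using assms by auto
qed

text \<open>This is sorting: as long as some reflection lowers the weight, apply it. When none does,
  \<open>V\<close> must be the value set of the identity, and monotonicity leaves only
  \<open>w = id\<close>.\<close>

lemma exists_word_of_length_weight:
  assumes "signed_perm n w" "strict_mono_on {1..int n} (hat l w)" "n \<ge> 2" "l = 1 \<or> l = -1"
    and "even (count_below (value_set n l w) 0) \<longleftrightarrow> l = -1"
  shows "\<exists>js. set js \<subseteq> verts (D_quiver n) \<and> word_prod js = w \<and> length js = weight (value_set n l w)"
  using assms
proof (induction "weight (value_set n l w)" arbitrary: w rule: less_induct)
  case less
  let ?V = "value_set n l w"
  have V: "signed_set n ?V" using signed_set_value_set less.prems by auto
  show ?case
  proof (cases "\<exists>j \<in> verts (D_quiver n). ascent j (simple_refl j ` ?V)")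
    case True
    then obtain j where j: "j \<in> verts (D_quiver n)" and asc: "ascent j (simple_refl j ` ?V)" by auto
    let ?u = "simple_refl j \<circ> w"
    have U: "value_set n l ?u = simple_refl j ` ?V" using value_set_simple_refl[OF j] less.prems by auto
    have inv: "simple_refl j ` simple_refl j ` ?V = ?V"
      by (simp add: image_comp comp_def simple_refl_involution[OF j])
    have wt: "weight ?V = weight (value_set n l ?u) + 1"
      using weight_ascent[OF signed_set_image[OF V j] j asc] less.prems(3) by (simp add: U inv)
    \<comment> \<open>For \<open>j \<ge> 1\<close> the reflection reverses only the pairs
      \<open>j, j + 1\<close> and \<open>- j - 1, - j\<close>, and \<open>V\<close> contains one
      value from each. For \<open>j = -1\<close> it carries -2 and -1 past 0, 1 and 2, none of which
      lies in \<open>V\<close>.\<close>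
    have mono: "simple_refl j x < simple_refl j y" if "x \<in> ?V" "y \<in> ?V" "x < y" for x y
    proof -
      have m: "(if j = -1 then {- 1, - 2} else {j, - (j + 1)}) \<subseteq> ?V"
        using asc j unfolding ascent_def subset_iff mem_simple_refl_image[OF j]
        by (auto simp: verts_D_quiver simple_refl_pos simple_refl_neg)
      note sg = signed_set_uminus[OF V]
      show ?thesis
      proof (cases "j = -1")
        case True
        then have "1 \<notin> ?V" "2 \<notin> ?V" "0 \<notin> ?V"
          using m sg[of 1] sg[of 2] signed_set_range[OF V, of 0] by auto
        then have "x \<notin> {0, 1, 2}" "y \<notin> {0, 1, 2}" using that by auto
        then show ?thesis using that(3) by (auto simp: True simple_refl_neg)
      next
        case False
        then have "- j \<notin> ?V" "j + 1 \<notin> ?V"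
          using m sg[of j] sg[of "j + 1"] by auto
        then have "x \<notin> {- j, j + 1}" "y \<notin> {- j, j + 1}" using that by auto
        then show ?thesis using that(3) False j by (auto simp: verts_D_quiver simple_refl_pos)
      qed
    qed
    have "strict_mono_on {1..int n} (hat l ?u)"
      unfolding hat_simple_refl[OF j less.prems(4)]
      using mono less.prems(2) by (auto simp: strict_mono_on_def value_set_def)
    moreover have "even (count_below (value_set n l ?u) 0) \<longleftrightarrow> l = -1"
      unfolding U using parity_simple_refl[OF V j] less.prems by auto
    ultimately obtain js where js: "set js \<subseteq> verts (D_quiver n)" "word_prod js = ?u"
      "length js = weight (value_set n l ?u)"
      using less.hyps[of ?u] wt simple_refl_signed_perm[OF j] less.prems by auto
    have "word_prod (j # js) = w"
      using js(2) by (auto simp: word_prod_Cons fun_eq_iff simple_refl_involution[OF j])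
    then show ?thesis using js wt j by (intro exI[of _ "j # js"]) auto
  next
    case False
    have no: "\<not> (j \<in> ?V \<and> - (j + 1) \<in> ?V)" if "1 \<le> j" "j \<le> int n - 1" for j
    proof
      assume *: "j \<in> ?V \<and> - (j + 1) \<in> ?V"
      have j: "j \<in> verts (D_quiver n)" using that by (auto simp: verts_D_quiver)
      have "ascent j (simple_refl j ` ?V)"
        using * that unfolding ascent_def subset_iff mem_simple_refl_image[OF j]
        by (auto simp: simple_refl_pos)
      then show False using False j by auto
    qed
    have no': "\<not> (- 1 \<in> ?V \<and> - 2 \<in> ?V)"
    proof
      assume *: "- 1 \<in> ?V \<and> - 2 \<in> ?V"
      have j: "- 1 \<in> verts (D_quiver n)" by (auto simp: verts_D_quiver)
      have "ascent (- 1) (simple_refl (- 1) ` ?V)"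
        using * unfolding ascent_def subset_iff mem_simple_refl_image[OF j]
        by (auto simp: simple_refl_neg)
      then show False using False j by auto
    qed
    \<comment> \<open>One of 1 and -1 lies in \<open>V\<close>, and \<open>no\<close> or
      \<open>no'\<close> accordingly forbids -2, so 2 lies in \<open>V\<close>. From there
      \<open>no\<close> propagates membership upwards.\<close>
    have big: "int k \<in> ?V" if "2 \<le> k" "k \<le> n" for k
      using that
    proof (induction k rule: dec_induct)
      case base
      show ?case
        using no[of 1] no' signed_set_uminus_iff[OF V, of 1] signed_set_uminus_iff[OF V, of 2] less.prems(3)
        by auto
    next
      case (step k)
      then show ?case
        using no[of "int k"] signed_set_uminus_iff[OF V, of "int (Suc k)"] by (auto simp: algebra_simps)
    qed
    have big': "k \<in> ?V" "- k \<notin> ?V" if "2 \<le> k" "k \<le> int n" for k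
      using big[of "nat k"] signed_set_uminus[OF V] that by auto
    have "{v \<in> ?V. v < 0} = (if - 1 \<in> ?V then {- 1} else {})"
    proof -
      have "v = - 1" if "v \<in> ?V" "v < 0" for v
      proof (rule ccontr)
        assume "v \<noteq> - 1"
        then have "2 \<le> - v" "- v \<le> int n" using that signed_set_range[OF V, of v] by auto
        then show False using big'(2)[of "- v"] that by auto
      qed
      then have "v \<in> ?V \<and> v < 0 \<longleftrightarrow> v = - 1 \<and> - 1 \<in> ?V" for v by (metis neg_less_0_iff_less zero_less_one)
      then show ?thesis by auto
    qed
    \<comment> \<open>At most -1 is negative now, so the parity alone decides between 1 and
      -1.\<close>
    then have "- 1 \<in> ?V \<longleftrightarrow> l = 1"
      using less.prems(4,5) by (auto simp: count_below_def split: if_splits)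
    then have l: "- l \<in> ?V" "l \<notin> ?V"
      using less.prems(3,4) signed_set_uminus_iff[OF V, of 1] by auto
    have V_eq: "?V = value_set n l id"
    proof -
      have "v = - l \<or> v \<in> {2..int n}" if "v \<in> ?V" for v
      proof (rule ccontr)
        assume *: "\<not> ?thesis"
        have "v \<noteq> l" "v \<noteq> - l" "v \<notin> {2..int n}" using * l that by auto
        then have "2 \<le> - v" "- v \<le> int n"
          using signed_set_range[OF V that] less.prems(4) by auto
        then show False using big'(2)[of "- v"] that by auto
      qed
      then have "?V \<subseteq> insert (- l) {2..int n}" by blast
      moreover have "insert (- l) {2..int n} \<subseteq> ?V" using l big'(1) by auto
      ultimately show ?thesis using value_set_id[of n l] less.prems(3) by auto
    qed
    have hat: "hat l w i = hat l id i" if "1 \<le> i" "i \<le> int n" for i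
    proof (rule strict_mono_on_image_eq[of "{1..int n}" "hat l w" "hat l id"])
      show "strict_mono_on {1..int n} (hat l id)"
        using less.prems(4) by (auto simp: strict_mono_on_def hat_def)
    qed (use less.prems V_eq that in \<open>auto simp: value_set_def\<close>)
    have pos: "w i = i" if "1 \<le> i" "i \<le> int n" for i
      using hat[OF that] less.prems(4) by (auto simp: hat_def split: if_splits)
    have "w = id"
    proof
      fix i
      have w: "w permutes {- int n..int n} - {0}" and odd: "w (- i) = - w i"
        using less.prems(1) unfolding signed_perm_def by blast+
      consider "i \<notin> {- int n..int n} - {0}" | "1 \<le> i" "i \<le> int n" | "1 \<le> - i" "- i \<le> int n"
        by fastforce
      then show "w i = id i"
        using permutes_not_in[OF w] pos[of i] pos[of "- i"] odd by cases auto
    qed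
    then show ?thesis
      using value_set_id_props(2)[of n l] less.prems by (intro exI[of _ "[]"]) (auto simp: word_prod_Nil)
  qed
qed

text \<open>The weight bounds the length of every word from below and the sorting word attains the
  bound, so reduced words attain it as well. The equality is what later forces every letter to be an
  ascent.\<close>

lemma reduced_word_ascents:
  assumes "signed_perm n w" "strict_mono_on {1..int n} (hat l w)" "n \<ge> 2" "l = 1 \<or> l = -1"
    and "even (count_below (value_set n l w) 0) \<longleftrightarrow> l = -1" and "reduced_word n w js"
  shows "weight (value_set n l (word_prod js)) = length js"
proof -
  obtain js' where js': "set js' \<subseteq> verts (D_quiver n)" "word_prod js' = w"
      "length js' = weight (value_set n l w)"
    using exists_word_of_length_weight[OF assms(1-5)] by auto
  then have "D_length n w \<le> weight (value_set n l w)"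
    unfolding D_length_def by (intro Least_le) auto
  then show ?thesis
    using assms(6) weight_le_length[of js n l] assms(3,4) by (auto simp: reduced_word_def)
qed

text \<open>For \<open>l = 1\<close> the type condition \<open>- w 1 < w 2\<close> is monotonicity
  at the flipped position, and flipping one sign turns the even number of negative values of a Weyl
  group element into an odd one.\<close>

lemma D_weyl_has_type:
  assumes "w \<in> D_weyl n" "has_type n l w" "l = 1 \<or> l = -1" "n \<ge> 2"
  shows "signed_perm n w" "strict_mono_on {1..int n} (hat l w)"
    "even (count_below (value_set n l w) 0) \<longleftrightarrow> l = -1"
proof -
  show sp: "signed_perm n w" using assms(1) by (auto simp: D_weyl_def signed_perm_def)
  show "strict_mono_on {1..int n} (hat l w)"
  proof (cases "l = -1")
    case True
    then show ?thesis using assms(2) by (auto simp: has_type_def hat_def strict_mono_on_def)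
  next
    case False
    then have l: "l = 1" and m: "strict_mono_on {2..int n} w" and w12: "- w 1 < w 2"
      using assms(2,3) by (auto simp: has_type_def)
    have le: "w 2 \<le> w y" if "2 \<le> y" "y \<le> int n" for y
      using m that by (cases "y = 2") (auto simp: strict_mono_on_def less_imp_le)
    show ?thesis
    proof (rule strict_mono_onI)
      fix x y assume xy: "x \<in> {1..int n}" "y \<in> {1..int n}" "x < y"
      show "hat l w x < hat l w y"
      proof (cases "x = 1")
        case True
        then show ?thesis using xy w12 le[of y] by (auto simp: hat_def l)
      next
        case False
        then show ?thesis using xy strict_mono_onD[OF m, of x y] by (auto simp: hat_def)
      qed
    qed
  qed
  let ?N = "{i \<in> {1..int n}. w i < 0}"
  let ?M = "{i \<in> {1..int n}. hat l w i < 0}"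
  have "{v \<in> value_set n l w. v < 0} = hat l w ` ?M" by (auto simp: value_set_def)
  then have card: "count_below (value_set n l w) 0 = card ?M"
    unfolding count_below_def minus_zero by (simp only:) (rule card_image, rule inj_on_subset[OF hat_inj[OF sp assms(3)]], blast)
  have ev: "even (card ?N)" using assms(1) by (simp add: D_weyl_def)
  show "even (count_below (value_set n l w) 0) \<longleftrightarrow> l = -1"
  proof (cases "l = -1")
    case True
    then have "?M = ?N" by (auto simp: hat_def)
    then show ?thesis using card ev True by simp
  next
    case False
    then have l: "l = 1" using assms(3) by simp
    let ?R = "{i \<in> {2..int n}. w i < 0}"
    \<comment> \<open>A zero value would keep its sign under the flip and spoil the parity
      count.\<close>
    have "w 1 \<noteq> 0"
      using sp permutes_in_image[of w "{- int n..int n} - {0}" 1] assms(4)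
      by (auto simp: signed_perm_def)
    then have w1: "w 1 < 0 \<longleftrightarrow> \<not> 0 < w 1" by auto
    have split: "{1..int n} = insert 1 {2..int n}" using assms(4) by auto
    have sets: "?M = (if w 1 > 0 then insert 1 ?R else ?R)" "?N = (if w 1 < 0 then insert 1 ?R else ?R)"
      unfolding split l by (auto simp: hat_def)
    have "finite ?R" "1 \<notin> ?R" by (rule finite_subset[of _ "{2..int n}"]) auto
    then have "card (insert 1 ?R) = Suc (card ?R)" by (rule card_insert_disjoint)
    then show ?thesis
      using ev unfolding card sets unfolding l w1 by (cases "0 < w 1") (simp_all only: if_True if_False, simp_all)
  qed
qed

subsection \<open>Comparison with the array of a join-irreducible element\<close>

text \<open>As \<open>hat l w\<close> increases, its \<open>m\<close>-th value is at most
  \<open>a\<close> exactly when at least \<open>m\<close> values are; \<open>card_le_signed\<close>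
  counts these. This turns entries of \<open>w\<close> into lengths of diagonals.\<close>

lemma hat_le_iff:
  assumes "signed_perm n w" "strict_mono_on {1..int n} (hat l w)" "l = 1 \<or> l = -1"
    and "1 \<le> m" "m \<le> n" "a \<le> n"
  shows "hat l w (int m) \<le> int a \<longleftrightarrow> m \<le> count_below (value_set n l w) (int a) + a"
proof -
  let ?f = "hat l w"
  have V: "signed_set n (value_set n l w)" using signed_set_value_set assms by auto
  have card: "card {v \<in> value_set n l w. v \<le> int a} = card {i \<in> {1..int n}. ?f i \<le> int a}"
  proof -
    have "{v \<in> value_set n l w. v \<le> int a} = ?f ` {i \<in> {1..int n}. ?f i \<le> int a}"
      by (auto simp: value_set_def)
    then show ?thesis
      by (simp only:) (rule card_image, rule inj_on_subset[OF hat_inj[OF assms(1,3)]], blast)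
  qed
  have le: "?f i \<le> ?f k \<longleftrightarrow> i \<le> k" if "i \<in> {1..int n}" "k \<in> {1..int n}" for i k
    using strict_mono_on_leD[OF assms(2), of i k] strict_mono_onD[OF assms(2), of k i] that by force
  let ?S = "{i \<in> {1..int n}. ?f i \<le> int a}"
  have fin: "finite ?S" by (rule finite_subset[of _ "{1..int n}"]) auto
  have "?f (int m) \<le> int a \<longleftrightarrow> m \<le> card ?S"
  proof
    assume *: "?f (int m) \<le> int a"
    have "{1..int m} \<subseteq> ?S"
    proof
      fix i assume i: "i \<in> {1..int m}"
      then have "?f i \<le> ?f (int m)" using le[of i "int m"] assms by auto
      then show "i \<in> ?S" using i assms * by auto
    qed
    then have "card {1..int m} \<le> card ?S" by (rule card_mono[OF fin])
    then show "m \<le> card ?S" by simp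
  next
    assume *: "m \<le> card ?S"
    show "?f (int m) \<le> int a"
    proof (rule ccontr)
      assume gt: "\<not> ?f (int m) \<le> int a"
      have "?S \<subseteq> {1..int m - 1}"
      proof
        fix i assume i: "i \<in> ?S"
        then have "\<not> ?f (int m) \<le> ?f i" using gt by auto
        then show "i \<in> {1..int m - 1}" using le[of "int m" i] i assms by auto
      qed
      then have "card ?S \<le> card {1..int m - 1}"
        by (intro card_mono) auto
      then show False using * assms(4) by simp
    qed
  qed
  then show ?thesis using card card_le_signed[OF V assms(6)] by simp
qed

text \<open>A value \<open>\<le> -1\<close> never exceeds the last entry of the row, which is 1 or
  -1. The critical value is 1, which could beat a last entry -1; but then exactly \<open>r\<close>
  values are negative, and the parity makes the last entry 1.\<close>

lemma i_prime_cases: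
  assumes "signed_perm n w" "strict_mono_on {1..int n} (hat l w)" "l = 1 \<or> l = -1"
    and par: "even (count_below (value_set n l w) 0) \<longleftrightarrow> l = -1"
    and r: "1 \<le> r" "r < n"
  shows "i_prime l w (r + 1) = (if w (int r + 1) \<ge> 2 then w (int r + 1) else array_entry l r r)"
proof -
  let ?V = "value_set n l w" and ?x = "w (int r + 1)"
  have V: "signed_set n ?V" using signed_set_value_set assms by auto
  have x: "hat l w (int (r + 1)) = ?x" using r by (auto simp: hat_def add.commute)
  have xV: "?x \<in> ?V" unfolding value_set_def x[symmetric] using r by (intro imageI) auto
  have "(- 1) ^ (r + 1) * l = array_entry l r r"
    using r by (cases r) (auto simp: array_entry_def)
  then have e: "i_prime l w (r + 1) = max ?x (array_entry l r r)"
    by (simp only: i_prime_def of_nat_add of_nat_1)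
  have "array_entry l r r = 1" if x1: "?x = 1"
  proof -
    have "r + 1 \<le> count_below ?V 1 + 1" "\<not> r + 1 \<le> count_below ?V 0"
      using hat_le_iff[OF assms(1-3), of "r + 1" 1] hat_le_iff[OF assms(1-3), of "r + 1" 0] x x1 r
      by auto
    moreover have "count_below ?V 0 = count_below ?V 1"
      using count_below_Suc[OF V, of 1] signed_set_uminus[OF V xV] x1 by simp
    ultimately have "count_below ?V 0 = r" by auto
    then show ?thesis using par assms(3) by (simp add: array_entry_diag[OF assms(3) r(1)])
  qed
  moreover have "?x \<le> -1 \<or> ?x = 1 \<or> 2 \<le> ?x" using signed_set_range[OF V xV] by auto
  moreover have "array_entry l r r = 1 \<or> array_entry l r r = -1"
    using array_entry_diag[OF assms(3) r(1)] by auto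
  ultimately show ?thesis
    unfolding e by (elim disjE) (auto simp: max_def)
qed

text \<open>Row \<open>r\<close> keeps column \<open>c\<close> exactly when
  \<open>w (r + 1) \<le> r + 1 - c\<close>, where a value below 2 keeps the whole row. With
  \<open>a = r + 1 - c\<close>, \<open>hat_le_iff\<close> turns this into
  \<open>c \<le> count_below V a\<close>.\<close>

lemma in_subarray_iff:
  assumes "signed_perm n w" "strict_mono_on {1..int n} (hat l w)" "l = 1 \<or> l = -1"
    and par: "even (count_below (value_set n l w) 0) \<longleftrightarrow> l = -1"
    and rc: "(r, c) \<in> positions n"
  shows "in_subarray l w r c \<longleftrightarrow> (r, c) \<notin> removed n (value_set n l w)"
proof -
  let ?V = "value_set n l w" and ?x = "w (int r + 1)"
  have r: "1 \<le> c" "c \<le> r" "r < n" "1 \<le> r" using rc by (auto simp: positions_def)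
  have x: "hat l w (int (r + 1)) = ?x" using r by (auto simp: hat_def add.commute)
  have diag: "array_entry l r r = 1 \<or> array_entry l r r = -1"
    using array_entry_diag[OF assms(3) r(4)] by auto
  have "in_subarray l w r c \<longleftrightarrow> ?x \<le> int (r + 1 - c)"
  proof (cases "?x \<ge> 2")
    case True
    show ?thesis
    proof
      assume "in_subarray l w r c"
      then obtain c' where c': "c \<le> c'" "c' \<le> r" "array_entry l r c' = ?x"
        using True unfolding in_subarray_def i_prime_cases[OF assms(1-4) r(4,3)] by auto
      then have "c' \<noteq> r" using diag True by auto
      then show "?x \<le> int (r + 1 - c)" using c' r by (auto simp: array_entry_def)
    next
      assume *: "?x \<le> int (r + 1 - c)"
      \<comment> \<open>Solving \<open>r + 1 - c' = ?x\<close> for the column; as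
        \<open>?x \<ge> 2\<close>, the solution is off the diagonal.\<close>
      then have "array_entry l r (r + 1 - nat ?x) = ?x"
        using True r by (auto simp: array_entry_def)
      then show "in_subarray l w r c"
        using * True r unfolding in_subarray_def i_prime_cases[OF assms(1-4) r(4,3)]
        by (intro exI[of _ "r + 1 - nat ?x"]) auto
    qed
  next
    case False
    then have "in_subarray l w r c"
      using r unfolding in_subarray_def i_prime_cases[OF assms(1-4) r(4,3)]
      by (intro exI[of _ r]) auto
    then show ?thesis using False r by auto
  qed
  also have "\<dots> \<longleftrightarrow> c \<le> count_below ?V (int (r + 1 - c))"
    using hat_le_iff[OF assms(1-3), of "r + 1" "r + 1 - c"] x r by auto
  also have "\<dots> \<longleftrightarrow> (r, c) \<notin> removed n ?V"
    using rc r by (auto simp: removed_def of_nat_diff add.commute not_le)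
  finally show ?thesis .
qed

lemma i_prime_in_row:
  assumes "signed_perm n w" "strict_mono_on {1..int n} (hat l w)" "l = 1 \<or> l = -1"
    and par: "even (count_below (value_set n l w) 0) \<longleftrightarrow> l = -1"
    and m: "2 \<le> m" "m \<le> n"
  shows "i_prime l w m = int m \<or> (\<exists>c \<in> {1..m - 1}. array_entry l (m - 1) c = i_prime l w m)"
proof -
  obtain r where r: "m = r + 1" "1 \<le> r" "r < n" using m by (cases m) auto
  let ?x = "w (int r + 1)"
  have x: "hat l w (int m) = ?x" using r by (auto simp: hat_def add.commute)
  \<comment> \<open>\<open>hat_le_iff\<close> with \<open>a = m\<close>, where the right-hand side
    holds trivially.\<close>
  have le: "?x \<le> int m" using hat_le_iff[OF assms(1-3), of m m] x m by auto
  show ?thesis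
  proof (cases "?x \<ge> 2")
    case True
    show ?thesis
    proof (cases "?x = int m")
      case True
      then show ?thesis
        using \<open>2 \<le> ?x\<close> unfolding r(1) i_prime_cases[OF assms(1-4) r(2,3)] by simp
    next
      case False
      then have "array_entry l r (r + 1 - nat ?x) = ?x" "r + 1 - nat ?x \<in> {1..r + 1 - 1}"
        using True le r by (auto simp: array_entry_def)
      then show ?thesis
        using True unfolding r(1) i_prime_cases[OF assms(1-4) r(2,3)] by auto
    qed
  next
    case False
    then show ?thesis
      using r unfolding r(1) i_prime_cases[OF assms(1-4) r(2,3)] by (intro disjI2 bexI[of _ r]) auto
  qed
qed

section \<open>The path algebra as a ring\<close>

lemma (in pre_digraph) awlast_append: "awlast u (p @ q) = awlast (awlast u p) q"
  by (simp add: awalk_verts_conv)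

lemma path_algebra_add: "f \<oplus>\<^bsub>path_algebra G\<^esub> g = (\<lambda>q. f q + g q)"
  and path_algebra_zero: "\<zero>\<^bsub>path_algebra G\<^esub> = (\<lambda>_. 0)"
  and path_algebra_one: "\<one>\<^bsub>path_algebra G\<^esub> = (\<lambda>(u, p). if u \<in> verts G \<and> p = [] then 1 else 0)"
  and path_algebra_mult: "(f \<otimes>\<^bsub>path_algebra G\<^esub> g) (u, p) =
     (\<Sum>i\<le>length p. f (u, take i p) * g (last (pre_digraph.awalk_verts G u (take i p)), drop i p))"
  and path_algebra_carrier: "f \<in> carrier (path_algebra G) \<longleftrightarrow>
     finite {q. f q \<noteq> 0} \<and> {q. f q \<noteq> 0} \<subseteq> quiver_paths G"
  by (simp_all add: path_algebra_def)

text \<open>Finitely many vertices are what makes the sum of the trivial paths finitely supported,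
  hence a unit.\<close>

locale finite_quiver = wf_digraph G for G :: "('v, 'a) pre_digraph" +
  fixes A :: "('v \<times> 'a list \<Rightarrow> 'k::field) ring"
  assumes finite_verts: "finite (verts G)"
  defines "A \<equiv> path_algebra G"
begin

lemma add_eq: "f \<oplus>\<^bsub>A\<^esub> g = (\<lambda>q. f q + g q)"
  by (simp add: A_def path_algebra_add)

lemma zero_eq: "\<zero>\<^bsub>A\<^esub> = (\<lambda>_. 0)"
  by (simp add: A_def path_algebra_zero)

lemma one_eq: "\<one>\<^bsub>A\<^esub> = (\<lambda>(u, p). if u \<in> verts G \<and> p = [] then 1 else 0)"
  by (simp add: A_def path_algebra_one)

lemma mult_eq: "(f \<otimes>\<^bsub>A\<^esub> g) (u, p) =
     (\<Sum>i\<le>length p. f (u, take i p) * g (awlast u (take i p), drop i p))"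
  by (simp add: A_def path_algebra_mult)

lemma carrier_iff: "f \<in> carrier A \<longleftrightarrow>
     finite {q. f q \<noteq> 0} \<and> {q. f q \<noteq> 0} \<subseteq> quiver_paths G"
  by (simp add: A_def path_algebra_carrier)

lemma quiver_paths_iff: "(u, p) \<in> quiver_paths G \<longleftrightarrow> awalk u p (awlast u p)"
  by (auto simp: quiver_paths_def awlast_of_awalk)

lemma append_quiver_paths:
  "(u, p @ q) \<in> quiver_paths G \<longleftrightarrow> (u, p) \<in> quiver_paths G \<and> (awlast u p, q) \<in> quiver_paths G"
  by (auto simp: quiver_paths_iff awlast_append)

lemma mult_closed: assumes "f \<in> carrier A" "g \<in> carrier A" shows "f \<otimes>\<^bsub>A\<^esub> g \<in> carrier A"
proof -
  let ?S = "{x. f x \<noteq> 0}" and ?T = "{x. g x \<noteq> 0}"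
  have *: "\<exists>p1 p2. p = p1 @ p2 \<and> (u, p1) \<in> ?S \<and> (awlast u p1, p2) \<in> ?T"
    if "(f \<otimes>\<^bsub>A\<^esub> g) (u, p) \<noteq> 0" for u p
  proof -
    from that obtain i where "f (u, take i p) * g (awlast u (take i p), drop i p) \<noteq> 0"
      unfolding mult_eq by (meson sum.neutral)
    then show ?thesis by (intro exI[of _ "take i p"] exI[of _ "drop i p"]) auto
  qed
  have "{q. (f \<otimes>\<^bsub>A\<^esub> g) q \<noteq> 0} \<subseteq> (\<lambda>((u, p), (v, q)). (u, p @ q)) ` (?S \<times> ?T)"
    by (auto simp: image_iff split_beta dest!: *) (metis fst_conv snd_conv)
  moreover have "finite (?S \<times> ?T)" using assms by (simp add: carrier_iff)
  ultimately have "finite {q. (f \<otimes>\<^bsub>A\<^esub> g) q \<noteq> 0}" by (meson finite_imageI finite_subset)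
  moreover have "{q. (f \<otimes>\<^bsub>A\<^esub> g) q \<noteq> 0} \<subseteq> quiver_paths G"
    using assms by (auto simp: carrier_iff append_quiver_paths dest!: *)
  ultimately show ?thesis by (simp add: carrier_iff)
qed

lemma mult_assoc: "(f \<otimes>\<^bsub>A\<^esub> g) \<otimes>\<^bsub>A\<^esub> h = f \<otimes>\<^bsub>A\<^esub> (g \<otimes>\<^bsub>A\<^esub> h)"
proof (rule ext, clarify)
  fix u and p :: "'a list"
  let ?n = "length p"
  \<comment> \<open>Both bracketings sum over the cuts of \<open>p\<close> into three pieces;
    \<open>i\<close> and \<open>j\<close> are the lengths of the first two.\<close>
  define t where "t i j = f (u, take i p) * (g (awlast u (take i p), take j (drop i p))
     * h (awlast u (take (i + j) p), drop (i + j) p))" for i j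
  have "((f \<otimes>\<^bsub>A\<^esub> g) \<otimes>\<^bsub>A\<^esub> h) (u, p) = (\<Sum>k\<le>?n. \<Sum>i\<le>k. t i (k - i))"
    by (auto simp: mult_eq t_def sum_distrib_right drop_take min_def mult.assoc intro!: sum.cong)
  also have "\<dots> = (\<Sum>(i, j)\<in>{(i, j). i + j \<le> ?n}. t i j)"
    by (rule sum.triangle_reindex_eq[symmetric])
  also have "{(i, j). i + j \<le> ?n} = (SIGMA i:{..?n}. {..?n - i})" by auto
  also have "(\<Sum>(i, j)\<in>(SIGMA i:{..?n}. {..?n - i}). t i j) = (\<Sum>i\<le>?n. \<Sum>j\<le>?n - i. t i j)"
    by (rule sum.Sigma[symmetric]) auto
  also have "\<dots> = (f \<otimes>\<^bsub>A\<^esub> (g \<otimes>\<^bsub>A\<^esub> h)) (u, p)"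
    by (simp add: mult_eq t_def sum_distrib_left awlast_append[symmetric] take_add add.commute)
  finally show "((f \<otimes>\<^bsub>A\<^esub> g) \<otimes>\<^bsub>A\<^esub> h) (u, p) = (f \<otimes>\<^bsub>A\<^esub> (g \<otimes>\<^bsub>A\<^esub> h)) (u, p)" .
qed

lemma scaled_one_mult:
  assumes "f \<in> carrier A"
  shows "(\<lambda>q. c * \<one>\<^bsub>A\<^esub> q) \<otimes>\<^bsub>A\<^esub> f = (\<lambda>q. c * f q)"
proof (rule ext, clarify)
  fix u and p :: "'a list"
  have "f (u, p) = 0" if "u \<notin> verts G"
    using assms that by (auto simp: carrier_iff quiver_paths_def)
  moreover have "((\<lambda>q. c * \<one>\<^bsub>A\<^esub> q) \<otimes>\<^bsub>A\<^esub> f) (u, p)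
     = (\<Sum>i\<le>length p. if i = 0 then c * (if u \<in> verts G then f (u, p) else 0) else 0)"
    unfolding mult_eq by (rule sum.cong) (auto simp: one_eq)
  ultimately show "((\<lambda>q. c * \<one>\<^bsub>A\<^esub> q) \<otimes>\<^bsub>A\<^esub> f) (u, p) = c * f (u, p)"
    by auto
qed

lemma mult_scaled_one:
  assumes "f \<in> carrier A"
  shows "f \<otimes>\<^bsub>A\<^esub> (\<lambda>q. c * \<one>\<^bsub>A\<^esub> q) = (\<lambda>q. c * f q)"
proof (rule ext, clarify)
  fix u and p :: "'a list"
  have "f (u, p) = 0" if "awlast u p \<notin> verts G"
    using assms that awalk_last_in_verts[of u p "awlast u p"]
    by (auto simp: carrier_iff quiver_paths_iff[symmetric])
  moreover have "(f \<otimes>\<^bsub>A\<^esub> (\<lambda>q. c * \<one>\<^bsub>A\<^esub> q)) (u, p) = (\<Sum>i\<le>length p.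
      if i = length p then c * (if awlast u p \<in> verts G then f (u, p) else 0) else 0)"
    unfolding mult_eq by (rule sum.cong) (auto simp: one_eq)
  ultimately show "(f \<otimes>\<^bsub>A\<^esub> (\<lambda>q. c * \<one>\<^bsub>A\<^esub> q)) (u, p) = c * f (u, p)"
    by auto
qed

lemma scaled_closed: assumes "f \<in> carrier A" shows "(\<lambda>q. c * f q) \<in> carrier A"
proof -
  have "{q. c * f q \<noteq> 0} \<subseteq> {q. f q \<noteq> 0}" by auto
  then show ?thesis using assms
    unfolding carrier_iff by (metis (lifting) finite_subset subset_trans)
qed

lemma one_closed: "\<one>\<^bsub>A\<^esub> \<in> carrier A"
proof -
  have "{q. \<one>\<^bsub>A\<^esub> q \<noteq> 0} = (\<lambda>u. (u, [])) ` verts G" by (auto simp: one_eq split: if_splits)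
  then show ?thesis using finite_verts by (auto simp: carrier_iff quiver_paths_iff awalk_Nil_iff)
qed

sublocale ring A
proof (rule ringI)
  show "abelian_group A"
  proof (rule abelian_groupI)
    fix f g assume fg: "f \<in> carrier A" "g \<in> carrier A"
    have "{q. f q + g q \<noteq> 0} \<subseteq> {q. f q \<noteq> 0} \<union> {q. g q \<noteq> 0}" by auto
    then show "f \<oplus>\<^bsub>A\<^esub> g \<in> carrier A" using fg
      by (simp add: carrier_iff add_eq) (meson Un_least finite_UnI finite_subset order_trans)
    show "\<exists>g\<in>carrier A. g \<oplus>\<^bsub>A\<^esub> f = \<zero>\<^bsub>A\<^esub>"
      using scaled_closed[OF fg(1), of "- 1"] by (intro bexI[of _ "\<lambda>q. - 1 * f q"]) (auto simp: add_eq zero_eq)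
  qed (auto simp: add_eq zero_eq carrier_iff add.assoc add.commute)
  show "Group.monoid A"
    using scaled_one_mult[of _ 1] mult_scaled_one[of _ 1]
    by (intro Group.monoidI) (auto simp: mult_closed one_closed mult_assoc)
qed (auto simp: fun_eq_iff mult_eq add_eq algebra_simps sum.distrib)

lemma minus_eq:
  assumes "f \<in> carrier A" "g \<in> carrier A"
  shows "f \<ominus>\<^bsub>A\<^esub> g = (\<lambda>q. f q - g q)"
proof -
  have "\<ominus>\<^bsub>A\<^esub> g = (\<lambda>q. - 1 * g q)"
    using assms scaled_closed[OF assms(2), of "- 1"]
    by (intro minus_equality) (auto simp: add_eq zero_eq)
  then show ?thesis by (simp add: a_minus_def add_eq)
qed

subsection \<open>Paths\<close>

lemma path_elem_closed: "x \<in> quiver_paths G \<Longrightarrow> path_elem x \<in> carrier A"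
  by (auto simp: carrier_iff path_elem_def)

lemma path_elem_mult:
  "path_elem (u, p) \<otimes>\<^bsub>A\<^esub> path_elem (v, q) = (if awlast u p = v then path_elem (u, p @ q) else \<zero>\<^bsub>A\<^esub>)"
proof (rule ext, clarify)
  fix u' and p' :: "'a list"
  have "(path_elem (u, p) \<otimes>\<^bsub>A\<^esub> path_elem (v, q)) (u', p') = (\<Sum>i\<le>length p'.
      if i = length p then if awlast u p = v \<and> u' = u \<and> p' = p @ q then 1 else 0 else 0)"
    unfolding mult_eq
  proof (rule sum.cong, goal_cases)
    case (2 i)
    show ?case
    proof (cases "take i p' = p")
      case True
      then have "i = length p" "p' = p @ drop i p'"
        using 2 append_take_drop_id[of i p'] by auto
      then show ?thesis by (auto simp: path_elem_def)
    next
      case False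
      then show ?thesis by (auto simp: path_elem_def)
    qed
  qed simp
  then show "(path_elem (u, p) \<otimes>\<^bsub>A\<^esub> path_elem (v, q)) (u', p') =
      (if awlast u p = v then path_elem (u, p @ q) else \<zero>\<^bsub>A\<^esub>) (u', p')"
    by (auto simp: path_elem_def zero_eq)
qed

text \<open>Induction on the support, removing one path at a time. It reduces additive claims to
  scalar multiples of single paths.\<close>

lemma path_algebra_induct [consumes 1, case_names zero add path]:
  assumes "f \<in> carrier A" and "P \<zero>\<^bsub>A\<^esub>"
    and "\<And>f g. f \<in> carrier A \<Longrightarrow> g \<in> carrier A \<Longrightarrow> P f \<Longrightarrow> P g \<Longrightarrow> P (f \<oplus>\<^bsub>A\<^esub> g)"
    and "\<And>c u p. (u, p) \<in> quiver_paths G \<Longrightarrow> P (\<lambda>q. c * path_elem (u, p) q)"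
  shows "P f"
proof -
  have "finite {q. f q \<noteq> 0}" using assms(1) by (simp add: carrier_iff)
  then have "{q. f q \<noteq> 0} \<subseteq> quiver_paths G \<longrightarrow> P f"
  proof (induction "{q. f q \<noteq> 0}" arbitrary: f rule: finite_induct)
    case empty
    then have "f = \<zero>\<^bsub>A\<^esub>" by (auto simp: zero_eq)
    then show ?case using assms(2) by simp
  next
    case (insert x F)
    show ?case
    proof
      assume f: "{q. f q \<noteq> 0} \<subseteq> quiver_paths G"
      define g where "g = f(x := 0)"
      have F: "F = {q. g q \<noteq> 0}" using insert(2,4) by (auto simp: g_def)
      have x: "x \<in> quiver_paths G" using f insert(4) by auto
      have "g \<in> carrier A" using F f insert by (auto simp: carrier_iff)
      moreover have "P g" using insert(3)[OF F] F insert(4) f by auto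
      moreover have "f = (\<lambda>q. f x * path_elem x q) \<oplus>\<^bsub>A\<^esub> g"
        by (auto simp: fun_eq_iff add_eq g_def path_elem_def)
      ultimately show "P f"
        using assms(3,4) x scaled_closed[OF path_elem_closed[OF x]]
        by (cases x) (metis (no_types))
    qed
  qed
  then show ?thesis using assms(1) by (simp add: carrier_iff)
qed

end

section \<open>The preprojective algebra and its array basis\<close>

lemma D_quiver_simps [simp]:
  "tail (D_quiver n) = arrow_tail" "head (D_quiver n) = arrow_head"
  by (simp_all add: D_quiver_def)

lemma arcs_D_quiver:
  "a \<in> arcs (D_quiver n) \<longleftrightarrow> (case a of X i \<Rightarrow> 1 \<le> i \<and> i \<le> int n - 2 | Y i \<Rightarrow> 2 \<le> i \<and> i \<le> int n - 1 | _ \<Rightarrow> True)"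
  by (auto simp: D_quiver_def split: arrow.splits)

lemma finite_verts_D_quiver: "finite (verts (D_quiver n))"
  by (simp add: D_quiver_def)

lemma wf_digraph_D_quiver: "n \<ge> 4 \<Longrightarrow> wf_digraph (D_quiver n)"
  by unfold_locales (auto simp: arcs_D_quiver verts_D_quiver split: arrow.splits)

lemma arrow_eqI:
  assumes "a \<in> arcs (D_quiver n)" "b \<in> arcs (D_quiver n)"
    and "arrow_tail a = arrow_tail b" "arrow_head a = arrow_head b"
  shows "a = b"
  using assms by (cases a; cases b) (auto simp: arcs_D_quiver)

text \<open>Meant for adjacent vertices only. The vertex -1 is treated first because the order of
  the integers does not reflect its single neighbour 2.\<close>

definition arrow_between :: "int \<Rightarrow> int \<Rightarrow> arrow" where
  "arrow_between i j = (if i = -1 then X' else if j = -1 then Y' else if i < j then X i else Y i)"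

lemma array_entry_less: "c < r \<Longrightarrow> array_entry l r c = int r + 1 - int c"
  by (simp add: array_entry_def)

lemma array_entry_diag_Suc: "r \<ge> 1 \<Longrightarrow> array_entry l (Suc r) (Suc r) = - array_entry l r r"
  by (cases r) (simp_all add: array_entry_def)

lemma positions_iff: "(r, c) \<in> positions n \<longleftrightarrow> 1 \<le> c \<and> c \<le> r \<and> r < n"
  by (simp add: positions_def)

lemma set_array_positions: "set (array_positions n) = positions n"
  by (force simp: array_positions_def positions_def)

lemma distinct_array_positions: "distinct (array_positions n)"
proof -
  have "distinct [(r, c). r \<leftarrow> rs, c \<leftarrow> [1..<Suc r]]" if "distinct rs" for rs
    using that by (induction rs) (auto simp: distinct_map inj_on_def)
  then show ?thesis by (simp add: array_positions_def del: upt_Suc)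
qed

text \<open>The path leads from the box back to the generator, leftwards along the row and then up
  the first column. Left multiplication prepends arrows, so the box is built by moves down followed
  by moves to the right.\<close>

function array_path :: "int \<Rightarrow> nat \<Rightarrow> nat \<Rightarrow> arrow list" where
  "array_path l r c =
    (if 1 < c then arrow_between (array_entry l r c) (array_entry l r (c - 1)) # array_path l r (c - 1)
     else if 1 < r then arrow_between (array_entry l r c) (array_entry l (r - 1) c) # array_path l (r - 1) c
     else [])"
  by auto
termination by (relation "measure (\<lambda>(l, r, c). r + c)") auto

declare array_path.simps [simp del]

text \<open>A partial map on positions, with \<open>None\<close> for the zero vector. For
  \<open>l = 1\<close> or \<open>l = -1\<close> the order of the tests is immaterial: if
  \<open>c < r\<close>, the entries below and to the right differ.\<close>

definition step :: "nat \<Rightarrow> int \<Rightarrow> arrow \<Rightarrow> nat \<times> nat \<Rightarrow> (nat \<times> nat) option" where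
  "step n l a = (\<lambda>(r, c).
     if r < n - 1 \<and> arrow_head a = array_entry l r c \<and> arrow_tail a = array_entry l (r + 1) c
     then Some (r + 1, c)
     else if c < r \<and> arrow_head a = array_entry l r c \<and> arrow_tail a = array_entry l r (c + 1)
     then Some (r, c + 1) else None)"

section \<open>The quotient of the path algebra by the relations\<close>

locale type_D =
  fixes n :: nat and l :: int
    and A :: "'k::field path_elt ring" and P :: "'k preproj_elt ring"
  assumes n: "n \<ge> 4" and l: "l = 1 \<or> l = -1"
  defines A_eq: "A \<equiv> path_algebra (D_quiver n)" and P_eq: "P \<equiv> preproj n"
begin

sublocale A: finite_quiver "D_quiver n" A
  by (intro finite_quiver.intro finite_quiver_axioms.intro wf_digraph_D_quiver n finite_verts_D_quiver)
    (rule A_eq)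

definition cls :: "'k path_elt \<Rightarrow> 'k preproj_elt" where
  "cls f = D_ideal n +>\<^bsub>A\<^esub> f"

lemma quiver_path_Nil: "(u, []) \<in> quiver_paths (D_quiver n) \<longleftrightarrow> u \<in> verts (D_quiver n)"
  by (simp add: A.quiver_paths_iff A.awalk_Nil_iff)

lemma quiver_path_Cons:
  "(u, a # p) \<in> quiver_paths (D_quiver n) \<longleftrightarrow>
     a \<in> arcs (D_quiver n) \<and> u = arrow_tail a \<and> (arrow_head a, p) \<in> quiver_paths (D_quiver n)"
  by (auto simp: A.quiver_paths_iff A.awalk_Cons_iff)

lemma arrow_path_closed: "a \<in> arcs (D_quiver n) \<Longrightarrow> arrow_path a \<in> carrier A"
  using A.head_in_verts[of a] unfolding arrow_path_def
  by (intro A.path_elem_closed) (simp add: quiver_path_Cons quiver_path_Nil)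

lemma arrow_path_mult:
  "arrow_path a \<otimes>\<^bsub>A\<^esub> path_elem (u, p) =
     (if arrow_head a = u then path_elem (arrow_tail a, a # p) else \<zero>\<^bsub>A\<^esub>)"
  by (simp add: arrow_path_def A.path_elem_mult)

lemma D_relations_closed: "D_relations n \<subseteq> carrier A"
proof -
  have "X i \<in> arcs (D_quiver n)" if "1 \<le> i" "i \<le> int n - 2" for i
    using that by (simp add: arcs_D_quiver)
  moreover have "Y i \<in> arcs (D_quiver n)" if "2 \<le> i" "i \<le> int n - 1" for i
    using that by (simp add: arcs_D_quiver)
  moreover have "X' \<in> arcs (D_quiver n)" "Y' \<in> arcs (D_quiver n)"
    by (simp_all add: arcs_D_quiver)
  ultimately show ?thesis
    using n unfolding D_relations_def Let_def A_eq[symmetric]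
    by (auto intro!: arrow_path_closed A.m_closed A.minus_closed A.a_closed)
qed

lemma D_ideal_ideal: "ideal (D_ideal n) A"
  unfolding D_ideal_def A_eq[symmetric] by (rule A.genideal_ideal[OF D_relations_closed])

sublocale I: ideal "D_ideal n" A
  by (rule D_ideal_ideal)

lemma P_Quot: "P = A Quot D_ideal n"
  by (simp add: P_eq preproj_def A_eq)

sublocale H: ring_hom_ring A P cls
  using I.rcos_ring_hom_ring unfolding P_Quot cls_def[abs_def] .

lemma carrier_P: "carrier P = cls ` carrier A"
  unfolding P_Quot FactRing_def A_RCOSETS_def' cls_def by auto

lemma cls_closed [simp]: "f \<in> carrier A \<Longrightarrow> cls f \<in> carrier P"
  by simp

lemma zero_P: "\<zero>\<^bsub>P\<^esub> = D_ideal n"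
  by (simp add: P_Quot FactRing_def)

lemma cls_eq_zero_iff: "f \<in> carrier A \<Longrightarrow> cls f = \<zero>\<^bsub>P\<^esub> \<longleftrightarrow> f \<in> D_ideal n"
  unfolding zero_P cls_def using I.rcos_const_imp_mem I.a_rcos_const by blast

lemma idem_eq: "idem n i = cls (path_elem (i, []))"
  by (simp add: idem_def cls_def A_eq)

lemma arrow_cls_eq: "arrow_cls n a = cls (arrow_path a)"
  by (simp add: arrow_cls_def cls_def A_eq)

lemma idem_closed: "i \<in> verts (D_quiver n) \<Longrightarrow> idem n i \<in> carrier P"
  unfolding idem_eq by (simp add: A.path_elem_closed quiver_path_Nil)

lemma arrow_cls_closed: "a \<in> arcs (D_quiver n) \<Longrightarrow> arrow_cls n a \<in> carrier P"
  unfolding arrow_cls_eq by (simp add: arrow_path_closed)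

lemma relation_zero: "f \<in> D_relations n \<Longrightarrow> cls f = \<zero>\<^bsub>P\<^esub>"
  using D_relations_closed A.genideal_self[OF D_relations_closed]
  by (subst cls_eq_zero_iff) (auto simp: D_ideal_def A_eq)

lemma relation_eq:
  assumes "f \<ominus>\<^bsub>A\<^esub> g \<in> D_relations n" "f \<in> carrier A" "g \<in> carrier A"
  shows "cls f = cls g"
proof -
  have "cls f \<ominus>\<^bsub>P\<^esub> cls g = \<zero>\<^bsub>P\<^esub>"
    using relation_zero[OF assms(1)] assms(2,3) by (simp add: a_minus_def)
  then show ?thesis using assms by (simp add: H.S.r_right_minus_eq)
qed

lemma arc_simps:
  "1 \<le> i \<Longrightarrow> i \<le> int n - 2 \<Longrightarrow> X i \<in> arcs (D_quiver n)"
  "2 \<le> i \<Longrightarrow> i \<le> int n - 1 \<Longrightarrow> Y i \<in> arcs (D_quiver n)"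
  "X' \<in> arcs (D_quiver n)" "Y' \<in> arcs (D_quiver n)"
  by (simp_all add: arcs_D_quiver)

lemma relations:
  "arrow_cls n (X 1) \<otimes>\<^bsub>P\<^esub> arrow_cls n (Y 2) = \<zero>\<^bsub>P\<^esub>"
  "arrow_cls n X' \<otimes>\<^bsub>P\<^esub> arrow_cls n Y' = \<zero>\<^bsub>P\<^esub>"
  "arrow_cls n (X 2) \<otimes>\<^bsub>P\<^esub> arrow_cls n (Y 3) =
     arrow_cls n (Y 2) \<otimes>\<^bsub>P\<^esub> arrow_cls n (X 1) \<oplus>\<^bsub>P\<^esub> arrow_cls n Y' \<otimes>\<^bsub>P\<^esub> arrow_cls n X'"
  "arrow_cls n (Y (int n - 1)) \<otimes>\<^bsub>P\<^esub> arrow_cls n (X (int n - 2)) = \<zero>\<^bsub>P\<^esub>"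
  "3 \<le> i \<Longrightarrow> i \<le> int n - 2 \<Longrightarrow>
     arrow_cls n (X i) \<otimes>\<^bsub>P\<^esub> arrow_cls n (Y (i + 1)) = arrow_cls n (Y i) \<otimes>\<^bsub>P\<^esub> arrow_cls n (X (i - 1))"
proof -
  note c = arrow_path_closed[OF arc_simps(1)] arrow_path_closed[OF arc_simps(2)]
    arrow_path_closed[OF arc_simps(3)] arrow_path_closed[OF arc_simps(4)]
  let ?x = "\<lambda>i. arrow_path (X i)" and ?y = "\<lambda>i. arrow_path (Y i)"
  have *: "?x 1 \<otimes>\<^bsub>A\<^esub> ?y 2 \<in> D_relations n"
    "arrow_path X' \<otimes>\<^bsub>A\<^esub> arrow_path Y' \<in> D_relations n"
    "?y (int n - 1) \<otimes>\<^bsub>A\<^esub> ?x (int n - 2) \<in> D_relations n"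
    "?x 2 \<otimes>\<^bsub>A\<^esub> ?y 3 \<ominus>\<^bsub>A\<^esub> (?y 2 \<otimes>\<^bsub>A\<^esub> ?x 1 \<oplus>\<^bsub>A\<^esub> arrow_path Y' \<otimes>\<^bsub>A\<^esub> arrow_path X') \<in> D_relations n"
    unfolding D_relations_def Let_def A_eq by auto
  show "arrow_cls n (X 1) \<otimes>\<^bsub>P\<^esub> arrow_cls n (Y 2) = \<zero>\<^bsub>P\<^esub>"
    "arrow_cls n X' \<otimes>\<^bsub>P\<^esub> arrow_cls n Y' = \<zero>\<^bsub>P\<^esub>"
    "arrow_cls n (Y (int n - 1)) \<otimes>\<^bsub>P\<^esub> arrow_cls n (X (int n - 2)) = \<zero>\<^bsub>P\<^esub>"
    using relation_zero[OF *(1)] relation_zero[OF *(2)] relation_zero[OF *(3)] n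
    by (simp_all add: arrow_cls_eq c)
  show "arrow_cls n (X 2) \<otimes>\<^bsub>P\<^esub> arrow_cls n (Y 3) =
     arrow_cls n (Y 2) \<otimes>\<^bsub>P\<^esub> arrow_cls n (X 1) \<oplus>\<^bsub>P\<^esub> arrow_cls n Y' \<otimes>\<^bsub>P\<^esub> arrow_cls n X'"
    using relation_eq[OF *(4)] n by (simp add: arrow_cls_eq c)
  show "arrow_cls n (X i) \<otimes>\<^bsub>P\<^esub> arrow_cls n (Y (i + 1)) = arrow_cls n (Y i) \<otimes>\<^bsub>P\<^esub> arrow_cls n (X (i - 1))"
    if "3 \<le> i" "i \<le> int n - 2"
  proof -
    have "?x i \<otimes>\<^bsub>A\<^esub> ?y (i + 1) \<ominus>\<^bsub>A\<^esub> ?y i \<otimes>\<^bsub>A\<^esub> ?x (i - 1) \<in> D_relations n"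
      using that unfolding D_relations_def Let_def A_eq by blast
    from relation_eq[OF this] show ?thesis using that by (simp add: arrow_cls_eq c)
  qed
qed

section \<open>The elements attached to the boxes and the action of the arrows on them\<close>

definition basis_elt :: "nat \<Rightarrow> nat \<Rightarrow> 'k preproj_elt" where
  "basis_elt r c = cls (path_elem (array_entry l r c, array_path l r c))"

lemma array_entry_verts: "(r, c) \<in> positions n \<Longrightarrow> array_entry l r c \<in> verts (D_quiver n)"
  using l array_entry_diag[OF l, of r]
  by (cases "c = r") (auto simp: verts_D_quiver positions_iff array_entry_less n)

lemma arrow_between_down:
  assumes "(r, c) \<in> positions n" "r + 1 < n"
  defines "a \<equiv> arrow_between (array_entry l (r + 1) c) (array_entry l r c)"
  shows "a \<in> arcs (D_quiver n)" "arrow_tail a = array_entry l (r + 1) c"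
    "arrow_head a = array_entry l r c"
  using assms(1,2) array_entry_diag[OF l, of r] n
  by (cases "c = r"; auto simp: a_def arrow_between_def positions_iff array_entry_less arcs_D_quiver)+

lemma arrow_between_right:
  assumes "(r, c) \<in> positions n" "c < r"
  defines "a \<equiv> arrow_between (array_entry l r (c + 1)) (array_entry l r c)"
  shows "a \<in> arcs (D_quiver n)" "arrow_tail a = array_entry l r (c + 1)"
    "arrow_head a = array_entry l r c"
  using assms(1,2) array_entry_diag[OF l, of r] n
  by (cases "c + 1 = r"; auto simp: a_def arrow_between_def positions_iff array_entry_less arcs_D_quiver)+

text \<open>Reaches each box along the route of \<open>array_path\<close>.\<close>

lemma positions_induct [consumes 1, case_names start down right]:
  assumes "(r, c) \<in> positions n" and "Q 1 1"
    and down: "\<And>r. (r, 1) \<in> positions n \<Longrightarrow> r + 1 < n \<Longrightarrow> Q r 1 \<Longrightarrow> Q (r + 1) 1"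
    and right: "\<And>r c. (r, c) \<in> positions n \<Longrightarrow> c < r \<Longrightarrow> Q r c \<Longrightarrow> Q r (c + 1)"
  shows "Q r c"
proof -
  have "1 \<le> r" "1 \<le> c" using assms(1) by (auto simp: positions_iff)
  have col: "r < n \<Longrightarrow> Q r 1"
    using \<open>1 \<le> r\<close> by (induction r rule: dec_induct) (use assms(2) down in \<open>auto simp: positions_iff\<close>)
  from \<open>1 \<le> c\<close> assms(1) show ?thesis
    by (induction c rule: dec_induct) (use col right in \<open>auto simp: positions_iff\<close>)
qed

lemma array_path_start: "array_path l 1 1 = []"
  and array_path_down: "1 \<le> r \<Longrightarrow> array_path l (r + 1) 1 =
    arrow_between (array_entry l (r + 1) 1) (array_entry l r 1) # array_path l r 1"
  and array_path_right: "1 \<le> c \<Longrightarrow> array_path l r (c + 1) =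
    arrow_between (array_entry l r (c + 1)) (array_entry l r c) # array_path l r c"
  by (subst array_path.simps; simp)+

lemma array_entry_start: "array_entry l 1 1 = l"
  by (simp add: array_entry_def)

lemma array_path_quiver_path:
  assumes "(r, c) \<in> positions n"
  shows "(array_entry l r c, array_path l r c) \<in> quiver_paths (D_quiver n)
     \<and> A.awlast (array_entry l r c) (array_path l r c) = l"
  using assms
proof (induction rule: positions_induct)
  case start
  show ?case
    unfolding array_path_start array_entry_start quiver_path_Nil
    using l n by (auto simp: verts_D_quiver)
next
  case (down r)
  then show ?case
    using arrow_between_down[OF down(1,2)]
    by (simp only: array_path_down[of r] positions_iff quiver_path_Cons A.awalk_verts.simps
        A.awalk_verts_non_Nil last_ConsR D_quiver_simps not_False_eq_True if_False)
next
  case (right r c)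
  then show ?case
    using arrow_between_right[OF right(1,2)]
    by (simp only: array_path_right[of c] positions_iff quiver_path_Cons A.awalk_verts.simps
        A.awalk_verts_non_Nil last_ConsR D_quiver_simps not_False_eq_True if_False)
qed

lemma path_closed: "(r, c) \<in> positions n \<Longrightarrow> path_elem (array_entry l r c, array_path l r c) \<in> carrier A"
  using array_path_quiver_path A.path_elem_closed by blast

lemma basis_elt_closed: "(r, c) \<in> positions n \<Longrightarrow> basis_elt r c \<in> carrier P"
  unfolding basis_elt_def by (intro cls_closed path_closed)

lemma basis_elt_start: "basis_elt 1 1 = idem n l"
  by (simp only: basis_elt_def array_path_start array_entry_start idem_eq)

lemma idem_basis_elt:
  assumes "(r, c) \<in> positions n" "i \<in> verts (D_quiver n)"
  shows "idem n i \<otimes>\<^bsub>P\<^esub> basis_elt r c = (if array_entry l r c = i then basis_elt r c else \<zero>\<^bsub>P\<^esub>)"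
proof -
  have "path_elem (i, []) \<in> carrier A" using assms(2) by (simp add: A.path_elem_closed quiver_path_Nil)
  then have "idem n i \<otimes>\<^bsub>P\<^esub> basis_elt r c =
      cls (path_elem (i, []) \<otimes>\<^bsub>A\<^esub> path_elem (array_entry l r c, array_path l r c))"
    using path_closed[OF assms(1)] by (simp add: idem_eq basis_elt_def)
  then show ?thesis by (auto simp: A.path_elem_mult basis_elt_def)
qed

lemma basis_elt_idem:
  assumes "(r, c) \<in> positions n"
  shows "basis_elt r c \<otimes>\<^bsub>P\<^esub> idem n l = basis_elt r c"
proof -
  have "path_elem (l, []) \<in> carrier A"
    using l n by (auto intro!: A.path_elem_closed simp: quiver_path_Nil verts_D_quiver)
  then have "basis_elt r c \<otimes>\<^bsub>P\<^esub> idem n l =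
      cls (path_elem (array_entry l r c, array_path l r c) \<otimes>\<^bsub>A\<^esub> path_elem (l, []))"
    using path_closed[OF assms(1)] by (simp add: idem_eq basis_elt_def)
  then show ?thesis using array_path_quiver_path[OF assms] by (simp add: A.path_elem_mult basis_elt_def)
qed

lemma arrow_basis_elt:
  assumes "(r, c) \<in> positions n" "a \<in> arcs (D_quiver n)"
  shows "arrow_cls n a \<otimes>\<^bsub>P\<^esub> basis_elt r c =
    (if arrow_head a = array_entry l r c then cls (path_elem (arrow_tail a, a # array_path l r c)) else \<zero>\<^bsub>P\<^esub>)"
proof -
  have "arrow_cls n a \<otimes>\<^bsub>P\<^esub> basis_elt r c =
      cls (arrow_path a \<otimes>\<^bsub>A\<^esub> path_elem (array_entry l r c, array_path l r c))"
    using path_closed[OF assms(1)] arrow_path_closed[OF assms(2)] by (simp add: arrow_cls_eq basis_elt_def)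
  then show ?thesis by (simp add: arrow_path_mult)
qed

lemma arrow_basis_elt_right:
  assumes "(r, c) \<in> positions n" "c < r" "a \<in> arcs (D_quiver n)"
    and "arrow_head a = array_entry l r c" "arrow_tail a = array_entry l r (c + 1)"
  shows "arrow_cls n a \<otimes>\<^bsub>P\<^esub> basis_elt r c = basis_elt r (c + 1)"
proof -
  have "a = arrow_between (array_entry l r (c + 1)) (array_entry l r c)"
    using arrow_between_right[OF assms(1,2)] assms(3-5) by (intro arrow_eqI) auto
  then show ?thesis
    using assms array_path_right[of c r] unfolding arrow_basis_elt[OF assms(1,3)]
    by (auto simp: basis_elt_def positions_iff)
qed

lemma arrow_basis_elt_first_column:
  assumes "1 \<le> r" "r + 1 < n" "a \<in> arcs (D_quiver n)"
    and "arrow_head a = array_entry l r 1" "arrow_tail a = array_entry l (r + 1) 1"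
  shows "arrow_cls n a \<otimes>\<^bsub>P\<^esub> basis_elt r 1 = basis_elt (r + 1) 1"
proof -
  have r: "(r, 1) \<in> positions n" using assms by (auto simp: positions_iff)
  have "a = arrow_between (array_entry l (r + 1) 1) (array_entry l r 1)"
    using arrow_between_down[OF r assms(2)] assms(3-5) by (intro arrow_eqI) auto
  then show ?thesis
    using assms array_path_down[of r] unfolding arrow_basis_elt[OF r assms(3)]
    by (auto simp: basis_elt_def)
qed

lemma opposite_arrows:
  assumes "a \<in> arcs (D_quiver n)" "b \<in> arcs (D_quiver n)" "\<bar>e\<bar> = 1"
    and "arrow_tail a = e" "arrow_head a = 2" "arrow_tail b = 2" "arrow_head b = e"
  shows "arrow_cls n a \<otimes>\<^bsub>P\<^esub> arrow_cls n b = \<zero>\<^bsub>P\<^esub>"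
proof (cases "e = 1")
  case True
  then have "a = X 1" "b = Y 2"
    using assms n by (auto intro!: arrow_eqI[of _ n] simp: arc_simps)
  then show ?thesis using relations(1) by simp
next
  case False
  then have "e = -1" using assms(3) by auto
  then have "a = X'" "b = Y'"
    using assms n by (auto intro!: arrow_eqI[of _ n] simp: arc_simps)
  then show ?thesis using relations(2) by simp
qed

lemmas elt_closed = arrow_cls_closed basis_elt_closed

lemma arrow_basis_elt_row:
  assumes "1 \<le> r" "r < n"
  shows "(\<forall>b \<in> arcs (D_quiver n). 2 \<le> r \<longrightarrow> arrow_head b = 2 \<longrightarrow> arrow_tail b = - array_entry l r r \<longrightarrow>
      arrow_cls n b \<otimes>\<^bsub>P\<^esub> basis_elt r (r - 1) = \<zero>\<^bsub>P\<^esub>) \<and>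
     (\<forall>c a. (r, c) \<in> positions n \<longrightarrow> a \<in> arcs (D_quiver n) \<longrightarrow> arrow_head a = array_entry l r c \<longrightarrow>
      arrow_tail a = array_entry l (r + 1) c \<longrightarrow>
      arrow_cls n a \<otimes>\<^bsub>P\<^esub> basis_elt r c = (if r + 1 < n then basis_elt (r + 1) c else \<zero>\<^bsub>P\<^esub>))"
    (is "_ \<and> (\<forall>c a. _ \<longrightarrow> _ \<longrightarrow> _ \<longrightarrow> _ \<longrightarrow> ?down r c a)")
  using assms
proof (induction r rule: dec_induct)
    case base
    have "c = 1" if "(1, c) \<in> positions n" for c using that by (auto simp: positions_iff)
    then show ?case using arrow_basis_elt_first_column[of 1] n by auto
  next
    case (step q)
    have q: "1 \<le> q" "q + 1 < n" using step.hyps step.prems by auto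
    define r where "r = q + 1"
    have r: "2 \<le> r" "1 \<le> r" "r < n" using q by (auto simp: r_def)
    note diag = array_entry_diag[OF l r(2)]
    have e: "\<bar>array_entry l r r\<bar> = 1" using diag by auto
    \<comment> \<open>The box \<open>(r, r - 1)\<close> arises from \<open>(q, q)\<close>, whose
      entry is the opposite of the last entry of row \<open>r\<close>. An arrow back to that vertex
      completes a walk from an end vertex to 2 and back, which is a relation.\<close>
    have wrong: "arrow_cls n b \<otimes>\<^bsub>P\<^esub> basis_elt r (r - 1) = \<zero>\<^bsub>P\<^esub>"
      if b: "b \<in> arcs (D_quiver n)" "arrow_head b = 2" "arrow_tail b = - array_entry l r r" for b
    proof -
      have pos: "(q, q) \<in> positions n" using q by (auto simp: positions_iff)
      let ?a = "arrow_between (array_entry l (q + 1) q) (array_entry l q q)"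
      note a = arrow_between_down[OF pos q(2)]
      have "basis_elt r (r - 1) = arrow_cls n ?a \<otimes>\<^bsub>P\<^esub> basis_elt q q"
        using step.IH q a pos by (auto simp: r_def)
      moreover have "arrow_cls n b \<otimes>\<^bsub>P\<^esub> arrow_cls n ?a = \<zero>\<^bsub>P\<^esub>"
        using a b e q array_entry_diag_Suc[of q l] array_entry_less[of q "q + 1" l]
        by (intro opposite_arrows[of _ _ "array_entry l q q"]) (auto simp: r_def)
      ultimately show ?thesis
        using b a(1) pos by (simp add: H.S.m_assoc[symmetric] elt_closed)
    qed
    have down: "?down r c a"
      if "1 \<le> c" "c \<le> r" "a \<in> arcs (D_quiver n)" "arrow_head a = array_entry l r c"
        "arrow_tail a = array_entry l (r + 1) c" for c a
      using that
    proof (induction c arbitrary: a rule: dec_induct)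
      case base
      show ?case
      proof (cases "r + 1 < n")
        case True
        then show ?thesis using arrow_basis_elt_first_column[OF r(2)] base by auto
      next
        case False
        then have "arrow_tail a = int n" using base r by (auto simp: array_entry_less)
        then show ?thesis using A.tail_in_verts[OF base(2)] n by (auto simp: verts_D_quiver)
      qed
    next
      case (step c)
      have c: "1 \<le> c" "c < r" using step by auto
      have pos: "(r, c) \<in> positions n" using c r by (auto simp: positions_iff)
      let ?R = "arrow_between (array_entry l r (c + 1)) (array_entry l r c)"
      note R = arrow_between_right[OF pos c(2)]
      define j where "j = int r + 1 - int c"
      have j: "array_entry l r c = j" "2 \<le> j" "j \<le> int n - 1"
        using c r by (auto simp: array_entry_less j_def)
      have right: "basis_elt r (c + 1) = arrow_cls n ?R \<otimes>\<^bsub>P\<^esub> basis_elt r c"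
        using arrow_basis_elt_right[OF pos c(2)] R by simp
      have tail_a: "arrow_tail a = j"
        using step.prems c by (simp add: array_entry_less j_def)
      have a: "a \<in> arcs (D_quiver n)" by (rule step.prems)
      have head_a: "arrow_head a = array_entry l r (c + 1)" using step.prems by simp
      have assoc: "arrow_cls n x \<otimes>\<^bsub>P\<^esub> (arrow_cls n y \<otimes>\<^bsub>P\<^esub> basis_elt r c) =
          arrow_cls n x \<otimes>\<^bsub>P\<^esub> arrow_cls n y \<otimes>\<^bsub>P\<^esub> basis_elt r c"
        if "x \<in> arcs (D_quiver n)" "y \<in> arcs (D_quiver n)" for x y
        using that pos by (simp add: H.S.m_assoc elt_closed)
      \<comment> \<open>The other way around the square, down by the induction over the columns and
        then right. In the last row the move down already gives zero.\<close>
      have around: "arrow_cls n (X j) \<otimes>\<^bsub>P\<^esub> (arrow_cls n (Y (j + 1)) \<otimes>\<^bsub>P\<^esub> basis_elt r c) =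
          (if r + 1 < n then basis_elt (r + 1) (c + 1) else \<zero>\<^bsub>P\<^esub>)" if "j \<le> int n - 2"
      proof -
        have "arrow_cls n (Y (j + 1)) \<otimes>\<^bsub>P\<^esub> basis_elt r c =
            (if r + 1 < n then basis_elt (r + 1) c else \<zero>\<^bsub>P\<^esub>)"
          using step.IH[of "Y (j + 1)"] that j c arc_simps(2)[of "j + 1"]
          by (auto simp: array_entry_less j_def)
        moreover have "arrow_cls n (X j) \<otimes>\<^bsub>P\<^esub> basis_elt (r + 1) c = basis_elt (r + 1) (c + 1)" if "r + 1 < n"
          using that \<open>j \<le> int n - 2\<close> j c arc_simps(1)[of j]
          by (intro arrow_basis_elt_right) (auto simp: positions_iff array_entry_less j_def)
        ultimately show ?thesis using that j arc_simps(1)[of j] by (auto simp: elt_closed)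
      qed
      show ?case
      proof (cases "c + 1 = r")
        case True
        then have j2: "j = 2" by (simp add: j_def)
        define e where "e = array_entry l r r"
        have e1: "e = 1 \<or> e = -1" using diag by (auto simp: e_def)
        have w: "arrow_cls n b \<otimes>\<^bsub>P\<^esub> basis_elt r c = \<zero>\<^bsub>P\<^esub>"
          if "b \<in> arcs (D_quiver n)" "arrow_head b = 2" "arrow_tail b = - e" for b
        proof -
          have "r - 1 = c" using True by simp
          then show ?thesis using wrong[OF that(1,2)] that(3) by (simp only: e_def)
        qed
        have aR: "arrow_tail a = 2" "arrow_head a = e" "arrow_tail ?R = e" "arrow_head ?R = 2"
          using tail_a head_a R(2,3) j(1) j2 unfolding e_def True by simp_all
        \<comment> \<open>Of the two detours through 1 and -1 only the one through the last box of
          row \<open>r\<close> survives.\<close>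
        have "arrow_cls n (Y 2) \<otimes>\<^bsub>P\<^esub> (arrow_cls n (X 1) \<otimes>\<^bsub>P\<^esub> basis_elt r c) \<oplus>\<^bsub>P\<^esub>
            arrow_cls n Y' \<otimes>\<^bsub>P\<^esub> (arrow_cls n X' \<otimes>\<^bsub>P\<^esub> basis_elt r c) =
            arrow_cls n a \<otimes>\<^bsub>P\<^esub> (arrow_cls n ?R \<otimes>\<^bsub>P\<^esub> basis_elt r c)"
          using e1
        proof
          assume e: "e = 1"
          then have "a = Y 2" "?R = X 1"
            using aR a R(1) n by (auto intro!: arrow_eqI[of _ n] simp: arc_simps)
          moreover have "arrow_cls n X' \<otimes>\<^bsub>P\<^esub> basis_elt r c = \<zero>\<^bsub>P\<^esub>"
            using w[of X'] e by (simp add: arc_simps)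
          ultimately show ?thesis using n pos by (simp add: elt_closed arc_simps)
        next
          assume e: "e = -1"
          then have "a = Y'" "?R = X'"
            using aR a R(1) n by (auto intro!: arrow_eqI[of _ n] simp: arc_simps)
          moreover have "arrow_cls n (X 1) \<otimes>\<^bsub>P\<^esub> basis_elt r c = \<zero>\<^bsub>P\<^esub>"
            using w[of "X 1"] e n by (simp add: arc_simps)
          ultimately show ?thesis using n pos by (simp add: elt_closed arc_simps)
        qed
        moreover have "arrow_cls n (X 2) \<otimes>\<^bsub>P\<^esub> (arrow_cls n (Y 3) \<otimes>\<^bsub>P\<^esub> basis_elt r c) =
            arrow_cls n (Y 2) \<otimes>\<^bsub>P\<^esub> (arrow_cls n (X 1) \<otimes>\<^bsub>P\<^esub> basis_elt r c) \<oplus>\<^bsub>P\<^esub>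
            arrow_cls n Y' \<otimes>\<^bsub>P\<^esub> (arrow_cls n X' \<otimes>\<^bsub>P\<^esub> basis_elt r c)"
          using relations(3) n pos by (simp add: assoc elt_closed arc_simps H.S.l_distr)
        ultimately show ?thesis using around j2 n unfolding Suc_eq_plus1 right by simp
      next
        case False
        then have j3: "3 \<le> j" using c by (simp add: j_def)
        have "array_entry l r (c + 1) = j - 1" using False c by (simp add: array_entry_less j_def)
        then have aR: "a = Y j" "?R = X (j - 1)"
          using j j3 tail_a head_a a R by (auto intro!: arrow_eqI[of _ n] simp: arc_simps)
        show ?thesis
        proof (cases "j \<le> int n - 2")
          case True
          then show ?thesis
            using relations(5)[OF j3 True] around[OF True] j3 j
            unfolding Suc_eq_plus1 right aR by (simp add: assoc arc_simps)
        next
          case False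
          \<comment> \<open>This happens only at the box \<open>(n - 1, 1)\<close>, where the square
            degenerates to the relation at the vertex \<open>n - 1\<close>.\<close>
          then have jn: "j = int n - 1" using j by simp
          then have "\<not> r + 1 < n" using c r by (auto simp: j_def)
          moreover have "j - 1 = int n - 2" using jn by simp
          ultimately show ?thesis
            using relations(4) n pos unfolding Suc_eq_plus1 right aR jn
            by (simp add: assoc arc_simps elt_closed)
        qed
      qed
    qed
    show ?case using wrong down unfolding r_def[symmetric] Suc_eq_plus1 by (auto simp: positions_iff)
qed

lemma arrow_basis_elt_wrong_end:
  assumes "2 \<le> r" "r < n" "b \<in> arcs (D_quiver n)" "arrow_head b = 2" "arrow_tail b = - array_entry l r r"
  shows "arrow_cls n b \<otimes>\<^bsub>P\<^esub> basis_elt r (r - 1) = \<zero>\<^bsub>P\<^esub>"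
  using arrow_basis_elt_row[of r] assms by simp

lemma arrow_basis_elt_down:
  assumes "(r, c) \<in> positions n" "a \<in> arcs (D_quiver n)"
    and "arrow_head a = array_entry l r c" "arrow_tail a = array_entry l (r + 1) c"
  shows "arrow_cls n a \<otimes>\<^bsub>P\<^esub> basis_elt r c = (if r + 1 < n then basis_elt (r + 1) c else \<zero>\<^bsub>P\<^esub>)"
  using arrow_basis_elt_row[of r] assms by (simp add: positions_iff)

lemma arrow_cls_basis_elt:
  assumes rc: "(r, c) \<in> positions n" and a: "a \<in> arcs (D_quiver n)"
  shows "arrow_cls n a \<otimes>\<^bsub>P\<^esub> basis_elt r c =
    (case step n l a (r, c) of Some (r', c') \<Rightarrow> basis_elt r' c' | None \<Rightarrow> \<zero>\<^bsub>P\<^esub>)"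
proof (cases "arrow_head a = array_entry l r c")
  case False
  then show ?thesis by (simp add: arrow_basis_elt[OF assms] step_def)
next
  case head: True
  have r: "1 \<le> c" "c \<le> r" "r < n" "1 \<le> r" using rc by (auto simp: positions_iff)
  show ?thesis
  proof (cases "arrow_tail a = array_entry l (r + 1) c")
    case True
    have "\<not> (c < r \<and> array_entry l r (c + 1) = array_entry l (r + 1) c)"
      using array_entry_diag[OF l r(4)] r
      by (cases "c + 1 = r") (auto simp: array_entry_less)
    then show ?thesis
      using arrow_basis_elt_down[OF rc a head True] True head r
      by (auto simp: step_def)
  next
    case down: False
    show ?thesis
    proof (cases "c < r \<and> arrow_tail a = array_entry l r (c + 1)")
      case True
      then show ?thesis using arrow_basis_elt_right[OF rc _ a head] down head by (auto simp: step_def)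
    next
      case False
      have e: "array_entry l r r = 1 \<or> array_entry l r r = -1"
        using array_entry_diag[OF l r(4)] by auto
      \<comment> \<open>Vertex 2 has the three neighbours 3, 1 and -1, of which the array uses two
        at each box. At every other entry each arrow with that head matches a move down or to the
        right.\<close>
      have "c + 1 = r \<and> arrow_head a = 2 \<and> arrow_tail a = - array_entry l r r"
      proof (cases "c = r")
        case True
        then show ?thesis using head down a e r by (cases a) (auto simp: array_entry_less arcs_D_quiver)
      next
        case False
        then have "c < r" using r by simp
        then show ?thesis
          using head down a e r \<open>\<not> (c < r \<and> arrow_tail a = array_entry l r (c + 1))\<close>
          by (cases a; cases "c + 1 = r") (auto simp: array_entry_less arcs_D_quiver)
      qed
      moreover from this have "r - 1 = c" "2 \<le> r" using r by auto
      ultimately have "arrow_cls n a \<otimes>\<^bsub>P\<^esub> basis_elt r c = \<zero>\<^bsub>P\<^esub>"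
        using arrow_basis_elt_wrong_end[of r a] a r by (simp only:)
      moreover have "step n l a (r, c) = None" using False down by (auto simp: step_def)
      ultimately show ?thesis by simp
    qed
  qed
qed

end

section \<open>Linear independence\<close>

text \<open>The last arrow of the list acts first, as for left multiplication by a path.\<close>

fun run :: "nat \<Rightarrow> int \<Rightarrow> arrow list \<Rightarrow> nat \<times> nat \<Rightarrow> (nat \<times> nat) option" where
  "run n l [] x = Some x"
| "run n l (a # p) x = Option.bind (run n l p x) (step n l a)"

lemma run_append: "run n l (p @ q) x = Option.bind (run n l q x) (run n l p)"
  by (induction p) (auto simp: Option.bind_assoc intro: Option.bind_cong split: Option.bind_splits)

lemma step_SomeD:
  assumes "step n l a x = Some y"
  shows "arrow_tail a = case_prod (array_entry l) y" "arrow_head a = case_prod (array_entry l) x"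
    "x \<in> positions n \<Longrightarrow> y \<in> positions n"
  using assms by (auto simp: step_def positions_def split: prod.splits if_splits)

context type_D
begin

text \<open>The test at the end of the path makes trivial paths act as idempotents;
  \<open>run\<close> alone would let them act as the identity.\<close>

definition path_act :: "int \<times> arrow list \<Rightarrow> nat \<times> nat \<Rightarrow> (nat \<times> nat) option" where
  "path_act = (\<lambda>(u, p) x. if A.awlast u p = case_prod (array_entry l) x then run n l p x else None)"

lemma run_positions: "run n l p x = Some y \<Longrightarrow> x \<in> positions n \<Longrightarrow> y \<in> positions n"
  by (induction p arbitrary: y) (auto simp: bind_eq_Some_conv dest: step_SomeD(3))

lemma path_act_positions: "path_act t x = Some y \<Longrightarrow> x \<in> positions n \<Longrightarrow> y \<in> positions n"
  by (auto simp: path_act_def run_positions split: prod.splits if_splits)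

lemma path_act_start:
  assumes "(u, p) \<in> quiver_paths (D_quiver n)" "path_act (u, p) x = Some y"
  shows "case_prod (array_entry l) y = u"
proof (cases p)
  case Nil
  then show ?thesis using assms(2) by (auto simp: path_act_def split: if_splits)
next
  case (Cons a q)
  then have "u = arrow_tail a" using assms(1) by (simp add: quiver_path_Cons)
  moreover obtain z where "step n l a z = Some y"
    using assms(2) Cons by (auto simp: path_act_def bind_eq_Some_conv split: if_splits)
  ultimately show ?thesis using step_SomeD(1) by simp
qed

lemma path_act_append:
  assumes "(v, q) \<in> quiver_paths (D_quiver n)"
  shows "Option.bind (path_act (v, q) x) (path_act (u, p)) =
    (if A.awlast u p = v then path_act (u, p @ q) x else None)"
proof (cases "path_act (v, q) x")
  case None
  then show ?thesis by (auto simp: path_act_def A.awlast_append run_append split: if_splits)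
next
  case (Some y)
  have "case_prod (array_entry l) y = v" using path_act_start[OF assms Some] .
  moreover have "A.awlast v q = case_prod (array_entry l) x" "run n l q x = Some y"
    using Some by (auto simp: path_act_def split: if_splits)
  ultimately show ?thesis by (auto simp: Some path_act_def A.awlast_append run_append)
qed

text \<open>The matrix of the action of a path algebra element on the free module on the positions.\<close>

definition mat :: "'k path_elt \<Rightarrow> nat \<times> nat \<Rightarrow> nat \<times> nat \<Rightarrow> 'k" where
  "mat f y x = (\<Sum>t \<in> {t. f t \<noteq> 0}. if path_act t x = Some y then f t else 0)"

lemma mat_superset:
  assumes "finite T" "{t. f t \<noteq> 0} \<subseteq> T"
  shows "mat f y x = (\<Sum>t\<in>T. if path_act t x = Some y then f t else 0)"
  unfolding mat_def by (rule sum.mono_neutral_left) (use assms in auto)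

lemma mat_add:
  assumes "f \<in> carrier A" "g \<in> carrier A"
  shows "mat (\<lambda>q. f q + g q) y x = mat f y x + mat g y x"
proof -
  let ?T = "{t. f t \<noteq> 0} \<union> {t. g t \<noteq> 0}"
  have "finite ?T" using assms by (simp add: A.carrier_iff)
  moreover have "{t. f t + g t \<noteq> 0} \<subseteq> ?T" by auto
  ultimately show ?thesis
    by (simp add: mat_superset[of ?T] sum.distrib[symmetric] if_distrib cong: if_cong)
qed

lemma mat_scale: "mat (\<lambda>q. c * f q) y x = c * mat f y x"
proof (cases "c = 0")
  case True
  then show ?thesis by (simp add: mat_def)
next
  case False
  then show ?thesis by (auto simp: mat_def sum_distrib_left intro!: sum.cong)
qed

lemma mat_zero: "mat (\<lambda>_. 0) y x = 0"
  by (simp add: mat_def)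

lemma mat_path_elem: "mat (path_elem t) y x = (if path_act t x = Some y then 1 else 0)"
  by (subst mat_superset[of "{t}"]) (auto simp: path_elem_def)

lemma mat_diff:
  assumes "f \<in> carrier A" "g \<in> carrier A"
  shows "mat (f \<ominus>\<^bsub>A\<^esub> g) y x = mat f y x - mat g y x"
  using mat_add[OF assms(1) A.scaled_closed[OF assms(2), of "- 1"], of y x] mat_scale[of "- 1" g y x]
  by (simp add: A.minus_eq[OF assms])

lemma mat_minus:
  assumes "f \<in> carrier A"
  shows "mat (\<ominus>\<^bsub>A\<^esub> f) y x = - mat f y x"
proof -
  have "mat (f \<oplus>\<^bsub>A\<^esub> \<ominus>\<^bsub>A\<^esub> f) y x = 0" using assms by (simp add: A.r_neg) (simp add: A.zero_eq mat_zero)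
  then show ?thesis using mat_add[OF assms A.a_inv_closed[OF assms], of y x]
    by (simp add: A.add_eq add_eq_0_iff)
qed

lemma scaled_mult:
  "(\<lambda>q. c * f q) \<otimes>\<^bsub>A\<^esub> g = (\<lambda>q. c * (f \<otimes>\<^bsub>A\<^esub> g) q)"
  "f \<otimes>\<^bsub>A\<^esub> (\<lambda>q. c * g q) = (\<lambda>q. c * (f \<otimes>\<^bsub>A\<^esub> g) q)"
  by (auto simp: fun_eq_iff A.mult_eq sum_distrib_left algebra_simps)

lemma finite_positions: "finite (positions n)"
  by (metis List.finite_set set_array_positions)

text \<open>By bilinearity both factors may be taken to be paths. Paths act by partial maps, so at
  most one intermediate position contributes, and the claim becomes
  \<open>path_act_append\<close>.\<close>

lemma mat_mult:
  assumes "f \<in> carrier A" "g \<in> carrier A" "x \<in> positions n"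
  shows "mat (f \<otimes>\<^bsub>A\<^esub> g) y x = (\<Sum>z\<in>positions n. mat f y z * mat g z x)"
  using assms(1)
proof (induction rule: A.path_algebra_induct)
  case zero
  then show ?case using assms(2) by (simp add: mat_zero A.zero_eq[symmetric]) (simp add: A.zero_eq mat_zero)
next
  case (add f f')
  then show ?case
    using assms(2) by (simp add: A.l_distr) (simp add: A.add_eq mat_add sum.distrib distrib_right)
next
  case (path c u p)
  have pc: "path_elem (u, p) \<in> carrier A" using path by (rule A.path_elem_closed)
  have "mat (path_elem (u, p) \<otimes>\<^bsub>A\<^esub> g) y x = (\<Sum>z\<in>positions n. mat (path_elem (u, p)) y z * mat g z x)"
    using assms(2)
  proof (induction rule: A.path_algebra_induct)
    case zero
    then show ?case using pc by (simp add: mat_zero A.zero_eq[symmetric]) (simp add: A.zero_eq mat_zero)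
  next
    case (add g g')
    then show ?case
      using pc by (simp add: A.r_distr) (simp add: A.add_eq mat_add sum.distrib distrib_left)
  next
    case (path d v q)
    have "mat (path_elem (u, p) \<otimes>\<^bsub>A\<^esub> path_elem (v, q)) y x =
        (if Option.bind (path_act (v, q) x) (path_act (u, p)) = Some y then 1 else 0)"
      unfolding path_act_append[OF path] A.path_elem_mult
      by (simp add: mat_path_elem A.zero_eq mat_zero)
    also have "\<dots> = (\<Sum>z\<in>positions n. mat (path_elem (u, p)) y z * mat (path_elem (v, q)) z x)"
    proof (cases "path_act (v, q) x")
      case None
      then show ?thesis by (simp add: mat_path_elem)
    next
      case (Some w)
      then have "w \<in> positions n" using path_act_positions assms(3) by blast
      moreover have "mat (path_elem (u, p)) y z * mat (path_elem (v, q)) z x =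
          (if z = w then mat (path_elem (u, p)) y w else 0)" for z
        using Some by (simp add: mat_path_elem)
      ultimately show ?thesis using finite_positions by (simp add: Some mat_path_elem)
    qed
    finally show ?case by (simp add: scaled_mult mat_scale sum_distrib_left mult.left_commute)
  qed
  then show ?case by (simp add: scaled_mult mat_scale sum_distrib_left mult.assoc)
qed

section \<open>The relations act as zero, so matrix entries are defined on classes\<close>

definition rep_kernel :: "'k path_elt set" where
  "rep_kernel = {f \<in> carrier A. \<forall>x \<in> positions n. \<forall>y \<in> positions n. mat f y x = 0}"

lemma rep_kernel_ideal: "ideal rep_kernel A"
proof (rule idealI)
  show "ring A" by (rule A.ring_axioms)
  show "subgroup rep_kernel (add_monoid A)"
  proof (rule A.add.subgroupI)
    show "rep_kernel \<noteq> {}"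
      using A.zero_closed by (auto simp: rep_kernel_def A.zero_eq mat_zero intro!: exI[of _ "\<lambda>_. 0"])
    show "\<ominus>\<^bsub>A\<^esub> f \<in> rep_kernel" if "f \<in> rep_kernel" for f
      using that by (auto simp: rep_kernel_def mat_minus)
  qed (auto simp: rep_kernel_def A.add_eq[symmetric], auto simp: A.add_eq mat_add)
qed (auto simp: rep_kernel_def mat_mult)

lemma arrow_path_mult_arrow_path:
  "arrow_head a = arrow_tail b \<Longrightarrow> arrow_path a \<otimes>\<^bsub>A\<^esub> arrow_path b = path_elem (arrow_tail a, [a, b])"
  by (simp add: arrow_path_mult arrow_path_def[of b])

text \<open>For a nontrivial path the end test in \<open>path_act\<close> is implied by the head
  test in \<open>step\<close>.\<close>

lemma path_act_two_arrows:
  "path_act (arrow_tail a, [a, b]) x = Option.bind (step n l b x) (step n l a)"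
  using step_SomeD(2)[of n l b x] by (cases "step n l b x") (auto simp: path_act_def)

lemma array_entry_cases:
  assumes "(r, c) \<in> positions n"
  obtains (diag) "c = r" "array_entry l r r = 1 \<or> array_entry l r r = -1"
  | (edge) "r = c + 1" "array_entry l r c = 2" "array_entry l r r = 1 \<or> array_entry l r r = -1"
  | (inner) "c + 1 < r" "array_entry l r c = int r + 1 - int c" "array_entry l r (c + 1) = int r - int c"
proof -
  have "array_entry l r r = 1 \<or> array_entry l r r = -1"
    using array_entry_diag[OF l, of r] assms by (auto simp: positions_iff)
  moreover have "c = r \<or> r = c + 1 \<or> c + 1 < r" using assms by (auto simp: positions_iff)
  ultimately show ?thesis using that by (auto simp: array_entry_less)
qed

text \<open>Each relation compares routes in the array. By \<open>diag\<close> the ends of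
  consecutive rows have opposite entries, so a walk from an end to 2 and back is impossible; by
  \<open>next_entry\<close> two moves to the right never return to the starting entry; what remains
  are the two ways around one square, or a square cut off by the last row.\<close>

lemma mat_relations:
  assumes x: "x \<in> positions n"
  shows "mat (arrow_path (X 1) \<otimes>\<^bsub>A\<^esub> arrow_path (Y 2)) y x = 0"
    "mat (arrow_path X' \<otimes>\<^bsub>A\<^esub> arrow_path Y') y x = 0"
    "mat (arrow_path (Y (int n - 1)) \<otimes>\<^bsub>A\<^esub> arrow_path (X (int n - 2))) y x = 0"
    "mat (arrow_path (X 2) \<otimes>\<^bsub>A\<^esub> arrow_path (Y 3)) y x =
      mat (arrow_path (Y 2) \<otimes>\<^bsub>A\<^esub> arrow_path (X 1)) y x + mat (arrow_path Y' \<otimes>\<^bsub>A\<^esub> arrow_path X') y x"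
    "3 \<le> i \<Longrightarrow> i \<le> int n - 2 \<Longrightarrow> mat (arrow_path (X i) \<otimes>\<^bsub>A\<^esub> arrow_path (Y (i + 1))) y x =
      mat (arrow_path (Y i) \<otimes>\<^bsub>A\<^esub> arrow_path (X (i - 1))) y x"
proof -
  obtain r c where rc: "x = (r, c)" by (cases x)
  have r: "1 \<le> c" "c \<le> r" "r < n" using x rc by (auto simp: positions_iff)
  have diag: "array_entry l (Suc r) (Suc r) = - array_entry l r r"
    using r by (intro array_entry_diag_Suc) auto
  have next_entry: "array_entry l r (Suc (Suc c)) < int r - int c" if "Suc c < r"
    using that array_entry_diag[OF l, of r] by (cases "Suc (Suc c) = r") (auto simp: array_entry_less)
  note * = arrow_path_mult_arrow_path mat_path_elem path_act_two_arrows[of "X i" for i, simplified]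
    path_act_two_arrows[of "Y i" for i, simplified] path_act_two_arrows[of X', simplified]
    path_act_two_arrows[of Y', simplified]
  show "mat (arrow_path (X 1) \<otimes>\<^bsub>A\<^esub> arrow_path (Y 2)) y x = 0"
    using x[unfolded rc] n r diag next_entry unfolding rc
    by (cases rule: array_entry_cases; auto simp: * step_def array_entry_less)
  show "mat (arrow_path X' \<otimes>\<^bsub>A\<^esub> arrow_path Y') y x = 0"
    using x[unfolded rc] n r diag next_entry unfolding rc
    by (cases rule: array_entry_cases; auto simp: * step_def array_entry_less)
  show "mat (arrow_path (Y (int n - 1)) \<otimes>\<^bsub>A\<^esub> arrow_path (X (int n - 2))) y x = 0"
    using x[unfolded rc] n r diag next_entry unfolding rc
    by (cases rule: array_entry_cases; auto simp: * step_def array_entry_less)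
  show "mat (arrow_path (X 2) \<otimes>\<^bsub>A\<^esub> arrow_path (Y 3)) y x =
      mat (arrow_path (Y 2) \<otimes>\<^bsub>A\<^esub> arrow_path (X 1)) y x + mat (arrow_path Y' \<otimes>\<^bsub>A\<^esub> arrow_path X') y x"
    using x[unfolded rc] n r diag next_entry unfolding rc
    by (cases rule: array_entry_cases; auto simp: * step_def array_entry_less)
  show "3 \<le> i \<Longrightarrow> i \<le> int n - 2 \<Longrightarrow> mat (arrow_path (X i) \<otimes>\<^bsub>A\<^esub> arrow_path (Y (i + 1))) y x =
      mat (arrow_path (Y i) \<otimes>\<^bsub>A\<^esub> arrow_path (X (i - 1))) y x"
    using x[unfolded rc] n r diag next_entry unfolding rc
    by (cases rule: array_entry_cases; auto simp: * step_def array_entry_less)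
qed

lemma D_ideal_subset_rep_kernel: "D_ideal n \<subseteq> rep_kernel"
  unfolding D_ideal_def A_eq[symmetric]
proof (rule A.genideal_minimal[OF rep_kernel_ideal])
  note c = arrow_path_closed[OF arc_simps(1)] arrow_path_closed[OF arc_simps(2)]
    arrow_path_closed[OF arc_simps(3)] arrow_path_closed[OF arc_simps(4)]
  have add: "mat (f \<oplus>\<^bsub>A\<^esub> g) y x = mat f y x + mat g y x" if "f \<in> carrier A" "g \<in> carrier A" for f g y x
    using mat_add[OF that] by (simp add: A.add_eq)
  show "D_relations n \<subseteq> rep_kernel"
    unfolding rep_kernel_def using D_relations_closed n
    by (auto simp: D_relations_def Let_def A_eq[symmetric] mat_relations mat_diff add c)
qed

lemma mat_eq_zero:
  assumes "f \<in> carrier A" "cls f = \<zero>\<^bsub>P\<^esub>" "x \<in> positions n" "y \<in> positions n"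
  shows "mat f y x = 0"
  using D_ideal_subset_rep_kernel assms by (auto simp: cls_eq_zero_iff rep_kernel_def)

lemma mat_cong:
  assumes "f \<in> carrier A" "g \<in> carrier A" "cls f = cls g" "x \<in> positions n" "y \<in> positions n"
  shows "mat f y x = mat g y x"
proof -
  have "cls (f \<ominus>\<^bsub>A\<^esub> g) = \<zero>\<^bsub>P\<^esub>" using assms(1-3) by (simp add: a_minus_def H.S.r_neg)
  then show ?thesis
    using mat_eq_zero[of "f \<ominus>\<^bsub>A\<^esub> g"] assms by (simp add: mat_diff)
qed

lemma path_act_array_path:
  assumes "(r, c) \<in> positions n"
  shows "path_act (array_entry l r c, array_path l r c) (1, 1) = Some (r, c)"
proof -
  have "run n l (array_path l r c) (1, 1) = Some (r, c)"
    using assms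
  proof (induction rule: positions_induct)
    case start
    show ?case unfolding array_path_start by simp
  next
    case (down r)
    then have "1 \<le> r" by (simp add: positions_iff)
    then show ?case
      using arrow_between_down[OF down(1,2)] down(2,3) less_diff_conv[of r n 1]
      unfolding array_path_down[OF \<open>1 \<le> r\<close>] by (simp add: step_def)
  next
    case (right r c)
    have r: "1 \<le> c" "1 \<le> r" "c < r" using right(1,2) by (auto simp: positions_iff)
    \<comment> \<open>\<open>step\<close> tests the move down first, and that test has to fail
      here.\<close>
    have "array_entry l r (c + 1) \<noteq> array_entry l (r + 1) c"
      using array_entry_diag[OF l r(2)] r by (cases "c + 1 = r") (auto simp: array_entry_less)
    then show ?case
      using arrow_between_right[OF right(1,2)] right(2,3) unfolding array_path_right[OF r(1)]
      by (simp add: step_def)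
  qed
  then show ?thesis
    using array_path_quiver_path[OF assms] array_entry_start by (simp add: path_act_def)
qed

lemma one_one_position: "(1, 1) \<in> positions n"
  using n by (simp add: positions_iff)

lemma mat_array_path:
  assumes "(r, c) \<in> positions n"
  shows "mat (path_elem (array_entry l r c, array_path l r c)) y (1, 1) = (if y = (r, c) then 1 else 0)"
  unfolding mat_path_elem path_act_array_path[OF assms] by auto

subsection \<open>Scalars\<close>

definition sc :: "'k \<Rightarrow> 'k preproj_elt" where
  "sc c = cls (\<lambda>q. c * \<one>\<^bsub>A\<^esub> q)"

lemma sc_arg_closed: "(\<lambda>q. c * \<one>\<^bsub>A\<^esub> q) \<in> carrier A"
  by (rule A.scaled_closed[OF A.one_closed])

lemma sc_closed: "sc c \<in> carrier P"
  unfolding sc_def by (intro cls_closed sc_arg_closed)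

lemma scalars_eq: "scalars n = range sc"
  by (simp add: scalars_def Let_def sc_def[abs_def] cls_def A_eq)

lemma sc_mult_cls: "f \<in> carrier A \<Longrightarrow> sc c \<otimes>\<^bsub>P\<^esub> cls f = cls (\<lambda>q. c * f q)"
  using A.scaled_one_mult[of f c] sc_arg_closed[of c] unfolding sc_def by (metis H.hom_mult)

lemma sc_commute: "p \<in> carrier P \<Longrightarrow> sc c \<otimes>\<^bsub>P\<^esub> p = p \<otimes>\<^bsub>P\<^esub> sc c"
  using A.scaled_one_mult[of _ c] A.mult_scaled_one[of _ c] sc_arg_closed[of c]
  unfolding sc_def carrier_P by (auto simp flip: H.hom_mult)

lemma sc_mult: "sc c \<otimes>\<^bsub>P\<^esub> sc d = sc (c * d)"
  unfolding sc_def[of d] sc_mult_cls[OF sc_arg_closed] by (simp add: sc_def mult.assoc)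

lemma sc_add: "sc c \<oplus>\<^bsub>P\<^esub> sc d = sc (c + d)"
  using H.hom_add[OF sc_arg_closed[of c] sc_arg_closed[of d]]
  by (simp add: sc_def A.add_eq distrib_right)

lemma sc_one: "sc 1 = \<one>\<^bsub>P\<^esub>"
  by (simp add: sc_def)

lemma sc_zero: "sc 0 = \<zero>\<^bsub>P\<^esub>"
  using H.hom_zero by (simp add: sc_def A.zero_eq)

text \<open>Otherwise the generator would vanish, although its coordinate at \<open>(1, 1)\<close>
  is 1.\<close>

lemma one_not_zero: "\<one>\<^bsub>P\<^esub> \<noteq> \<zero>\<^bsub>P\<^esub>"
proof
  assume "\<one>\<^bsub>P\<^esub> = \<zero>\<^bsub>P\<^esub>"
  then have "basis_elt 1 1 = \<zero>\<^bsub>P\<^esub>"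
    using basis_elt_closed[OF one_one_position] H.S.l_one H.S.l_null by metis
  then show False
    using mat_eq_zero[OF path_closed[OF one_one_position] _ one_one_position one_one_position]
      mat_array_path[OF one_one_position] unfolding basis_elt_def by simp
qed

lemma scalars_subfield: "subfield (scalars n) P"
proof (rule H.S.subfieldI)
  have minus: "\<ominus>\<^bsub>P\<^esub> sc c = sc (- c)" for c
    by (rule H.S.minus_equality) (simp_all add: sc_add sc_zero sc_closed)
  show "subcring (scalars n) P"
  proof (rule H.S.subcringI[OF H.S.subringI])
    show "\<one>\<^bsub>P\<^esub> \<in> scalars n" unfolding scalars_eq sc_one[symmetric] by blast
  qed (auto simp: scalars_eq sc_closed minus sc_mult sc_add mult.commute)
  show "Units (P\<lparr>carrier := scalars n\<rparr>) = scalars n - {\<zero>\<^bsub>P\<^esub>}"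
  proof (intro equalityI subsetI)
    fix x assume x: "x \<in> Units (P\<lparr>carrier := scalars n\<rparr>)"
    then obtain y where "x \<in> scalars n" "y \<in> scalars n" "y \<otimes>\<^bsub>P\<^esub> x = \<one>\<^bsub>P\<^esub>"
      by (auto simp: Units_def)
    then show "x \<in> scalars n - {\<zero>\<^bsub>P\<^esub>}" using one_not_zero by (auto simp: scalars_eq sc_closed)
  next
    fix x assume "x \<in> scalars n - {\<zero>\<^bsub>P\<^esub>}"
    then obtain c where c: "x = sc c" "c \<noteq> 0" using sc_zero by (auto simp: scalars_eq)
    then have "sc (inverse c) \<otimes>\<^bsub>P\<^esub> x = \<one>\<^bsub>P\<^esub>" "x \<otimes>\<^bsub>P\<^esub> sc (inverse c) = \<one>\<^bsub>P\<^esub>"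
      by (simp_all add: sc_mult sc_one)
    then show "x \<in> Units (P\<lparr>carrier := scalars n\<rparr>)"
      using c by (auto simp: Units_def scalars_eq)
  qed
qed

subsection \<open>Spans of basis elements\<close>

text \<open>Filtering the fixed list of positions, instead of choosing some enumeration of
  \<open>S\<close>, yields exactly the list of generators in the final statement.\<close>

definition span :: "(nat \<times> nat) set \<Rightarrow> 'k preproj_elt set" where
  "span S = H.S.Span (scalars n) (map (case_prod basis_elt) (filter (\<lambda>x. x \<in> S) (array_positions n)))"

lemma basis_list_closed: "set xs \<subseteq> positions n \<Longrightarrow> set (map (case_prod basis_elt) xs) \<subseteq> carrier P"
  using basis_elt_closed by auto

lemma span_closed [simp]: "span S \<subseteq> carrier P"
  and span_subgroup: "subgroup (span S) (add_monoid P)"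
  and span_smult: "v \<in> span S \<Longrightarrow> sc c \<otimes>\<^bsub>P\<^esub> v \<in> span S"
  and span_base: "x \<in> S \<Longrightarrow> x \<in> positions n \<Longrightarrow> case_prod basis_elt x \<in> span S"
proof -
  let ?us = "map (case_prod basis_elt) (filter (\<lambda>x. x \<in> S) (array_positions n))"
  have us: "set ?us \<subseteq> carrier P" by (rule basis_list_closed) (auto simp: set_array_positions)
  note K = scalars_subfield
  show "span S \<subseteq> carrier P" unfolding span_def by (rule H.S.Span_subgroup_props(1)[OF K us])
  show "subgroup (span S) (add_monoid P)" unfolding span_def by (rule H.S.Span_is_add_subgroup[OF K us])
  show "sc c \<otimes>\<^bsub>P\<^esub> v \<in> span S" if "v \<in> span S"
    using that unfolding span_def by (intro H.S.Span_smult_closed[OF K us]) (simp_all add: scalars_eq)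
  show "case_prod basis_elt x \<in> span S" if "x \<in> S" "x \<in> positions n"
  proof -
    have "case_prod basis_elt x \<in> set ?us" using that by (auto simp: set_array_positions)
    then show ?thesis unfolding span_def using H.S.Span_base_incl[OF K us] by blast
  qed
qed

lemma span_zero: "\<zero>\<^bsub>P\<^esub> \<in> span S"
  using subgroup.one_closed[OF span_subgroup] by simp

lemma span_add: "u \<in> span S \<Longrightarrow> v \<in> span S \<Longrightarrow> u \<oplus>\<^bsub>P\<^esub> v \<in> span S"
  using subgroup.m_closed[OF span_subgroup] by simp

text \<open>Scalars are put into the base case, so \<open>E\<close> need only be an additive
  subgroup; ideals and preimages under left multiplication then qualify directly.\<close>

lemma span_induct:
  assumes E: "subgroup E (add_monoid P)"
    and base: "\<And>r c k. (r, c) \<in> S \<Longrightarrow> (r, c) \<in> positions n \<Longrightarrow> sc k \<otimes>\<^bsub>P\<^esub> basis_elt r c \<in> E"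
  shows "span S \<subseteq> E"
  unfolding span_def
proof (rule H.S.Span_min[OF scalars_subfield _ E])
  show "set (map (case_prod basis_elt) (filter (\<lambda>x. x \<in> S) (array_positions n))) \<subseteq> carrier P"
    by (rule basis_list_closed) (auto simp: set_array_positions)
  show "scalars n <#>\<^bsub>P\<^esub> set (map (case_prod basis_elt) (filter (\<lambda>x. x \<in> S) (array_positions n))) \<subseteq> E"
    using base by (auto simp: set_mult_def scalars_eq set_array_positions)
qed

lemma mat_vanishing_subgroup:
  assumes y: "y \<in> positions n"
  shows "subgroup (cls ` {f \<in> carrier A. mat f y (1, 1) = 0}) (add_monoid P)"
proof (rule H.S.add.subgroupI)
  let ?E = "cls ` {f \<in> carrier A. mat f y (1, 1) = 0}"
  show "?E \<subseteq> carrier P" by auto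
  have "\<zero>\<^bsub>A\<^esub> \<in> {f \<in> carrier A. mat f y (1, 1) = 0}" by (simp add: A.zero_eq mat_zero A.zero_closed[unfolded A.zero_eq])
  then show "?E \<noteq> {}" by blast
  show "\<ominus>\<^bsub>P\<^esub> a \<in> ?E" if "a \<in> ?E" for a
  proof -
    from that obtain f where f: "f \<in> carrier A" "mat f y (1, 1) = 0" "a = cls f" by auto
    then have "\<ominus>\<^bsub>A\<^esub> f \<in> {f \<in> carrier A. mat f y (1, 1) = 0}" "\<ominus>\<^bsub>P\<^esub> a = cls (\<ominus>\<^bsub>A\<^esub> f)"
      by (simp_all add: mat_minus)
    then show ?thesis by blast
  qed
  show "a \<oplus>\<^bsub>P\<^esub> b \<in> ?E" if ab: "a \<in> ?E" "b \<in> ?E" for a b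
  proof -
    from ab obtain f g where f: "f \<in> carrier A" "mat f y (1, 1) = 0" "a = cls f"
      and g: "g \<in> carrier A" "mat g y (1, 1) = 0" "b = cls g" by auto
    have "mat (f \<oplus>\<^bsub>A\<^esub> g) y (1, 1) = 0" using mat_add[OF f(1) g(1)] f g by (simp add: A.add_eq)
    moreover have "a \<oplus>\<^bsub>P\<^esub> b = cls (f \<oplus>\<^bsub>A\<^esub> g)" using f g by simp
    ultimately show ?thesis using f(1) g(1) by (metis (mono_tags, lifting) A.a_closed imageI mem_Collect_eq)
  qed
qed

text \<open>\<open>mat f (r, c) (1, 1)\<close> serves as the coordinate at \<open>(r, c)\<close>: it
  depends only on the class of \<open>f\<close>, vanishes on all other basis elements and is 1 on
  this one.\<close>

lemma basis_independent:
  assumes "distinct xs" "set xs \<subseteq> positions n"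
  shows "H.S.independent (scalars n) (map (case_prod basis_elt) xs)"
  using assms
proof (induction xs)
  case (Cons x xs)
  obtain r c where x: "x = (r, c)" by (cases x)
  have rc: "(r, c) \<in> positions n" using Cons.prems x by auto
  let ?E = "cls ` {f \<in> carrier A. mat f (r, c) (1, 1) = 0}"
  have "H.S.Span (scalars n) (map (case_prod basis_elt) xs) \<subseteq> ?E"
  proof (rule H.S.Span_min[OF scalars_subfield _ mat_vanishing_subgroup[OF rc]])
    show "set (map (case_prod basis_elt) xs) \<subseteq> carrier P"
      using basis_list_closed Cons.prems by auto
    have "sc k \<otimes>\<^bsub>P\<^esub> basis_elt r' c' \<in> ?E" if "(r', c') \<in> set xs" for k r' c'
    proof -
      have *: "(r', c') \<in> positions n" "(r, c) \<noteq> (r', c')" using that Cons.prems x by auto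
      let ?p = "path_elem (array_entry l r' c', array_path l r' c') :: 'k path_elt"
      have "mat (\<lambda>q. k * ?p q) (r, c) (1, 1) = 0"
        unfolding mat_scale mat_array_path[OF *(1)] using *(2) by auto
      then show ?thesis
        unfolding basis_elt_def sc_mult_cls[OF path_closed[OF *(1)]]
        using A.scaled_closed[OF path_closed[OF *(1)], of k] by blast
    qed
    then show "scalars n <#>\<^bsub>P\<^esub> set (map (case_prod basis_elt) xs) \<subseteq> ?E"
      by (auto simp: set_mult_def scalars_eq)
  qed
  moreover have "basis_elt r c \<notin> ?E"
  proof
    assume "basis_elt r c \<in> ?E"
    then obtain f where f: "f \<in> carrier A" "mat f (r, c) (1, 1) = 0" "basis_elt r c = cls f" by auto
    have "mat f (r, c) (1, 1) = 1"
      using mat_cong[OF f(1) path_closed[OF rc] f(3)[unfolded basis_elt_def, symmetric] one_one_position rc]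
        mat_array_path[OF rc] by simp
    then show False using f(2) by simp
  qed
  ultimately show ?case
    using Cons basis_elt_closed[OF rc] x by (auto intro!: H.S.independent.intros(2))
qed simp

end

section \<open>Ideals attached to words\<close>

context type_D
begin

lemma l_vert: "l \<in> verts (D_quiver n)"
  using l n by (auto simp: verts_D_quiver)

section \<open>Left submodules spanned by sets of positions\<close>

definition closed_down :: "(nat \<times> nat) set \<Rightarrow> bool" where
  "closed_down S \<longleftrightarrow> (\<forall>x\<in>S. \<forall>y\<in>positions n. y \<in> successors x \<longrightarrow> y \<in> S)"

lemma step_successors: "step n l a x = Some y \<Longrightarrow> y \<in> successors x"
  by (auto simp: step_def successors_def split: prod.splits if_splits)

lemma left_mult_preimage_subgroup:
  assumes "g \<in> carrier P" "subgroup E (add_monoid P)"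
  shows "subgroup {v \<in> carrier P. g \<otimes>\<^bsub>P\<^esub> v \<in> E} (add_monoid P)"
proof (rule H.S.add.subgroupI)
  show "{v \<in> carrier P. g \<otimes>\<^bsub>P\<^esub> v \<in> E} \<noteq> {}"
    using assms(1) subgroup.one_closed[OF assms(2)] by (auto intro!: exI[of _ "\<zero>\<^bsub>P\<^esub>"])
  show "\<ominus>\<^bsub>P\<^esub> a \<in> {v \<in> carrier P. g \<otimes>\<^bsub>P\<^esub> v \<in> E}" if "a \<in> {v \<in> carrier P. g \<otimes>\<^bsub>P\<^esub> v \<in> E}" for a
  proof -
    have "\<ominus>\<^bsub>P\<^esub> (g \<otimes>\<^bsub>P\<^esub> a) \<in> E"
      using that subgroup.m_inv_closed[OF assms(2)] by (simp only: a_inv_def mem_Collect_eq)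
    then show ?thesis using that assms(1) by (simp add: H.S.r_minus)
  qed
qed (use assms(1) subgroup.m_closed[OF assms(2)] in \<open>auto simp: H.S.r_distr\<close>)

lemma left_mult_span:
  assumes g: "g \<in> carrier P"
    and base: "\<And>r c. (r, c) \<in> S \<Longrightarrow> (r, c) \<in> positions n \<Longrightarrow> g \<otimes>\<^bsub>P\<^esub> basis_elt r c \<in> span S'"
    and v: "v \<in> span S"
  shows "g \<otimes>\<^bsub>P\<^esub> v \<in> span S'"
proof -
  have "span S \<subseteq> {v \<in> carrier P. g \<otimes>\<^bsub>P\<^esub> v \<in> span S'}"
  proof (rule span_induct[OF left_mult_preimage_subgroup[OF g span_subgroup]])
    fix r c k assume *: "(r, c) \<in> S" "(r, c) \<in> positions n"
    have "g \<otimes>\<^bsub>P\<^esub> (sc k \<otimes>\<^bsub>P\<^esub> basis_elt r c) = sc k \<otimes>\<^bsub>P\<^esub> (g \<otimes>\<^bsub>P\<^esub> basis_elt r c)"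
      using g basis_elt_closed[OF *(2)] sc_closed[of k] sc_commute[OF g, of k]
      by (metis H.S.m_assoc)
    then show "sc k \<otimes>\<^bsub>P\<^esub> basis_elt r c \<in> {v \<in> carrier P. g \<otimes>\<^bsub>P\<^esub> v \<in> span S'}"
      using span_smult[OF base[OF *]] basis_elt_closed[OF *(2)] sc_closed[of k] by simp
  qed
  then show ?thesis using v by auto
qed

lemma arrow_span:
  assumes "closed_down S" "a \<in> arcs (D_quiver n)" "v \<in> span S"
  shows "arrow_cls n a \<otimes>\<^bsub>P\<^esub> v \<in> span S"
proof (rule left_mult_span[OF arrow_cls_closed[OF assms(2)] _ assms(3)])
  fix r c assume *: "(r, c) \<in> S" "(r, c) \<in> positions n"
  show "arrow_cls n a \<otimes>\<^bsub>P\<^esub> basis_elt r c \<in> span S"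
  proof (cases "step n l a (r, c)")
    case None
    then show ?thesis by (simp add: arrow_cls_basis_elt[OF *(2) assms(2)] span_zero)
  next
    case (Some y)
    then have "y \<in> positions n" "y \<in> successors (r, c)"
      using step_SomeD(3)[OF Some] step_successors *(2) by auto
    then have "y \<in> S" using assms(1) * unfolding closed_down_def by blast
    then show ?thesis
      using span_base[OF _ \<open>y \<in> positions n\<close>] Some
      by (cases y) (auto simp: arrow_cls_basis_elt[OF *(2) assms(2)])
  qed
qed

lemma idem_span:
  assumes "i \<in> verts (D_quiver n)" "v \<in> span S"
  shows "idem n i \<otimes>\<^bsub>P\<^esub> v \<in> span S"
  using span_base[of _ S] span_zero
  by (intro left_mult_span[OF idem_closed[OF assms(1)] _ assms(2)])
    (auto simp: idem_basis_elt[OF _ assms(1)])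

text \<open>Arrows move boxes to successors or kill them and idempotents keep or kill them, so a
  successor-closed set spans a left submodule.\<close>

lemma mult_span:
  assumes S: "closed_down S" and "g \<in> carrier P" and v: "v \<in> span S"
  shows "g \<otimes>\<^bsub>P\<^esub> v \<in> span S"
proof -
  have vP: "v \<in> carrier P" using v span_closed by blast
  have path: "cls (path_elem (u, p)) \<otimes>\<^bsub>P\<^esub> v \<in> span S" if "(u, p) \<in> quiver_paths (D_quiver n)" for u p
    using that
  proof (induction p arbitrary: u)
    case Nil
    then show ?case using idem_span v by (simp add: quiver_path_Nil flip: idem_eq)
  next
    case (Cons a p)
    then have a: "a \<in> arcs (D_quiver n)" "u = arrow_tail a"
      and p: "(arrow_head a, p) \<in> quiver_paths (D_quiver n)" by (auto simp: quiver_path_Cons)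
    have "cls (path_elem (u, a # p)) = arrow_cls n a \<otimes>\<^bsub>P\<^esub> cls (path_elem (arrow_head a, p))"
      using H.hom_mult[OF arrow_path_closed[OF a(1)] A.path_elem_closed[OF p]]
      by (simp add: arrow_path_mult arrow_cls_eq a(2))
    then have "cls (path_elem (u, a # p)) \<otimes>\<^bsub>P\<^esub> v =
        arrow_cls n a \<otimes>\<^bsub>P\<^esub> (cls (path_elem (arrow_head a, p)) \<otimes>\<^bsub>P\<^esub> v)"
      using vP arrow_cls_closed[OF a(1)] A.path_elem_closed[OF p] by (simp add: H.S.m_assoc)
    then show ?case using arrow_span[OF S a(1) Cons.IH[OF p]] by simp
  qed
  obtain f where f: "f \<in> carrier A" "g = cls f" using assms(2) by (auto simp: carrier_P)
  from f(1) have "cls f \<otimes>\<^bsub>P\<^esub> v \<in> span S"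
  proof (induction rule: A.path_algebra_induct)
    case zero
    then show ?case using vP span_zero by simp
  next
    case (add f g)
    then show ?case using vP span_add by (simp add: H.S.l_distr)
  next
    case (path c u p)
    have pc: "path_elem (u, p) \<in> carrier A" by (rule A.path_elem_closed[OF path])
    then have "cls (\<lambda>q. c * path_elem (u, p) q) \<otimes>\<^bsub>P\<^esub> v = sc c \<otimes>\<^bsub>P\<^esub> (cls (path_elem (u, p)) \<otimes>\<^bsub>P\<^esub> v)"
      using vP sc_closed by (simp add: H.S.m_assoc flip: sc_mult_cls)
    then show ?case using span_smult assms \<open>(u, p) \<in> _\<close> \<open>\<And>u p. _ \<Longrightarrow> cls (path_elem (u, p)) \<otimes>\<^bsub>P\<^esub> v \<in> span S\<close> by simp
  qed
  then show ?thesis using f by simp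
qed

definition proj :: "'k preproj_elt set" where
  "proj = (\<lambda>h. h \<otimes>\<^bsub>P\<^esub> idem n l) ` carrier P"

lemma proj_idem: "v \<in> proj \<Longrightarrow> v \<otimes>\<^bsub>P\<^esub> idem n l = v"
proof -
  have pc: "path_elem (l, []) \<in> carrier A"
    by (intro A.path_elem_closed) (simp add: quiver_path_Nil l_vert)
  have "idem n l \<otimes>\<^bsub>P\<^esub> idem n l = (idem n l :: 'k preproj_elt)"
    using H.hom_mult[OF pc pc] by (simp add: idem_eq A.path_elem_mult)
  then show "v \<in> proj \<Longrightarrow> v \<otimes>\<^bsub>P\<^esub> idem n l = v"
    using idem_closed[OF l_vert] by (auto simp: proj_def H.S.m_assoc)
qed

lemma proj_closed: "proj \<subseteq> carrier P"
  using idem_closed[OF l_vert] by (auto simp: proj_def)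

text \<open>As the fixed points of right multiplication by an idempotent, the projective module is
  easy to intersect with two-sided ideals.\<close>

lemma mem_proj_iff: "v \<in> proj \<longleftrightarrow> v \<in> carrier P \<and> v \<otimes>\<^bsub>P\<^esub> idem n l = v"
  using proj_idem proj_closed by (auto simp: proj_def image_iff)

lemma proj_subgroup: "subgroup proj (add_monoid P)"
proof (rule H.S.add.subgroupI)
  show "proj \<subseteq> carrier P" by (rule proj_closed)
  show "proj \<noteq> {}" by (auto simp: proj_def)
qed (use idem_closed[OF l_vert] in \<open>auto simp: mem_proj_iff H.S.l_minus H.S.l_distr\<close>)

lemma span_subset_proj: "span S \<subseteq> proj"
proof (rule span_induct[OF proj_subgroup])
  fix r c k assume "(r, c) \<in> positions n"
  then show "sc k \<otimes>\<^bsub>P\<^esub> basis_elt r c \<in> proj"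
    using basis_elt_idem basis_elt_closed sc_closed idem_closed[OF l_vert]
    by (simp add: mem_proj_iff H.S.m_assoc)
qed

text \<open>The span of all boxes is a left submodule containing the generator, hence
  everything.\<close>

lemma span_positions: "span (positions n) = proj"
proof
  have "closed_down (positions n)" by (simp add: closed_down_def)
  moreover have "idem n l \<in> span (positions n)"
    using span_base[of "(1, 1)" "positions n"] one_one_position basis_elt_start by simp
  ultimately show "proj \<subseteq> span (positions n)"
    using mult_span by (auto simp: proj_def)
qed (rule span_subset_proj)

lemma span_list: "span (positions n) = H.S.Span (scalars n) (map (case_prod basis_elt) (array_positions n))"
proof -
  have "filter (\<lambda>x. x \<in> positions n) (array_positions n) = array_positions n"
    by (rule filter_True) (simp add: set_array_positions)
  then show ?thesis by (simp only: span_def)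
qed

lemma carrier_proj_module: "carrier (proj_module n l) = proj"
  by (auto simp: proj_module_def Let_def P_eq[symmetric] r_coset_def proj_def)

lemma array_basis_basis_elt: "array_basis n l basis_elt"
proof -
  have "idem n (array_entry l r c) \<otimes>\<^bsub>P\<^esub> basis_elt r c = basis_elt r c"
    if "(r, c) \<in> positions n" for r c
    using idem_basis_elt[OF that array_entry_verts[OF that]] by simp
  moreover have "arrow_cls n a \<otimes>\<^bsub>P\<^esub> basis_elt r c =
           (if r < n - 1 \<and> arrow_head a = array_entry l r c
                 \<and> arrow_tail a = array_entry l (r + 1) c then basis_elt (r + 1) c
            else if c < r \<and> arrow_head a = array_entry l r c
                 \<and> arrow_tail a = array_entry l r (c + 1) then basis_elt r (c + 1)
            else \<zero>\<^bsub>P\<^esub>)" if "(r, c) \<in> positions n" "a \<in> arcs (D_quiver n)" for r c a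
    unfolding arrow_cls_basis_elt[OF that] by (simp add: step_def)
  ultimately show ?thesis
    unfolding array_basis_def Let_def P_eq[symmetric] set_array_positions carrier_proj_module
      span_positions[symmetric] span_list
    using basis_elt_start basis_independent[OF distinct_array_positions] by (auto simp: set_array_positions)
qed

subsection \<open>Multiplication by the ideals of the vertices\<close>

lemma vertex_ideal_eq:
  "vertex_ideal n j = ideal_prod P ((\<lambda>h. h \<otimes>\<^bsub>P\<^esub> (\<one>\<^bsub>P\<^esub> \<ominus>\<^bsub>P\<^esub> idem n j)) ` carrier P) (carrier P)"
  by (simp add: vertex_ideal_def Let_def P_eq[symmetric] r_coset_def UNION_singleton_eq_range)

lemma word_ideal_Nil: "word_ideal n [] = carrier P"
  and word_ideal_Cons: "word_ideal n (j # js) = ideal_prod P (vertex_ideal n j) (word_ideal n js)"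
  by (simp_all add: word_ideal_def P_eq)

text \<open>The first factor is a left ideal and the second is the whole ring: a multiplier from the
  left is absorbed by the first factor, a sign or a multiplier from the right by the second.\<close>

lemma vertex_ideal_ideal:
  assumes "j \<in> verts (D_quiver n)"
  shows "ideal (vertex_ideal n j) P"
proof -
  let ?d = "\<one>\<^bsub>P\<^esub> \<ominus>\<^bsub>P\<^esub> idem n j"
  have d: "?d \<in> carrier P" using idem_closed[OF assms] by simp
  have closed: "v \<in> carrier P" if "v \<in> vertex_ideal n j" for v
    using that unfolding vertex_ideal_eq by induction (use d in auto)
  have minus: "\<ominus>\<^bsub>P\<^esub> v \<in> vertex_ideal n j" if "v \<in> vertex_ideal n j" for v
    using that unfolding vertex_ideal_eq
  proof induction
    case (prod i k)
    then have "\<ominus>\<^bsub>P\<^esub> (i \<otimes>\<^bsub>P\<^esub> k) = i \<otimes>\<^bsub>P\<^esub> (\<ominus>\<^bsub>P\<^esub> k)" using d by (auto simp: H.S.r_minus)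
    then show ?case using prod by (auto intro: ideal_prod.prod)
  next
    case (sum s t)
    then have "s \<in> carrier P" "t \<in> carrier P" using closed unfolding vertex_ideal_eq by auto
    then show ?case using sum by (auto simp: H.S.minus_add intro: ideal_prod.sum)
  qed
  show ?thesis
  proof (rule idealI)
    show "ring P" by (rule H.S.ring_axioms)
    show "subgroup (vertex_ideal n j) (add_monoid P)"
    proof (rule H.S.add.subgroupI)
      have "(\<one>\<^bsub>P\<^esub> \<otimes>\<^bsub>P\<^esub> ?d) \<otimes>\<^bsub>P\<^esub> \<one>\<^bsub>P\<^esub> \<in> vertex_ideal n j"
        unfolding vertex_ideal_eq
        by (rule ideal_prod.prod, rule image_eqI[OF refl], (rule H.S.one_closed)+)
      then show "(vertex_ideal n j :: 'k preproj_elt set) \<noteq> {}" by blast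
      show "\<ominus>\<^bsub>P\<^esub> v \<in> vertex_ideal n j" if "v \<in> vertex_ideal n j" for v by (rule minus[OF that])
      show "u \<oplus>\<^bsub>P\<^esub> v \<in> vertex_ideal n j" if "u \<in> vertex_ideal n j" "v \<in> vertex_ideal n j" for u v
        using that unfolding vertex_ideal_eq by (rule ideal_prod.sum)
    qed (use closed in auto)
    show "g \<otimes>\<^bsub>P\<^esub> v \<in> vertex_ideal n j" if "v \<in> vertex_ideal n j" "g \<in> carrier P" for v g
      using that unfolding vertex_ideal_eq
    proof induction
      case (prod i k)
      then obtain h where h: "h \<in> carrier P" "i = h \<otimes>\<^bsub>P\<^esub> ?d" by auto
      then have "g \<otimes>\<^bsub>P\<^esub> (i \<otimes>\<^bsub>P\<^esub> k) = ((g \<otimes>\<^bsub>P\<^esub> h) \<otimes>\<^bsub>P\<^esub> ?d) \<otimes>\<^bsub>P\<^esub> k"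
        using prod d by (simp add: H.S.m_assoc)
      moreover have "g \<otimes>\<^bsub>P\<^esub> h \<in> carrier P" using h prod by simp
      ultimately show ?case using prod by (metis (no_types, lifting) ideal_prod.prod imageI)
    next
      case (sum s t)
      then have "s \<in> carrier P" "t \<in> carrier P" using closed unfolding vertex_ideal_eq by auto
      then show ?case using sum by (auto simp: H.S.r_distr intro: ideal_prod.sum)
    qed
    show "v \<otimes>\<^bsub>P\<^esub> g \<in> vertex_ideal n j" if "v \<in> vertex_ideal n j" "g \<in> carrier P" for v g
      using that unfolding vertex_ideal_eq
    proof induction
      case (prod i k)
      then have "(i \<otimes>\<^bsub>P\<^esub> k) \<otimes>\<^bsub>P\<^esub> g = i \<otimes>\<^bsub>P\<^esub> (k \<otimes>\<^bsub>P\<^esub> g)" using d by (auto simp: H.S.m_assoc)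
      then show ?case using prod by (auto intro: ideal_prod.prod)
    next
      case (sum s t)
      then have "s \<in> carrier P" "t \<in> carrier P" using closed unfolding vertex_ideal_eq by auto
      then show ?case using sum by (auto simp: H.S.l_distr intro: ideal_prod.sum)
    qed
  qed
qed

lemma word_ideal_ideal: "set js \<subseteq> verts (D_quiver n) \<Longrightarrow> ideal (word_ideal n js) P"
  by (induction js)
    (simp_all add: word_ideal_Nil word_ideal_Cons H.S.oneideal H.S.ideal_prod_is_ideal vertex_ideal_ideal)

text \<open>Deletes the boxes of entry \<open>j\<close> that generate, that is, the part of the top
  of \<open>span S\<close> at the vertex \<open>j\<close>.\<close>

definition cut :: "int \<Rightarrow> (nat \<times> nat) set \<Rightarrow> (nat \<times> nat) set" where
  "cut j S = {(r, c) \<in> S. array_entry l r c \<noteq> j \<or> (\<exists>y \<in> S. (r, c) \<in> successors y)}"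

lemma successor_arrow:
  assumes "x \<in> positions n" "y \<in> positions n" "x \<in> successors y"
  obtains a where "a \<in> arcs (D_quiver n)" "step n l a y = Some x"
    "case_prod (array_entry l) y \<noteq> case_prod (array_entry l) x"
proof -
  obtain r c where y: "y = (r, c)" by (cases y)
  have yp: "(r, c) \<in> positions n" using assms y by simp
  have r: "1 \<le> r" "1 \<le> c" "c \<le> r" using yp by (auto simp: positions_iff)
  have neq: "array_entry l (r + 1) c \<noteq> array_entry l r c" "c < r \<Longrightarrow> array_entry l r (c + 1) \<noteq> array_entry l r c"
    "c < r \<Longrightarrow> array_entry l (r + 1) c \<noteq> array_entry l r (c + 1)"
    using array_entry_diag[OF l r(1)] r
    by (cases "c = r"; cases "c + 1 = r"; auto simp: array_entry_less)+
  from assms(3) y consider (down) "x = (r + 1, c)" | (right) "x = (r, c + 1)"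
    by (auto simp: successors_def)
  then show ?thesis
  proof cases
    case down
    then have "r + 1 < n" using assms(1) by (simp add: positions_iff)
    with arrow_between_down[OF yp] show ?thesis
      using neq(1) by (intro that) (auto simp: step_def y down)
  next
    case right
    then have c: "c < r" using assms(1) by (simp add: positions_iff)
    with arrow_between_right[OF yp] show ?thesis
      using neq(2,3) by (intro that) (auto simp: step_def y right)
  qed
qed

lemma closed_down_cut: "closed_down S \<Longrightarrow> S \<subseteq> positions n \<Longrightarrow> closed_down (cut j S)"
  unfolding closed_down_def cut_def by fastforce

text \<open>Multiplying by \<open>1 - e_j\<close> kills the boxes of entry \<open>j\<close>, and the
  ring regenerates those reached by an arrow from a box of \<open>S\<close>. Such an arrow starts
  from a box with a different entry, since adjacent boxes never share one.\<close>

lemma ideal_span_step: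
  assumes I: "ideal I P" and j: "j \<in> verts (D_quiver n)"
    and S: "closed_down S" "S \<subseteq> positions n" and eq: "I \<inter> proj = span S"
  shows "ideal_prod P (vertex_ideal n j) I \<inter> proj = span (cut j S)"
proof
  let ?d = "\<one>\<^bsub>P\<^esub> \<ominus>\<^bsub>P\<^esub> idem n j"
  let ?J = "ideal_prod P (vertex_ideal n j) I"
  interpret I: ideal I P by (rule I)
  interpret V: ideal "vertex_ideal n j" P by (rule vertex_ideal_ideal[OF j])
  have J: "ideal ?J P" using H.S.ideal_prod_is_ideal[OF V.ideal_axioms I] .
  interpret J: ideal ?J P by (rule J)
  have ej: "idem n j \<in> carrier P" by (rule idem_closed[OF j])
  have d: "?d \<in> carrier P" using ej by simp
  have d_base: "?d \<otimes>\<^bsub>P\<^esub> basis_elt r c = (if array_entry l r c = j then \<zero>\<^bsub>P\<^esub> else basis_elt r c)"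
    if "(r, c) \<in> positions n" for r c
  proof -
    have "?d \<otimes>\<^bsub>P\<^esub> basis_elt r c = basis_elt r c \<ominus>\<^bsub>P\<^esub> idem n j \<otimes>\<^bsub>P\<^esub> basis_elt r c"
      using basis_elt_closed[OF that] ej by (simp add: a_minus_def H.S.l_distr H.S.l_minus)
    then show ?thesis
      using basis_elt_closed[OF that] by (simp add: idem_basis_elt[OF that j] a_minus_def H.S.r_neg)
  qed
  have S': "closed_down (cut j S)" by (rule closed_down_cut[OF S])
  have d_span: "?d \<otimes>\<^bsub>P\<^esub> v \<in> span (cut j S)" if "v \<in> span S" for v
  proof (rule left_mult_span[OF d _ that])
    fix r c assume *: "(r, c) \<in> S" "(r, c) \<in> positions n"
    show "?d \<otimes>\<^bsub>P\<^esub> basis_elt r c \<in> span (cut j S)"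
      using span_base[of "(r, c)" "cut j S"] * span_zero by (auto simp: d_base[OF *(2)] cut_def)
  qed
  have V_span: "v \<otimes>\<^bsub>P\<^esub> y \<in> span (cut j S)" if "v \<in> vertex_ideal n j" "y \<in> span S" for v y
    using that(1) unfolding vertex_ideal_eq
  proof induction
    case (prod i k)
    then obtain h where h: "h \<in> carrier P" "i = h \<otimes>\<^bsub>P\<^esub> ?d" by auto
    have y: "y \<in> carrier P" using that(2) span_closed by blast
    \<comment> \<open>From the inside out: \<open>k\<close> stays in \<open>span S\<close>,
      \<open>?d\<close> moves into \<open>span (cut j S)\<close>, and \<open>h\<close> acts on the
      submodule obtained.\<close>
    have "(i \<otimes>\<^bsub>P\<^esub> k) \<otimes>\<^bsub>P\<^esub> y = h \<otimes>\<^bsub>P\<^esub> (?d \<otimes>\<^bsub>P\<^esub> (k \<otimes>\<^bsub>P\<^esub> y))"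
      using h d y prod by (simp add: H.S.m_assoc)
    then show ?case using mult_span[OF S' h(1) d_span[OF mult_span[OF S(1) _ that(2)]]] prod by simp
  next
    case (sum s t)
    then have "s \<in> carrier P" "t \<in> carrier P" using V.Icarr unfolding vertex_ideal_eq by auto
    moreover have "y \<in> carrier P" using that(2) span_closed by blast
    ultimately show ?case using sum span_add by (simp add: H.S.l_distr)
  qed
  show "?J \<inter> proj \<subseteq> span (cut j S)"
  proof
    fix x assume x: "x \<in> ?J \<inter> proj"
    have e: "idem n l \<in> carrier P" by (rule idem_closed[OF l_vert])
    \<comment> \<open>Elements of \<open>proj\<close> are unchanged by the idempotent, and on a
      product it can be moved into the factor from \<open>I\<close>, where it lands in
      \<open>I \<inter> proj\<close>.\<close>
    have "x \<otimes>\<^bsub>P\<^esub> idem n l \<in> span (cut j S)" if "x \<in> ?J" for x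
      using that
    proof induction
      case (prod v i)
      have "i \<otimes>\<^bsub>P\<^esub> idem n l \<in> span S"
        unfolding eq[symmetric] using prod e I.I_r_closed I.Icarr by (auto simp: proj_def)
      then show ?case using V_span prod V.Icarr I.Icarr e by (simp add: H.S.m_assoc)
    next
      case (sum s t)
      then show ?case using J.Icarr e span_add by (simp add: H.S.l_distr)
    qed
    then show "x \<in> span (cut j S)" using x proj_idem by fastforce
  qed
  have dV: "h \<otimes>\<^bsub>P\<^esub> ?d \<in> vertex_ideal n j" if "h \<in> carrier P" for h
    using ideal_prod.prod[of "h \<otimes>\<^bsub>P\<^esub> ?d" "(\<lambda>h. h \<otimes>\<^bsub>P\<^esub> ?d) ` carrier P" "\<one>\<^bsub>P\<^esub>" "carrier P" P] that d
    unfolding vertex_ideal_eq by simp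
  have base_I: "basis_elt r c \<in> I" if "(r, c) \<in> S" for r c
    using span_base[OF that] S(2) that eq by auto
  have base_J: "basis_elt r c \<in> ?J" if rc: "(r, c) \<in> cut j S" for r c
  proof -
    have rcS: "(r, c) \<in> S" "(r, c) \<in> positions n" using rc S(2) by (auto simp: cut_def)
    show ?thesis
    proof (cases "array_entry l r c = j")
      case False
      have "(\<one>\<^bsub>P\<^esub> \<otimes>\<^bsub>P\<^esub> ?d) \<otimes>\<^bsub>P\<^esub> basis_elt r c \<in> ?J"
        using dV[OF H.S.one_closed] base_I[OF rcS(1)] by (rule ideal_prod.prod)
      then show ?thesis using False d by (simp add: d_base[OF rcS(2)])
    next
      case True
      then obtain y where y: "y \<in> S" "(r, c) \<in> successors y" using rc by (auto simp: cut_def)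
      obtain r' c' where y': "y = (r', c')" by (cases y)
      have yp: "(r', c') \<in> positions n" using y y' S(2) by auto
      obtain a where a: "a \<in> arcs (D_quiver n)" "step n l a (r', c') = Some (r, c)"
        "array_entry l r' c' \<noteq> array_entry l r c"
        using successor_arrow[OF rcS(2) yp] y y' by auto
      \<comment> \<open>The predecessor survives \<open>?d\<close> because its entry is not
        \<open>j\<close>, and the arrow carries it to the box wanted.\<close>
      have "(arrow_cls n a \<otimes>\<^bsub>P\<^esub> ?d) \<otimes>\<^bsub>P\<^esub> basis_elt r' c' \<in> ?J"
        using dV[OF arrow_cls_closed[OF a(1)]] base_I y y' by (auto intro: ideal_prod.prod)
      also have "(arrow_cls n a \<otimes>\<^bsub>P\<^esub> ?d) \<otimes>\<^bsub>P\<^esub> basis_elt r' c' = basis_elt r c"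
        using a True arrow_cls_closed[OF a(1)] d basis_elt_closed[OF yp]
        by (simp add: H.S.m_assoc d_base[OF yp] arrow_cls_basis_elt[OF yp a(1)])
      finally show ?thesis .
    qed
  qed
  have "span (cut j S) \<subseteq> ?J"
  proof (rule span_induct[OF J.a_subgroup])
    fix r c k assume "(r, c) \<in> cut j S"
    then show "sc k \<otimes>\<^bsub>P\<^esub> basis_elt r c \<in> ?J" using base_J J.I_l_closed sc_closed by blast
  qed
  then show "span (cut j S) \<subseteq> ?J \<inter> proj" using span_subset_proj by blast
qed

section \<open>The ideal of a reduced word and the kernel of the quotient map\<close>

lemma removed_closed_down:
  assumes "signed_set n V"
  shows "closed_down (removed n V)"
proof -
  have "count_below V (a + 1) \<le> count_below V a" for a
    unfolding count_below_def using signed_set_finite[OF assms] by (intro card_mono) auto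
  note mono = this
  have "(r + 1, c) \<in> removed n V" if "(r, c) \<in> removed n V" "(r + 1, c) \<in> positions n" for r c
    using that mono[of "int r + 1 - int c"] by (auto simp: removed_def algebra_simps)
  moreover have "(r, c + 1) \<in> removed n V" if "(r, c) \<in> removed n V" "(r, c + 1) \<in> positions n" for r c
  proof -
    \<comment> \<open>Moving right raises \<open>c\<close> by one and lowers \<open>a\<close> by
      one, and the count grows by at most one; moving down keeps \<open>c\<close> while the count
      can only drop.\<close>
    have "1 \<le> int r + 1 - int c" using that by (auto simp: positions_iff)
    from count_below_Suc[OF assms this] show ?thesis
      using that by (auto simp: removed_def algebra_simps split: if_splits)
  qed
  ultimately show ?thesis unfolding closed_down_def successors_def by fastforce
qed

text \<open>The first letter contributes the leftmost factor of the ideal and the last left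
  multiplication of the permutation, so one induction on the list serves both sides. The empty word
  gives the whole ring, and nothing but removed positions.\<close>

lemma word_ideal_span:
  assumes "set js \<subseteq> verts (D_quiver n)" "weight (value_set n l (word_prod js)) = length js"
  shows "word_ideal n js \<inter> proj = span (removed n (value_set n l (word_prod js)))"
  using assms
proof (induction js)
  case Nil
  have "count_below (value_set n l id) (int r + 1 - int c) = 0" if "(r, c) \<in> positions n" for r c
    using that value_set_id_props(3)[of n l "int r + 1 - int c"] l n by (auto simp: positions_iff)
  then have "removed n (value_set n l id) = positions n"
    by (auto simp: removed_def positions_iff)
  then have "word_ideal n [] \<inter> proj = span (removed n (value_set n l id))"
    using span_positions proj_closed by (simp only: word_ideal_Nil) blast
  then show ?case by (simp only: word_prod_Nil)
next
  case (Cons j js)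
  have n2: "n \<ge> 2" using n by simp
  let ?V = "value_set n l (word_prod js)"
  have j: "j \<in> verts (D_quiver n)" and js: "set js \<subseteq> verts (D_quiver n)" using Cons.prems by auto
  have V: "signed_set n ?V" and par: "even (count_below ?V 0) \<longleftrightarrow> l = -1"
    using value_set_word_prod[OF js n2 l] by auto
  \<comment> \<open>The weight gains at most one per letter, so equality for the whole word forces
    equality for the tail and a gain of exactly one at \<open>j\<close>.\<close>
  have w: "weight ?V = length js" "weight (value_set n l (word_prod (j # js))) = weight ?V + 1"
    using weight_word_prod(1)[OF Cons.prems(1) n2 l] weight_le_length[OF js n2 l] Cons.prems(2) by auto
  have asc: "ascent j ?V" using weight_word_prod(2)[OF Cons.prems(1) n2 l] w(2) by blast
  have "word_ideal n (j # js) \<inter> proj = span (cut j (removed n ?V))"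
    unfolding word_ideal_Cons
    by (rule ideal_span_step[OF word_ideal_ideal[OF js] j removed_closed_down[OF V] _ Cons.IH[OF js w(1)]])
      (auto simp: removed_def)
  also have "cut j (removed n ?V) = removed n (simple_refl j ` ?V)"
    unfolding cut_def removed_simple_refl[OF V j asc n2 l par] ..
  also have "simple_refl j ` ?V = value_set n l (word_prod (j # js))"
    unfolding word_prod_Cons by (rule value_set_simple_refl[OF j l, symmetric])
  finally show ?case .
qed

text \<open>The quotient map of rings carries right multiples of the idempotent onto right multiples
  of its image, and its kernel on the projective module is the intersection with the ideal.\<close>

lemma quotient_map_epi:
  assumes I: "ideal (word_ideal n js) P"
  shows "(\<lambda>x. word_ideal n js +>\<^bsub>P\<^esub> x) \<in> module_epi P (proj_module n l) (J_module n l js)"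
    and "a_kernel (proj_module n l) (J_module n l js) (\<lambda>x. word_ideal n js +>\<^bsub>P\<^esub> x) = word_ideal n js \<inter> proj"
proof -
  let ?I = "word_ideal n js :: 'k preproj_elt set"
  let ?p = "\<lambda>x. ?I +>\<^bsub>P\<^esub> x"
  interpret W: ideal ?I P by (rule I)
  interpret Q: ring_hom_ring P "P Quot ?I" ?p by (rule W.rcos_ring_hom_ring)
  have e: "idem n l \<in> carrier P" by (rule idem_closed[OF l_vert])
  have J: "J_module n l js = \<lparr> carrier = carrier (P Quot ?I) #>\<^bsub>P Quot ?I\<^esub> ?p (idem n l), monoid.mult = undefined,
      one = undefined, zero = \<zero>\<^bsub>P Quot ?I\<^esub>, add = add (P Quot ?I), smult = (\<lambda>a x. ?p a \<otimes>\<^bsub>P Quot ?I\<^esub> x) \<rparr>"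
    by (simp add: J_module_def Let_def P_eq)
  have M: "proj_module n l = \<lparr> carrier = proj, monoid.mult = undefined,
      one = undefined, zero = \<zero>\<^bsub>P\<^esub>, add = add P, smult = monoid.mult P \<rparr>"
    using carrier_proj_module by (simp add: proj_module_def Let_def P_eq)
  have carrier_Q: "carrier (P Quot ?I) = ?p ` carrier P"
    unfolding FactRing_def A_RCOSETS_def' by auto
  have img: "?p ` proj = carrier (P Quot ?I) #>\<^bsub>P Quot ?I\<^esub> ?p (idem n l)"
    unfolding proj_def r_coset_def carrier_Q image_image using e by (auto simp: Q.hom_mult)
  show "?p \<in> module_epi P (proj_module n l) (J_module n l js)"
    unfolding module_epi_def
  proof (intro CollectI conjI ballI)
    show "?p ` carrier (proj_module n l) = carrier (J_module n l js)"
      unfolding J M using img by simp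
  next
    fix x y :: "'k preproj_elt"
    assume "x \<in> carrier (proj_module n l)" "y \<in> carrier (proj_module n l)"
    then have "x \<in> carrier P" "y \<in> carrier P" using proj_closed carrier_proj_module by blast+
    then show "?p (x \<oplus>\<^bsub>proj_module n l\<^esub> y) = ?p x \<oplus>\<^bsub>J_module n l js\<^esub> ?p y"
      unfolding J M by simp
  next
    fix a x :: "'k preproj_elt"
    assume "a \<in> carrier P" "x \<in> carrier (proj_module n l)"
    then have "a \<in> carrier P" "x \<in> carrier P" using proj_closed carrier_proj_module by blast+
    then show "?p (a \<odot>\<^bsub>proj_module n l\<^esub> x) = a \<odot>\<^bsub>J_module n l js\<^esub> ?p x"
      unfolding J M by simp
  qed
  have zero: "\<zero>\<^bsub>P Quot ?I\<^esub> = ?I" by (simp only: FactRing_def ring.simps)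
  have "?p x = \<zero>\<^bsub>P Quot ?I\<^esub> \<longleftrightarrow> x \<in> ?I" if "x \<in> carrier P" for x
    unfolding zero by (rule iffI[OF W.rcos_const_imp_mem[OF that] W.a_rcos_const])
  then show "a_kernel (proj_module n l) (J_module n l js) ?p = ?I \<inter> proj"
    unfolding a_kernel_def' J M using proj_closed by auto
qed

end

theorem theorem6p5:
  fixes n :: nat and l :: int and w :: "int \<Rightarrow> int" and js :: "int list"
  assumes "n \<ge> 4"
    and "l = 1 \<or> l = -1"
    and "join_irreducible n w"
    and "has_type n l w"
    and "reduced_word n w js"
  shows "(\<forall>m \<in> {2..n}. i_prime l w m = int m
            \<or> (\<exists>c \<in> {1..m - 1}. array_entry l (m - 1) c = i_prime l w m))
       \<and> (\<exists>b :: nat \<Rightarrow> nat \<Rightarrow> 'k::field preproj_elt. array_basis n l b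
            \<and> (let P = preproj n; p = (\<lambda>x. word_ideal n js +>\<^bsub>P\<^esub> x) in
                 p \<in> module_epi P (proj_module n l) (J_module n l js)
               \<and> a_kernel (proj_module n l) (J_module n l js) p
                   = ring.Span P (scalars n)
                       (map (case_prod b)
                          (filter (\<lambda>(r, c). \<not> in_subarray l w r c) (array_positions n)))))"
proof -
  define A :: "'k path_elt ring" where "A = path_algebra (D_quiver n)"
  define P :: "'k preproj_elt ring" where "P = preproj n"
  interpret type_D n l A P
    using assms(1,2) by (intro type_D.intro) (auto simp: A_def P_def)
  have n2: "n \<ge> 2" using assms(1) by simp
  have W: "w \<in> D_weyl n" using assms(3) by (simp add: join_irreducible_def)
  note w = D_weyl_has_type[OF W assms(4,2) n2]
  have js: "set js \<subseteq> verts (D_quiver n)" "word_prod js = w"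
    using assms(5) by (auto simp: reduced_word_def)
  note ker = word_ideal_span[OF js(1) reduced_word_ascents[OF w(1,2) n2 assms(2) w(3) assms(5)]]
  \<comment> \<open>The two predicates have to be compared only inside the triangle, where the
    listed positions lie.\<close>
  have "filter (\<lambda>(r, c). \<not> in_subarray l w r c) (array_positions n) =
      filter (\<lambda>x. x \<in> removed n (value_set n l w)) (array_positions n)"
    by (rule filter_cong) (auto simp: set_array_positions in_subarray_iff[OF w(1,2) assms(2) w(3)])
  then have "array_basis n l basis_elt
            \<and> (let P = preproj n; p = (\<lambda>x. word_ideal n js +>\<^bsub>P\<^esub> x) in
                 p \<in> module_epi P (proj_module n l) (J_module n l js)
               \<and> a_kernel (proj_module n l) (J_module n l js) p
                   = ring.Span P (scalars n)
                       (map (case_prod basis_elt)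
                          (filter (\<lambda>(r, c). \<not> in_subarray l w r c) (array_positions n))))"
    using array_basis_basis_elt quotient_map_epi[OF word_ideal_ideal[OF js(1)]] ker
    unfolding Let_def P_def[symmetric] span_def js(2) by simp
  then show ?thesis
    using i_prime_in_row[OF w(1,2) assms(2) w(3)] by auto
qed

end
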